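(* Consider the tracking model with true parameter $\bar Q$, and the estimation problem (EST) formed from $M$ observed trajectories, both described in the context. Suppose that: (1) $\nu_2\in\mathbb{Z}_+$ is known, $\nu_2\ge n+1$, $\mathbb{P}(\mathscr{N}\in[\nu_1,\nu_2])=1$ with $\nu_1\in\mathbb{Z}_+$, $\nu_1\le\nu_2$, and $\mathbb{P}(\mathscr{N}=\nu_2)>0$; (2) $(A,B)$ is controllable, $B$ has full column rank, and $A$ is invertible; (3) the random elements $(\bar{\boldsymbol{x}},\mathscr{N})$ and $\{\boldsymbol{w}_t\}_{t=1}^\infty$ are all independent (that is, $(\bar{\boldsymbol{x}},\mathscr{N}),\boldsymbol{w}_1,\boldsymbol{w}_2,\dots$ are mutually independent), the $\boldsymbol{w}_t$ are identically distributed with $\mathbb{E}[\boldsymbol{w}_t]=0$ and $\operatorname{cov}(\boldsymbol{w}_t,\boldsymbol{w}_t)=\Sigma_w\succ0$, where $\Sigma_w$ is known and $\|\Sigma_w\|_F<\infty$; (4) the conditional covariance of $\bar{\boldsymbol{x}}$ given $\mathscr{N}=\nu_2$ is strictly positive definite, and $\mathbb{E}[\|\bar{\boldsymbol{x}}\|^2]<\infty$; (5) $\bar Q\in\mathbb{G}(\varphi)=\{Q\in\mathbb{S}^n_+ : \|Q\|_F\le\varphi\}$ for some $0<\varphi<\infty$. Then the optimization problem (EST) admits an optimal solution. Moreover, for any such optimal solution $(Q_M^\star,q_{1:\nu_2}^\star,P_{1:\nu_2}^\star,\eta_{1:\nu_2}^\star,\xi_{1:\nu_2-1}^\star)$, $Q_M^\star\to\bar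 Q$ in probability as $M\to\infty$.
   Context: Notation: $\mathbb{S}^n_+$ is the set of real symmetric positive semidefinite $n\times n$ matrices, $\succeq,\succ$ refer to the Loewner order, $\|\cdot\|$ is the Euclidean norm, $\|\cdot\|_F$ the Frobenius norm, $\mathbb{Z}_+$ the positive integers, and $v_{a:b}$ denotes the tuple $(v_a,\dots,v_b)$. Forward problem. $A\in\mathbb{R}^{n\times n}$, $B\in\mathbb{R}^{n\times m}$ are given, and $x_1^r,\dots,x_{\nu_2}^r\in\mathbb{R}^n$ is a known reference signal. On a probability space there are a random initial state $\bar{\boldsymbol{x}}\in\mathbb{R}^n$, a random planning horizon $\mathscr{N}\in\{\nu_1,\dots,\nu_2\}$, and process noise vectors $\boldsymbol{w}_t\in\mathbb{R}^m$. Given a realization $(\bar x,N)$ of $(\bar{\boldsymbol{x}},\mathscr{N})$, the agent's states $\boldsymbol{x}_t\in\mathbb{R}^n$ and controls $\boldsymbol{u}_t\in\mathbb{R}^m$ are the optimal ones (controls being causal, i.e. $\boldsymbol{u}_t$ may depend on information up to time $t$ but not on $\boldsymbol{w}_t,\boldsymbol{w}_{t+1},\dots$) for minimizing $$\mathbb{E}\Big[\tfrac12(\boldsymbol{x}_{\nu_2}-x^r_{\nu_2})^T\bar Q(\boldsymbol{x}_{\nu_2}-x^r_{\nu_2})+\sum_{t=\nu_2-N+1}^{\nu_2-1}\Big(\tfrac12(\boldsymbol{x}_t-x_t^r)^T\bar Q(\boldsymbol{x}_t-x_t^r)+\tfrac12\|\boldsymbol{u}_t\|^2\Big)\Big]$$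 (expectation over the noise) subject to $\boldsymbol{x}_{t+1}=A\boldsymbol{x}_t+B(\boldsymbol{u}_t+\boldsymbol{w}_t)$ for $t=\nu_2-N+1,\dots,\nu_2-1$, $\boldsymbol{x}_{\nu_2-N+1}=\bar x$, and $\boldsymbol{x}_t=0$, $\boldsymbol{u}_t=0$ for $t=1,\dots,\nu_2-N$. Here $\bar Q\in\mathbb{S}^n_+$ is the true (unknown) parameter. With $\bar q_t=-\bar Qx_t^r$, let $\bar P_{\nu_2}=\bar Q$, $\bar\eta_{\nu_2}=\bar q_{\nu_2}$, and for $t=\nu_2-1,\dots,1$, $$\bar P_t=A^T\bar P_{t+1}A+\bar Q-A^T\bar P_{t+1}B(B^T\bar P_{t+1}B+I)^{-1}B^T\bar P_{t+1}A,$$ $$\bar\eta_t=\big(A-B(B^T\bar P_{t+1}B+I)^{-1}B^T\bar P_{t+1}A\big)^T\bar\eta_{t+1}+\bar q_t.$$ The optimal control is $\boldsymbol{u}_t=-(B^T\bar P_{t+1}B+I)^{-1}(B^T\bar P_{t+1}A\boldsymbol{x}_t+B^T\bar\eta_{t+1})$ for $t=\nu_2-N+1,\dots,\nu_2-1$. This determines the joint law of $(\boldsymbol{x}_{1:\nu_2},\mathscr{N})$. Data. $M$ trajectories are observed, being independent and identically distributed copies of $(\boldsymbol{x}_{1:\nu_2},\mathscr{N})$. $M_N$ denotes the number of observations with horizon length $N$, so $\sum_{N=\nu_1}^{\nu_2}M_N=M$, and $\boldsymbol{x}_t^{i_N}$, $i_N=1,\dots,M_N$, denotes the state at time $t$ of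 the $i_N$-th observed trajectory with horizon length $N$. Problem (EST). Minimize $\Psi^o(Q,q_{1:\nu_2},P_{1:\nu_2},\eta_{1:\nu_2},\xi_{1:\nu_2-1})$ over $Q\in\mathbb{G}(\varphi)$, $q_t\in\mathbb{R}^n$, $P_t\in\mathbb{S}^n_+$, $\eta_t\in\mathbb{R}^n$ ($t=1,\dots,\nu_2$), $\xi_t\in\mathbb{R}$ ($t=1,\dots,\nu_2-1$), subject to $P_{\nu_2}=Q$, $\eta_{\nu_2}=q_{\nu_2}$, $q_t=-Qx_t^r$ for $t=1,\dots,\nu_2$, and $$\begin{bmatrix}B^TP_{t+1}B+I & B^TP_{t+1}A & B^T\eta_{t+1}\\ A^TP_{t+1}B & A^TP_{t+1}A+Q-P_t & \beta_t\\ \eta_{t+1}^TB & \beta_t^T & \xi_t\end{bmatrix}\succeq0,\qquad t=1,\dots,\nu_2-1,$$ where $\beta_t=q_t+A^T\eta_{t+1}-\eta_t$. The objective is $$\Psi^o=\frac1M\sum_{N=\nu_1}^{\nu_2}\sum_{i_N=1}^{M_N}\Big[\tfrac12(\boldsymbol{x}_{\nu_2}^{i_N})^TP_{\nu_2}\boldsymbol{x}_{\nu_2}^{i_N}+\eta_{\nu_2}^T\boldsymbol{x}_{\nu_2}^{i_N}-\tfrac12(\boldsymbol{x}_{\nu_2-N+1}^{i_N})^TP_{\nu_2-N+1}\boldsymbol{x}_{\nu_2-N+1}^{i_N}-\eta_{\nu_2-N+1}^T\boldsymbol{x}_{\nu_2-N+1}^{i_N}+\sum_{t=\nu_2-N+1}^{\nu_2-1}\Big(\tfrac12\xi_t+\tfrac12(\boldsymbol{x}_t^{i_N})^TQ\boldsymbol{x}_t^{i_N}+q_t^T\boldsymbol{x}_t^{i_N}-\tfrac12\operatorname{tr}(B^TP_{t+1}B\Sigma_w)\Big)\Big].$$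 *)

theory Defs
  imports "HOL-Probability.Probability"
begin

definition psd :: "real^'n^'n \<Rightarrow> bool" where
  "psd S \<longleftrightarrow> transpose S = S \<and> (\<forall>v. 0 \<le> v \<bullet> (S *v v))"

definition pos_def :: "real^'n^'n \<Rightarrow> bool" where
  "pos_def S \<longleftrightarrow> transpose S = S \<and> (\<forall>v. v \<noteq> 0 \<longrightarrow> 0 < v \<bullet> (S *v v))"

text \<open>The norm of the type \<open>real^'n^'n\<close> is the Frobenius norm.\<close>

lemma norm_eq_frobenius:
  fixes S :: "real^'n^'m"
  shows "norm S = sqrt (\<Sum>i\<in>UNIV. \<Sum>j\<in>UNIV. (S $ i $ j)\<^sup>2)"
  by (simp add: norm_vec_def L2_set_def sum_nonneg)

definition psd_ball :: "real \<Rightarrow> (real^'n^'n) set" where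
  "psd_ball \<phi> = {Q. psd Q \<and> norm Q \<le> \<phi>}"

text \<open>Every state can be steered to every other state in finitely many steps.\<close>

definition controllable :: "real^'n^'n \<Rightarrow> real^'m^'n \<Rightarrow> bool" where
  "controllable A B \<longleftrightarrow>
    (\<forall>x0 x1. \<exists>T (x :: nat \<Rightarrow> real^'n) (u :: nat \<Rightarrow> real^'m).
       x 0 = x0 \<and> x T = x1 \<and> (\<forall>t<T. x (Suc t) = A *v x t + B *v u t))"

definition cov_matrix :: "'a measure \<Rightarrow> ('a \<Rightarrow> real^'k) \<Rightarrow> real^'k^'k" where
  "cov_matrix M X = (\<chi> i j. \<integral>\<omega>. (X \<omega> $ i - (\<integral>\<omega>'. X \<omega>' $ i \<partial>M)) *
                              (X \<omega> $ j - (\<integral>\<omega>'. X \<omega>' $ j \<partial>M)) \<partial>M)"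

text \<open>
  Convergence in probability. The outer measure makes the notion meaningful without a
  measurability requirement (an arbitrary selection of minimizers need not be measurable);
  for random variables it is the usual one, see the lemma below.
\<close>

definition tendsto_in_prob ::
    "'a measure \<Rightarrow> (nat \<Rightarrow> 'a \<Rightarrow> 'b::metric_space) \<Rightarrow> ('a \<Rightarrow> 'b) \<Rightarrow> bool" where
  "tendsto_in_prob M X Y \<longleftrightarrow>
    (\<forall>\<epsilon>>0. (\<lambda>k. outer_measure_of M {\<omega> \<in> space M. \<epsilon> < dist (X k \<omega>) (Y \<omega>)}) \<longlonglongrightarrow> 0)"

lemma (in prob_space) tendsto_in_prob_iff:
  fixes X :: "nat \<Rightarrow> 'a \<Rightarrow> 'b::{metric_space, second_countable_topology}"
  assumes [measurable]: "\<And>k. X k \<in> borel_measurable M" "Y \<in> borel_measurable M"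
  shows "tendsto_in_prob M X Y \<longleftrightarrow>
    (\<forall>\<epsilon>>0. (\<lambda>k. prob {\<omega> \<in> space M. \<epsilon> < dist (X k \<omega>) (Y \<omega>)}) \<longlonglongrightarrow> 0)"
proof -
  have "outer_measure_of M {\<omega> \<in> space M. \<epsilon> < dist (X k \<omega>) (Y \<omega>)} =
        ennreal (prob {\<omega> \<in> space M. \<epsilon> < dist (X k \<omega>) (Y \<omega>)})" for k \<epsilon>
    by (subst outer_measure_of_eq) (auto simp: emeasure_eq_measure)
  then show ?thesis
    unfolding tendsto_in_prob_def by (simp flip: ennreal_0)
qed

text \<open>With horizon length \<open>N\<close> the agent is active from this time on.\<close>

definition start :: "nat \<Rightarrow> nat \<Rightarrow> nat" where
  "start \<nu>2 N = \<nu>2 - N + 1"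

primrec state :: "real^'n^'n \<Rightarrow> real^'m^'n \<Rightarrow> nat \<Rightarrow> real^'n \<Rightarrow>
    (nat \<Rightarrow> real^'m) \<Rightarrow> (nat \<Rightarrow> real^'m) \<Rightarrow> nat \<Rightarrow> real^'n" where
  "state A B s x0 u w 0 = 0"
| "state A B s x0 u w (Suc t) =
    (if Suc t < s then 0 else if Suc t = s then x0
     else A *v state A B s x0 u w t + B *v (u t + w t))"

text \<open>
  A causal control law gives the control at time \<open>t\<close> as a measurable function of the noise
  \<open>w\<^sub>1, \<dots>, w\<^sub>t\<^sub>-\<^sub>1\<close>; the initial state and the horizon are known to the agent, and are
  parameters of the law.
\<close>

definition causal :: "(nat \<Rightarrow> (nat \<Rightarrow> real^'m) \<Rightarrow> real^'m) \<Rightarrow> bool" where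
  "causal \<kappa> \<longleftrightarrow> (\<forall>t. \<kappa> t \<in> borel_measurable (Pi\<^sub>M {1..<t} (\<lambda>_. borel)))"

definition control :: "nat \<Rightarrow> (nat \<Rightarrow> (nat \<Rightarrow> real^'m) \<Rightarrow> real^'m) \<Rightarrow>
    (nat \<Rightarrow> real^'m) \<Rightarrow> nat \<Rightarrow> real^'m" where
  "control s \<kappa> w t = (if t < s then 0 else \<kappa> t (restrict w {1..<t}))"

definition tracking_cost :: "real^'n^'n \<Rightarrow> (nat \<Rightarrow> real^'n) \<Rightarrow> nat \<Rightarrow> nat \<Rightarrow>
    (nat \<Rightarrow> real^'n) \<Rightarrow> (nat \<Rightarrow> real^'m) \<Rightarrow> real" where
  "tracking_cost Q xr \<nu>2 N x u =
     1/2 * ((x \<nu>2 - xr \<nu>2) \<bullet> (Q *v (x \<nu>2 - xr \<nu>2))) +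
     (\<Sum>t = start \<nu>2 N..<\<nu>2.
        1/2 * ((x t - xr t) \<bullet> (Q *v (x t - xr t))) + 1/2 * (norm (u t))\<^sup>2)"

text \<open>
  The expectation is over the noise only, with initial state \<open>x0\<close> and horizon \<open>N\<close> held fixed.
  The cost is nonnegative for \<open>psd Q\<close>, so the expectation is taken in \<open>[0, \<infinity>]\<close>.
\<close>

definition expected_cost :: "'a measure \<Rightarrow> (nat \<Rightarrow> 'a \<Rightarrow> real^'m) \<Rightarrow>
    real^'n^'n \<Rightarrow> real^'m^'n \<Rightarrow> real^'n^'n \<Rightarrow> (nat \<Rightarrow> real^'n) \<Rightarrow> nat \<Rightarrow> real^'n \<Rightarrow> nat \<Rightarrow>
    (nat \<Rightarrow> (nat \<Rightarrow> real^'m) \<Rightarrow> real^'m) \<Rightarrow> ennreal" where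
  "expected_cost M w A B Q xr \<nu>2 x0 N \<kappa> =
    (\<integral>\<^sup>+\<omega>. (let W = (\<lambda>t. w t \<omega>); u = control (start \<nu>2 N) \<kappa> W
            in ennreal (tracking_cost Q xr \<nu>2 N (state A B (start \<nu>2 N) x0 u W) u)) \<partial>M)"

definition optimal_control :: "'a measure \<Rightarrow> (nat \<Rightarrow> 'a \<Rightarrow> real^'m) \<Rightarrow>
    real^'n^'n \<Rightarrow> real^'m^'n \<Rightarrow> real^'n^'n \<Rightarrow> (nat \<Rightarrow> real^'n) \<Rightarrow> nat \<Rightarrow> real^'n \<Rightarrow> nat \<Rightarrow>
    (nat \<Rightarrow> (nat \<Rightarrow> real^'m) \<Rightarrow> real^'m) \<Rightarrow> bool" where
  "optimal_control M w A B Q xr \<nu>2 x0 N \<kappa> \<longleftrightarrow>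
    causal \<kappa> \<and>
    (\<forall>\<kappa>'. causal \<kappa>' \<longrightarrow>
      expected_cost M w A B Q xr \<nu>2 x0 N \<kappa> \<le> expected_cost M w A B Q xr \<nu>2 x0 N \<kappa>')"

text \<open>
  The agent's policy \<open>\<kappa>\<close> assigns a control law to each realization \<open>(x0, N)\<close>. Joint
  measurability makes the resulting states random variables.
\<close>

definition optimal_policy :: "'a measure \<Rightarrow> ('a \<Rightarrow> real^'n) \<Rightarrow> ('a \<Rightarrow> nat) \<Rightarrow>
    (nat \<Rightarrow> 'a \<Rightarrow> real^'m) \<Rightarrow>
    real^'n^'n \<Rightarrow> real^'m^'n \<Rightarrow> real^'n^'n \<Rightarrow> (nat \<Rightarrow> real^'n) \<Rightarrow> nat \<Rightarrow>
    (real^'n \<Rightarrow> nat \<Rightarrow> nat \<Rightarrow> (nat \<Rightarrow> real^'m) \<Rightarrow> real^'m) \<Rightarrow> bool" where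
  "optimal_policy M xbar \<N> w A B Q xr \<nu>2 \<kappa> \<longleftrightarrow>
    (\<forall>N t. (\<lambda>(x0, h). \<kappa> x0 N t h)
       \<in> borel_measurable (borel \<Otimes>\<^sub>M Pi\<^sub>M {1..<t} (\<lambda>_. borel))) \<and>
    (AE \<omega> in M. optimal_control M w A B Q xr \<nu>2 (xbar \<omega>) (\<N> \<omega>) (\<kappa> (xbar \<omega>) (\<N> \<omega>)))"

definition agent_state :: "('a \<Rightarrow> real^'n) \<Rightarrow> ('a \<Rightarrow> nat) \<Rightarrow> (nat \<Rightarrow> 'a \<Rightarrow> real^'m) \<Rightarrow>
    real^'n^'n \<Rightarrow> real^'m^'n \<Rightarrow> nat \<Rightarrow>
    (real^'n \<Rightarrow> nat \<Rightarrow> nat \<Rightarrow> (nat \<Rightarrow> real^'m) \<Rightarrow> real^'m) \<Rightarrow> nat \<Rightarrow> 'a \<Rightarrow> real^'n" where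
  "agent_state xbar \<N> w A B \<nu>2 \<kappa> t \<omega> =
    (let s = start \<nu>2 (\<N> \<omega>); W = (\<lambda>t. w t \<omega>)
     in state A B s (xbar \<omega>) (control s (\<kappa> (xbar \<omega>) (\<N> \<omega>)) W) W t)"

text \<open>An observation is a trajectory \<open>x\<^sub>1, \<dots>, x\<^sub>\<nu>\<^sub>2\<close> together with its horizon length.\<close>

definition obs_space :: "nat \<Rightarrow> ((nat \<Rightarrow> real^'n) \<times> nat) measure" where
  "obs_space \<nu>2 = Pi\<^sub>M {1..\<nu>2} (\<lambda>_. borel) \<Otimes>\<^sub>M count_space UNIV"

definition observation :: "nat \<Rightarrow> (nat \<Rightarrow> 'a \<Rightarrow> real^'n) \<Rightarrow> ('a \<Rightarrow> nat) \<Rightarrow> 'a \<Rightarrow>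
    (nat \<Rightarrow> real^'n) \<times> nat" where
  "observation \<nu>2 x \<N> \<omega> = (\<lambda>t\<in>{1..\<nu>2}. x t \<omega>, \<N> \<omega>)"

definition lmi_block :: "real^'n^'n \<Rightarrow> real^'m^'n \<Rightarrow> real^'n^'n \<Rightarrow> (nat \<Rightarrow> real^'n) \<Rightarrow>
    (nat \<Rightarrow> real^'n^'n) \<Rightarrow> (nat \<Rightarrow> real^'n) \<Rightarrow> (nat \<Rightarrow> real) \<Rightarrow> nat \<Rightarrow>
    real^('m + 'n + 1)^('m + 'n + 1)" where
  "lmi_block A B Q q P \<eta> \<xi> t =
    (let P' = P (t+1); \<eta>' = \<eta> (t+1); \<beta> = q t + transpose A *v \<eta>' - \<eta> t;
         F11 = transpose B ** P' ** B + mat 1;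
         F12 = transpose B ** P' ** A;
         F13 = transpose B *v \<eta>';
         F21 = transpose A ** P' ** B;
         F22 = transpose A ** P' ** A + Q - P t
     in \<chi> i j. case i of
          Inl a \<Rightarrow> (case j of Inl b \<Rightarrow> F11 $ a $ b | Inr (Inl b) \<Rightarrow> F12 $ a $ b | Inr (Inr _) \<Rightarrow> F13 $ a)
        | Inr (Inl a) \<Rightarrow>
            (case j of Inl b \<Rightarrow> F21 $ a $ b | Inr (Inl b) \<Rightarrow> F22 $ a $ b | Inr (Inr _) \<Rightarrow> \<beta> $ a)
        | Inr (Inr _) \<Rightarrow>
            (case j of Inl b \<Rightarrow> F13 $ b | Inr (Inl b) \<Rightarrow> \<beta> $ b | Inr (Inr _) \<Rightarrow> \<xi> t))"

definition est_feasible :: "real^'n^'n \<Rightarrow> real^'m^'n \<Rightarrow> (nat \<Rightarrow> real^'n) \<Rightarrow> real \<Rightarrow> nat \<Rightarrow>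
    real^'n^'n \<Rightarrow> (nat \<Rightarrow> real^'n) \<Rightarrow> (nat \<Rightarrow> real^'n^'n) \<Rightarrow> (nat \<Rightarrow> real^'n) \<Rightarrow>
    (nat \<Rightarrow> real) \<Rightarrow> bool" where
  "est_feasible A B xr \<phi> \<nu>2 Q q P \<eta> \<xi> \<longleftrightarrow>
    Q \<in> psd_ball \<phi> \<and>
    (\<forall>t\<in>{1..\<nu>2}. psd (P t)) \<and>
    P \<nu>2 = Q \<and> \<eta> \<nu>2 = q \<nu>2 \<and>
    (\<forall>t\<in>{1..\<nu>2}. q t = - (Q *v xr t)) \<and>
    (\<forall>t\<in>{1..<\<nu>2}. psd (lmi_block A B Q q P \<eta> \<xi> t))"

definition est_loss :: "real^'m^'n \<Rightarrow> real^'m^'m \<Rightarrow> nat \<Rightarrow>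
    real^'n^'n \<Rightarrow> (nat \<Rightarrow> real^'n) \<Rightarrow> (nat \<Rightarrow> real^'n^'n) \<Rightarrow> (nat \<Rightarrow> real^'n) \<Rightarrow>
    (nat \<Rightarrow> real) \<Rightarrow> nat \<Rightarrow> (nat \<Rightarrow> real^'n) \<Rightarrow> real" where
  "est_loss B \<Sigma>w \<nu>2 Q q P \<eta> \<xi> N x =
    (let s = start \<nu>2 N in
      1/2 * (x \<nu>2 \<bullet> (P \<nu>2 *v x \<nu>2)) + \<eta> \<nu>2 \<bullet> x \<nu>2
      - 1/2 * (x s \<bullet> (P s *v x s)) - \<eta> s \<bullet> x s
      + (\<Sum>t = s..<\<nu>2.
           1/2 * \<xi> t + 1/2 * (x t \<bullet> (Q *v x t)) + q t \<bullet> x t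
           - 1/2 * trace (transpose B ** P (t+1) ** B ** \<Sigma>w)))"

text \<open>The data \<open>d 0, \<dots>, d (M-1)\<close> are the \<open>M\<close> observations, grouped by horizon length.\<close>

definition est_objective :: "real^'m^'n \<Rightarrow> real^'m^'m \<Rightarrow> nat \<Rightarrow> nat \<Rightarrow>
    nat \<Rightarrow> (nat \<Rightarrow> (nat \<Rightarrow> real^'n) \<times> nat) \<Rightarrow>
    real^'n^'n \<Rightarrow> (nat \<Rightarrow> real^'n) \<Rightarrow> (nat \<Rightarrow> real^'n^'n) \<Rightarrow> (nat \<Rightarrow> real^'n) \<Rightarrow>
    (nat \<Rightarrow> real) \<Rightarrow> real" where
  "est_objective B \<Sigma>w \<nu>1 \<nu>2 M d Q q P \<eta> \<xi> =
    1 / real M * (\<Sum>N = \<nu>1..\<nu>2. \<Sum>i | i < M \<and> snd (d i) = N.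
      est_loss B \<Sigma>w \<nu>2 Q q P \<eta> \<xi> N (fst (d i)))"

definition est_optimal :: "real^'n^'n \<Rightarrow> real^'m^'n \<Rightarrow> real^'m^'m \<Rightarrow> (nat \<Rightarrow> real^'n) \<Rightarrow>
    real \<Rightarrow> nat \<Rightarrow> nat \<Rightarrow> nat \<Rightarrow> (nat \<Rightarrow> (nat \<Rightarrow> real^'n) \<times> nat) \<Rightarrow>
    real^'n^'n \<Rightarrow> (nat \<Rightarrow> real^'n) \<Rightarrow> (nat \<Rightarrow> real^'n^'n) \<Rightarrow> (nat \<Rightarrow> real^'n) \<Rightarrow>
    (nat \<Rightarrow> real) \<Rightarrow> bool" where
  "est_optimal A B \<Sigma>w xr \<phi> \<nu>1 \<nu>2 M d Q q P \<eta> \<xi> \<longleftrightarrow>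
    est_feasible A B xr \<phi> \<nu>2 Q q P \<eta> \<xi> \<and>
    (\<forall>Q' q' P' \<eta>' \<xi>'. est_feasible A B xr \<phi> \<nu>2 Q' q' P' \<eta>' \<xi>' \<longrightarrow>
      est_objective B \<Sigma>w \<nu>1 \<nu>2 M d Q q P \<eta> \<xi> \<le> est_objective B \<Sigma>w \<nu>1 \<nu>2 M d Q' q' P' \<eta>' \<xi>')"

end

theory Submission
  imports Defs
begin

text \<open>
  Evaluated at \<open>(u, x, c)\<close>, the block matrix of the constraint at time \<open>t\<close> is a quadratic form, the
  excess of the Bellman inequality for the value function \<open>x \<bullet> P t x / 2 + \<eta> t \<bullet> x\<close>. Telescoping along a
  trajectory shows that the loss plus the control energy is half the sum of these forms plus terms of
  mean zero. Hence the expected loss of a feasible point is at least minus the expected control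
  energy, with equality iff every form vanishes almost surely along the observed trajectories.
  The Riccati solution for \<open>Qbar\<close> attains this bound, because optimality of the agent means exactly that its
  forms vanish. If another feasible point attains it, the gradients of its forms vanish
  as well; as the states on the event of full horizon length have a nondegenerate law, both points have the same feedback
  gains, and controllability together with \<open>\<nu>2 \<ge> n + 1\<close> forces the weights to agree.

  The objective is linear in the empirical means of \<open>(x x\<^sup>T, x, 1)\<close> for each time and horizon length,
  and coercive uniformly in these statistics. So minimizers exist, and the weight of a minimizer depends
  continuously on the statistics at the population values, to which they converge in probability by the
  weak law of large numbers.
\<close>

section \<open>The constraint as a quadratic form\<close>

text \<open>The rule would turn transposed products into \<open>v*\<close>, out of reach of the adjoint identity below.\<close>
declare transpose_matrix_vector [simp del]

text \<open>Three obstacles shape the development. First, the noise enters only through the range of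
  \<open>B\<close>, so by itself it need not make the law of the state nondegenerate. Nondegeneracy
  is carried from the initial state through the closed-loop maps \<open>A - B ** K t\<close>, which
  are onto because \<open>A\<close> is invertible. Second, a finite sample may miss the full
  horizon. Then the variables before the earliest observed start do not enter the objective and are
  not bounded by it. Hence feasibility is cut off at a time \<open>s\<close>
  (\<open>feasible_from\<close>), the truncated problem is minimized, and its minimizer is continued
  backward at no cost. In the population the full horizon has positive probability, so
  \<open>s = 1\<close>. Third, uniqueness of a population minimizer is shown for its weight alone,
  so stability is a compactness argument: minimizers for statistics that approach the population
  values have a subsequence that tends to a population minimizer.

  Optimality of the agent is given for almost every realization of \<open>(xbar, \<N>)\<close>
  separately; independence and a Fubini argument turn this into almost sure equality with one
  feedback trajectory.\<close>

definition stage_form :: "real^'n^'n \<Rightarrow> real^'m^'n \<Rightarrow> real^'n^'n \<Rightarrow> real^'n \<Rightarrow> real^'n^'n \<Rightarrow> real^'n \<Rightarrow>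
    real^'n^'n \<Rightarrow> real^'n \<Rightarrow> real \<Rightarrow> real^'m \<Rightarrow> real^'n \<Rightarrow> real \<Rightarrow> real" where
  "stage_form A B Q q P \<eta> P' \<eta>' \<xi> u x c =
    (A *v x + B *v u) \<bullet> (P' *v (A *v x + B *v u)) + u \<bullet> u + 2 * c * (\<eta>' \<bullet> (A *v x + B *v u))
    + x \<bullet> (Q *v x) + 2 * c * (q \<bullet> x) - x \<bullet> (P *v x) - 2 * c * (\<eta> \<bullet> x) + c\<^sup>2 * \<xi>"

lemma inner_transpose_mult: "x \<bullet> (transpose M *v y) = (M *v x) \<bullet> (y :: real^'k)"
  by (metis dot_lmul_matrix inner_commute transpose_matrix_vector)

lemma inner_symmetric_mult: "transpose S = S \<Longrightarrow> x \<bullet> (S *v y) = y \<bullet> (S *v (x :: real^'k))"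
  by (metis inner_commute inner_transpose_mult)

lemma psd_transpose: "psd S \<Longrightarrow> transpose S = S"
  by (simp add: psd_def)

lemma psd_form_nonneg: "psd S \<Longrightarrow> 0 \<le> v \<bullet> (S *v v)"
  by (simp add: psd_def)

lemma symmetric_matrixI:
  fixes S :: "real^'k^'k"
  assumes "\<And>x y. x \<bullet> (S *v y) = y \<bullet> (S *v x)"
  shows "transpose S = S"
proof -
  have "x \<bullet> (transpose S *v y) = x \<bullet> (S *v y)" for x y
    by (metis assms inner_commute inner_transpose_mult)
  then have "transpose S *v y = S *v y" for y
    by (metis vector_eq_ldot)
  then show ?thesis by (simp add: matrix_eq)
qed

lemma inner_matrix_mult_eq_sum:
  "x \<bullet> (M *v y) = (\<Sum>i\<in>UNIV. \<Sum>j\<in>UNIV. x $ i * M $ i $ j * y $ j)" for M :: "real^'k^'l"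
  by (simp add: inner_vec_def matrix_vector_mult_def sum_distrib_left mult.assoc)

lemma sum_UNIV_sum_type:
  "(\<Sum>i\<in>UNIV. f i) = (\<Sum>a\<in>UNIV. f (Inl a)) + (\<Sum>b\<in>UNIV. f (Inr b))"
  for f :: "'p::finite + 'q::finite \<Rightarrow> real"
  by (simp add: UNIV_Plus_UNIV[symmetric] sum.Plus del: UNIV_Plus_UNIV)

lemma sum_UNIV_num1: "(\<Sum>b\<in>UNIV. f b) = f (1::1)" for f :: "1 \<Rightarrow> real"
  by (simp add: UNIV_1)

lemma block_matrix_form:
  fixes F11 :: "real^'m^'m" and F22 :: "real^'n^'n" and v :: "real^('m + 'n + 1)"
  defines "u \<equiv> \<chi> a. v $ Inl a" and "x \<equiv> \<chi> a. v $ Inr (Inl a)" and "c \<equiv> v $ Inr (Inr 1)"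
  shows "v \<bullet> ((\<chi> i j. case i of
          Inl a \<Rightarrow> (case j of Inl b \<Rightarrow> F11 $ a $ b | Inr (Inl b) \<Rightarrow> F12 $ a $ b | Inr (Inr _) \<Rightarrow> f $ a)
        | Inr (Inl a) \<Rightarrow>
            (case j of Inl b \<Rightarrow> F21 $ a $ b | Inr (Inl b) \<Rightarrow> F22 $ a $ b | Inr (Inr _) \<Rightarrow> \<beta> $ a)
        | Inr (Inr _) \<Rightarrow>
            (case j of Inl b \<Rightarrow> f $ b | Inr (Inl b) \<Rightarrow> \<beta> $ b | Inr (Inr _) \<Rightarrow> \<xi>)) *v v) =
    u \<bullet> (F11 *v u) + u \<bullet> (F12 *v x) + x \<bullet> (F21 *v u) + x \<bullet> (F22 *v x)
    + 2 * c * (u \<bullet> f) + 2 * c * (x \<bullet> \<beta>) + c\<^sup>2 * \<xi>"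
  unfolding inner_matrix_mult_eq_sum sum_UNIV_sum_type sum_UNIV_num1
  by (simp add: inner_vec_def sum.distrib u_def x_def c_def sum_distrib_left power2_eq_square mult_ac)

lemma lmi_block_form:
  fixes A :: "real^'n^'n" and B :: "real^'m^'n" and v :: "real^('m + 'n + 1)"
  assumes "transpose (P (t+1)) = P (t+1)"
  shows "v \<bullet> (lmi_block A B Q q P \<eta> \<xi> t *v v) =
    stage_form A B Q (q t) (P t) (\<eta> t) (P (t+1)) (\<eta> (t+1)) (\<xi> t)
      (\<chi> a. v $ Inl a) (\<chi> a. v $ Inr (Inl a)) (v $ Inr (Inr 1))"
proof -
  let ?P = "P (t+1)" and ?h = "\<eta> (t+1)"
  define u where "u = (\<chi> a. v $ Inl a)"
  define x where "x = (\<chi> a. v $ Inr (Inl a))"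
  have sym: "(A *v x) \<bullet> (?P *v (B *v u)) = (B *v u) \<bullet> (?P *v (A *v x))"
    by (rule inner_symmetric_mult[OF assms(1)])
  show ?thesis
    unfolding lmi_block_def Let_def block_matrix_form u_def[symmetric] x_def[symmetric] stage_form_def
    by (simp add: matrix_vector_mul_assoc[symmetric] matrix_vector_mult_add_rdistrib
        matrix_vector_mult_diff_rdistrib)
       (simp add: inner_transpose_mult inner_diff_right inner_add_right inner_add_left inner_diff_left
        matrix_vector_right_distrib sym[simplified] inner_commute[of x "q t"]
        inner_commute[of x "\<eta> t"] inner_commute[of "\<eta> (Suc t)"]
        algebra_simps)
qed

lemma transpose_lmi_block:
  assumes "transpose (P (t+1)) = P (t+1)" "transpose (P t) = P t" "transpose Q = Q"
  shows "transpose (lmi_block A B Q q P \<eta> \<xi> t) = lmi_block A B Q q P \<eta> \<xi> t"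
proof -
  have a: "transpose (transpose B ** P (t+1) ** B) = transpose B ** P (t+1) ** B"
    "transpose (transpose A ** P (t+1) ** A) = transpose A ** P (t+1) ** A"
    "transpose (transpose A ** P (t+1) ** B) = transpose B ** P (t+1) ** A"
    using assms(1) by (simp_all add: matrix_transpose_mul matrix_mul_assoc)
  have s: "S $ i $ j = transpose S $ j $ i" for S :: "real^'k^'l" and i j
    by (simp add: transpose_def)
  have "(transpose B ** P (t+1) ** B) $ i $ j = (transpose B ** P (t+1) ** B) $ j $ i" for i j
    by (subst s) (simp only: a)
  moreover have "(transpose A ** P (t+1) ** A) $ i $ j = (transpose A ** P (t+1) ** A) $ j $ i" for i j
    by (subst s) (simp only: a)
  moreover have "(transpose A ** P (t+1) ** B) $ i $ j = (transpose B ** P (t+1) ** A) $ j $ i" for i j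
    by (subst s) (simp only: a)
  moreover have "Q $ i $ j = Q $ j $ i" for i j by (subst s) (simp only: assms)
  moreover have "P t $ i $ j = P t $ j $ i" for i j by (subst s) (simp only: assms)
  ultimately show ?thesis
    unfolding vec_eq_iff transpose_def[of "lmi_block A B Q q P \<eta> \<xi> t"]
    by (simp add: lmi_block_def Let_def mat_def split: sum.split)
qed

text \<open>The third block variable \<open>c\<close> homogenizes the form: \<open>c = 1\<close>
  gives twice the excess in the Bellman inequality, \<open>c = 0\<close> its purely quadratic part.
  Both values are used later, the first to bound slacks and \<open>\<eta>\<close>, the second to
  bound \<open>P\<close>.\<close>

lemma psd_lmi_block_iff:
  fixes A :: "real^'n^'n" and B :: "real^'m^'n"
  assumes "transpose (P (t+1)) = P (t+1)" "transpose (P t) = P t" "transpose Q = Q"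
  shows "psd (lmi_block A B Q q P \<eta> \<xi> t) \<longleftrightarrow>
    (\<forall>u x c. 0 \<le> stage_form A B Q (q t) (P t) (\<eta> t) (P (t+1)) (\<eta> (t+1)) (\<xi> t) u x c)"
proof -
  let ?F = "stage_form A B Q (q t) (P t) (\<eta> t) (P (t+1)) (\<eta> (t+1)) (\<xi> t)"
  have "0 \<le> ?F u x c" if p: "psd (lmi_block A B Q q P \<eta> \<xi> t)" for u x c
  proof -
    define v :: "real^('m + 'n + 1)" where
      "v = (\<chi> i. case i of Inl a \<Rightarrow> u $ a | Inr (Inl a) \<Rightarrow> x $ a | Inr (Inr _) \<Rightarrow> c)"
    have "u = (\<chi> a. v $ Inl a)" "x = (\<chi> a. v $ Inr (Inl a))" "c = v $ Inr (Inr 1)"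
      by (simp_all add: v_def vec_eq_iff)
    then have "?F u x c = v \<bullet> (lmi_block A B Q q P \<eta> \<xi> t *v v)"
      using lmi_block_form[of P t v A B Q q \<eta> \<xi>, OF assms(1)] by simp
    then show ?thesis using psd_form_nonneg[OF p] by metis
  qed
  moreover have "psd (lmi_block A B Q q P \<eta> \<xi> t)" if "\<forall>u x c. 0 \<le> ?F u x c"
    unfolding psd_def lmi_block_form[of P t _ A B Q q \<eta> \<xi>, OF assms(1)]
    using transpose_lmi_block[of P t Q A B q \<eta> \<xi>, OF assms] that by blast
  ultimately show ?thesis by blast
qed

lemma quadratic_nonneg_imp_linear_coeff_zero:
  fixes d e :: real
  assumes "\<And>s. 0 \<le> 2 * s * d + s\<^sup>2 * e"
  shows "d = 0"
proof (rule ccontr)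
  assume d: "d \<noteq> 0"
  \<comment> \<open>The minimizer of \<open>2 * s * d + s\<^sup>2 * (\<bar>e\<bar> + 1)\<close>; the
    added 1 keeps the denominator positive.\<close>
  define s where "s = - d / (\<bar>e\<bar> + 1)"
  have "s\<^sup>2 * e \<le> s\<^sup>2 * (\<bar>e\<bar> + 1)" by (intro mult_left_mono) auto
  also have "\<dots> = - s * d"
    by (simp add: s_def power2_eq_square)
  finally have "0 \<le> s * d" using assms[of s] by simp
  moreover have "s * d = - (d\<^sup>2 / (\<bar>e\<bar> + 1))" by (simp add: s_def power2_eq_square)
  moreover have "0 < d\<^sup>2 / (\<bar>e\<bar> + 1)" using d by (intro divide_pos_pos) auto
  ultimately show False by simp
qed

lemma eq_0_if_inner_0: "(\<And>h. h \<bullet> v = 0) \<Longrightarrow> v = (0::'a::real_inner)"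
  using inner_eq_zero_iff by blast

text \<open>A zero of a nonnegative form is a minimum, so its derivative vanishes in every direction
  \<open>(h, g)\<close> of control and state. The first equation is the stationarity condition for
  the control, the second the adjoint recursion with costate \<open>P *v x + \<eta>\<close>.\<close>

lemma stage_form_gradient_zero:
  fixes A :: "real^'n^'n" and B :: "real^'m^'n"
  assumes nn: "\<And>u x c. 0 \<le> stage_form A B Q q P \<eta> P' \<eta>' \<xi> u x c"
    and z: "stage_form A B Q q P \<eta> P' \<eta>' \<xi> u x 1 = 0"
    and sym: "transpose P' = P'" "transpose P = P" "transpose Q = Q"
  defines "y \<equiv> A *v x + B *v u"
  shows "transpose B *v (P' *v y + \<eta>') + u = 0"
    and "transpose A *v (P' *v y + \<eta>') + Q *v x + q - P *v x - \<eta> = 0"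
proof -
  have D: "h \<bullet> (transpose B *v (P' *v y + \<eta>') + u)
      + g \<bullet> (transpose A *v (P' *v y + \<eta>') + Q *v x + q - P *v x - \<eta>) = 0" (is "?D = 0") for h g
  proof (rule quadratic_nonneg_imp_linear_coeff_zero)
    fix s
    define k where "k = A *v g + B *v h"
    have y: "A *v (x + s *\<^sub>R g) + B *v (u + s *\<^sub>R h) = y + s *\<^sub>R k"
      by (simp add: y_def k_def matrix_vector_right_distrib algebra_simps
           matrix_vector_mult_scaleR)
    have e: "h \<bullet> (transpose B *v (P' *v y + \<eta>')) + g \<bullet> (transpose A *v (P' *v y + \<eta>')) = k \<bullet> (P' *v y + \<eta>')"
      by (simp add: inner_transpose_mult k_def inner_add_left)
    have 1: "y \<bullet> (P' *v k) = k \<bullet> (P' *v y)" "x \<bullet> (P *v g) = g \<bullet> (P *v x)" "x \<bullet> (Q *v g) = g \<bullet> (Q *v x)"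
      by (rule inner_symmetric_mult[OF sym(1)] inner_symmetric_mult[OF sym(2)] inner_symmetric_mult[OF sym(3)])+
    \<comment> \<open>The perturbation leaves \<open>c = 1\<close> fixed, so the second-order term
      is the form at \<open>c = 0\<close>.\<close>
    have "stage_form A B Q q P \<eta> P' \<eta>' \<xi> (u + s *\<^sub>R h) (x + s *\<^sub>R g) 1
       = stage_form A B Q q P \<eta> P' \<eta>' \<xi> u x 1
       + 2 * s * (k \<bullet> (P' *v y + \<eta>') + h \<bullet> u + g \<bullet> (Q *v x + q - P *v x - \<eta>))
       + s\<^sup>2 * stage_form A B Q q P \<eta> P' \<eta>' \<xi> h g 0"
      unfolding stage_form_def y k_def[symmetric] y_def[symmetric]
      by (simp add: matrix_vector_right_distrib matrix_vector_mult_scaleR inner_add_left inner_add_right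
           inner_diff_right 1 power2_eq_square algebra_simps inner_commute)
    also have "k \<bullet> (P' *v y + \<eta>') + h \<bullet> u + g \<bullet> (Q *v x + q - P *v x - \<eta>) = ?D"
      using e by (simp add: inner_add_right inner_diff_right)
    finally show "0 \<le> 2 * s * ?D + s\<^sup>2 * stage_form A B Q q P \<eta> P' \<eta>' \<xi> h g 0"
      using nn[of "u + s *\<^sub>R h" "x + s *\<^sub>R g" 1] unfolding z add_0_left by (rule ord_le_eq_trans[rotated])
  qed
  show "transpose B *v (P' *v y + \<eta>') + u = 0"
    by (rule eq_0_if_inner_0) (use D[of _ 0] in simp)
  show "transpose A *v (P' *v y + \<eta>') + Q *v x + q - P *v x - \<eta> = 0"
    by (rule eq_0_if_inner_0) (use D[of 0] in simp)
qed

text \<open>Completing the square in the control yields the Riccati recursion, with gain \<open>K\<close> and feedforward term \<open>k\<close>.\<close>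

lemma riccati_step:
  fixes A :: "real^'n^'n" and B :: "real^'m^'n"
  assumes P': "psd P'" and Q: "psd Q"
  obtains K k P \<eta> \<xi> F where "psd P" "pos_def F"
    "\<And>u x c. stage_form A B Q q P \<eta> P' \<eta>' \<xi> u x c =
       (u + K *v x + c *\<^sub>R k) \<bullet> (F *v (u + K *v x + c *\<^sub>R k))"
proof -
  \<comment> \<open>The Hessian in the control; the identity comes from the control energy and makes
    it definite whatever \<open>B\<close> is.\<close>
  define F where "F = transpose B ** P' ** B + mat 1"
  have Fv: "F *v u = transpose B *v (P' *v (B *v u)) + u" for u
    by (simp add: F_def matrix_vector_mult_add_rdistrib matrix_vector_mul_assoc[symmetric])
  have Fsym: "transpose F = F"
    using inner_symmetric_mult[OF psd_transpose[OF P'], of "B *v _" "B *v _"]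
    by (intro symmetric_matrixI) (simp add: Fv inner_add_right inner_transpose_mult inner_commute
       )
  have Fpos: "pos_def F"
    unfolding pos_def_def
  proof (intro conjI allI impI Fsym)
    fix v :: "real^'m" assume "v \<noteq> 0"
    then have "0 < v \<bullet> v" by simp
    moreover have "0 \<le> (B *v v) \<bullet> (P' *v (B *v v))" using P' by (simp add: psd_def)
    ultimately have "0 < (B *v v) \<bullet> (P' *v (B *v v)) + v \<bullet> v" by (rule add_nonneg_pos[rotated])
    then show "0 < v \<bullet> (F *v v)"
      by (simp add: Fv inner_add_right inner_transpose_mult)
  qed
  have "inj ((*v) F)"
  proof (rule injI)
    fix a b assume "F *v a = F *v b"
    then have "(a - b) \<bullet> (F *v (a - b)) = 0" by (simp add: matrix_vector_mult_diff_distrib)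
    then have "a - b = 0" using Fpos unfolding pos_def_def by (metis less_irrefl)
    then show "a = b" by simp
  qed
  then obtain G where "G ** F = mat 1"
    using matrix_left_invertible_injective[of F] by blast
  then have G: "F ** G = mat 1" by (rule matrix_left_right_inverse[THEN iffD1])
  have FG: "F *v (G *v a) = a" for a
    unfolding matrix_vector_mul_assoc G by simp
  define K where "K = G ** (transpose B ** P' ** A)"
  define k where "k = G *v (transpose B *v \<eta>')"
  have FK: "F *v (K *v x) = transpose B *v (P' *v (A *v x))" for x
    unfolding K_def matrix_vector_mul_assoc[symmetric] FG ..
  have Fk: "F *v k = transpose B *v \<eta>'"
    unfolding k_def FG ..
  \<comment> \<open>What the completed square leaves over in the state, in the mixed terms and in
    \<open>c\<^sup>2\<close> is absorbed by \<open>P\<close>, \<open>\<eta>\<close> and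
    \<open>\<xi>\<close>, so the form becomes exactly the square.\<close>
  define P where "P = transpose A ** P' ** A + Q - transpose K ** F ** K"
  define \<eta> where "\<eta> = q + transpose A *v \<eta>' - transpose K *v (F *v k)"
  define \<xi> where "\<xi> = k \<bullet> (F *v k)"
  have eq: "stage_form A B Q q P \<eta> P' \<eta>' \<xi> u x c =
       (u + K *v x + c *\<^sub>R k) \<bullet> (F *v (u + K *v x + c *\<^sub>R k))" for u x c
  proof -
    have 1: "(K *v x) \<bullet> (F *v u) = u \<bullet> (F *v (K *v x))" "k \<bullet> (F *v u) = u \<bullet> (F *v k)"
       "k \<bullet> (F *v (K *v x)) = (K *v x) \<bullet> (F *v k)"
      by (rule inner_symmetric_mult[OF Fsym])+
    have 2: "u \<bullet> (F *v (K *v x)) = (B *v u) \<bullet> (P' *v (A *v x))" "u \<bullet> (F *v k) = (B *v u) \<bullet> \<eta>'"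
      "u \<bullet> (F *v u) = (B *v u) \<bullet> (P' *v (B *v u)) + u \<bullet> u"
        unfolding FK Fk inner_transpose_mult by (rule refl refl)+ (simp add: Fv inner_add_right inner_transpose_mult)
    have 3: "(A *v x) \<bullet> (P' *v (B *v u)) = (B *v u) \<bullet> (P' *v (A *v x))"
      by (rule inner_symmetric_mult[OF psd_transpose[OF P']])
    have 4: "x \<bullet> (P *v x) = (A *v x) \<bullet> (P' *v (A *v x)) + x \<bullet> (Q *v x) - (K *v x) \<bullet> (F *v (K *v x))"
      by (simp add: P_def matrix_vector_mult_add_rdistrib matrix_vector_mult_diff_rdistrib
         inner_add_right inner_diff_right matrix_vector_mul_assoc[symmetric] inner_transpose_mult
        )
    have 5: "\<eta> \<bullet> x = q \<bullet> x + \<eta>' \<bullet> (A *v x) - (K *v x) \<bullet> (F *v k)"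
      by (simp add: \<eta>_def inner_commute[of _ x] inner_add_right inner_diff_right inner_transpose_mult
         )
         (simp add: inner_commute)
    show ?thesis
      unfolding stage_form_def 4 5 \<xi>_def
      by (simp add: matrix_vector_right_distrib matrix_vector_mult_scaleR inner_add_left inner_add_right
         1 2 3 power2_eq_square algebra_simps inner_commute[of \<eta>'])
  qed
  have "psd P"
    unfolding psd_def
  proof (intro conjI allI)
    show "transpose P = P"
    proof (rule symmetric_matrixI)
      fix x y
      have "(A *v y) \<bullet> (P' *v (A *v x)) = (A *v x) \<bullet> (P' *v (A *v y))"
        "(K *v y) \<bullet> (F *v (K *v x)) = (K *v x) \<bullet> (F *v (K *v y))" "y \<bullet> (Q *v x) = x \<bullet> (Q *v y)"
        by (rule inner_symmetric_mult[OF psd_transpose[OF P']] inner_symmetric_mult[OF Fsym]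
          inner_symmetric_mult[OF psd_transpose[OF Q]])+
      then show "x \<bullet> (P *v y) = y \<bullet> (P *v x)"
        by (simp add: P_def matrix_vector_mult_add_rdistrib matrix_vector_mult_diff_rdistrib
          inner_add_right inner_diff_right matrix_vector_mul_assoc[symmetric] inner_transpose_mult
         )
    qed
    fix x
    \<comment> \<open>At the minimizing control with \<open>c = 0\<close> the form is zero, which
      writes \<open>x \<bullet> (P *v x)\<close> as a sum of nonnegative costs.\<close>
    define u where "u = - (K *v x)"
    define y where "y = A *v x + B *v u"
    have "stage_form A B Q q P \<eta> P' \<eta>' \<xi> u x 0 = 0" unfolding eq by (simp add: u_def)
    moreover have "stage_form A B Q q P \<eta> P' \<eta>' \<xi> u x 0 =
      y \<bullet> (P' *v y) + u \<bullet> u + x \<bullet> (Q *v x) - x \<bullet> (P *v x)"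
      unfolding stage_form_def y_def by simp
    ultimately show "0 \<le> x \<bullet> (P *v x)"
      using psd_form_nonneg[OF P', of y] psd_form_nonneg[OF Q, of x] inner_ge_zero[of u] by linarith
  qed
  then show ?thesis by (rule that[OF _ Fpos eq])
qed

section \<open>Identifiability of the weight from the gains\<close>

text \<open>The Krylov spaces \<open>V k\<close> cannot grow strictly more than
  \<open>CARD('n)\<close> times, so \<open>V k = V (Suc k)\<close> for some
  \<open>k \<le> CARD('n)\<close>. This space is invariant under \<open>A\<close> and contains the
  range of \<open>B\<close>, hence every state reachable from 0, in particular \<open>r\<close>. As
  \<open>r\<close> is orthogonal to it, \<open>r\<close> is orthogonal to itself.\<close>

lemma controllable_orthogonal_zero:
  fixes A :: "real^'n^'n" and B :: "real^'m^'n"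
  assumes ctrl: "controllable A B"
    and orth: "\<And>j u. j < CARD('n) \<Longrightarrow> r \<bullet> (((*v) A ^^ j) (B *v u)) = 0"
  shows "r = 0"
proof -
  define G where "G k = {((*v) A ^^ j) (B *v u) | j u. j < k}" for k
  define V where "V k = span (G k)" for k
  have GI: "((*v) A ^^ j) (B *v u) \<in> V k" if "j < k" for j k u
    using that by (auto simp: V_def G_def intro!: span_base)
  have mono: "V k \<subseteq> V l" if "k \<le> l" for k l
    unfolding V_def using that by (intro span_mono) (auto simp: G_def)
  have "\<exists>k\<le>CARD('n). V k = V (Suc k)"
  proof (rule ccontr)
    assume c: "\<not> (\<exists>k\<le>CARD('n). V k = V (Suc k))"
    have "k \<le> dim (G k)" if "k \<le> Suc CARD('n)" for k
      using that
    proof (induction k)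
      case (Suc k)
      have "V k \<subset> V (Suc k)" using c Suc.prems mono[of k "Suc k"] by fastforce
      then have "dim (G k) < dim (G (Suc k))" unfolding V_def by (rule dim_psubset)
      then show ?case using Suc by linarith
    qed simp
    from this[of "Suc CARD('n)"] show False
      using dim_subset_UNIV_cart[of "G (Suc CARD('n))"] by simp
  qed
  then obtain k where k: "k \<le> CARD('n)" "V k = V (Suc k)" by blast
  have sub: "subspace (V k)" by (simp add: V_def)
  have A_inv: "A *v v \<in> V k" if "v \<in> V k" for v
  proof -
    have "A *v v \<in> span ((*v) A ` G k)"
      using that by (auto simp: V_def span_linear_image)
    also have "\<dots> \<subseteq> V (Suc k)"
      unfolding V_def
    proof (rule span_mono, rule subsetI)
      fix z assume "z \<in> (*v) A ` G k"
      then obtain j u where "j < k" "z = A *v (((*v) A ^^ j) (B *v u))" by (auto simp: G_def)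
      then have "z = ((*v) A ^^ Suc j) (B *v u)" "Suc j < Suc k" by auto
      then show "z \<in> G (Suc k)" unfolding G_def by blast
    qed
    finally show ?thesis using k by simp
  qed
  have B_in: "B *v u \<in> V k" for u
    using GI[of 0 "Suc k" u] k by simp
  have "r \<bullet> v = 0" if "v \<in> V k" for v
  proof -
    have "v \<in> span (G CARD('n))" using that mono[OF k(1)] by (auto simp: V_def)
    then show ?thesis
      by (rule span_induct) (auto simp: G_def orth subspace_def inner_add_right)
  qed
  moreover have "r \<in> V k"
  proof -
    obtain T x u where x: "x 0 = (0::real^'n)" "x T = r" "\<forall>t<T. x (Suc t) = A *v x t + B *v u t"
      using ctrl unfolding controllable_def by blast
    have "x t \<in> V k" if "t \<le> T" for t
      using that
    proof (induction t)
      case 0 then show ?case using sub x by (simp add: subspace_0)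
    next
      case (Suc t)
      then show ?case using x A_inv B_in sub by (simp add: subspace_add)
    qed
    then show ?thesis using x by auto
  qed
  ultimately show ?thesis by (metis inner_eq_zero_iff)
qed

text \<open>If the closed loop annihilates \<open>x\<close>, the gain equation gives
  \<open>K *v x = 0\<close>, so \<open>A *v x = 0\<close> and \<open>x = 0\<close>. An injective
  endomorphism of a finite-dimensional space is onto.\<close>

lemma closed_loop_matrix_surj:
  fixes A :: "real^'n^'n" and B :: "real^'m^'n"
  assumes "invertible A" and gain: "\<And>x. transpose B *v (P *v (A *v x - B *v (K *v x))) = K *v x"
  shows "\<exists>x. A *v x - B *v (K *v x) = y"
proof -
  obtain A' where A': "A' ** A = mat 1" using assms(1) by (auto simp: invertible_def)
  define C where "C x = A *v x - B *v (K *v x)" for x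
  have lin: "linear C"
    unfolding C_def by (intro linear_compose_sub) (auto simp: matrix_vector_mul_assoc)
  have "inj C"
  proof (rule linear_injective_0[OF lin, THEN iffD2], intro allI impI)
    fix x assume x: "C x = 0"
    then have "K *v x = 0" using gain[of x] by (simp add: C_def)
    then have "A *v x = 0" using x by (simp add: C_def)
    then show "x = 0" using A' by (metis matrix_vector_mul_assoc matrix_vector_mul_lid matrix_vector_mult_0_right)
  qed
  from surjD[OF linear_injective_imp_surjective[OF lin this], of y] show ?thesis unfolding C_def by metis
qed

text \<open>The gains determine \<open>P (t + 1)\<close> up to a symmetric matrix that annihilates the range of \<open>B\<close>;
  propagating this through the Riccati recursion annihilates the whole controllable subspace.\<close>

lemma equal_gains_imp_equal_weight:
  fixes A :: "real^'n^'n" and B :: "real^'m^'n" and P P' :: "nat \<Rightarrow> real^'n^'n"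
  assumes ctrl: "controllable A B" and inv: "invertible A" and n: "CARD('n) + 1 \<le> \<nu>"
    and sym: "\<And>t. t \<in> {1..\<nu>} \<Longrightarrow> transpose (P t) = P t" "\<And>t. t \<in> {1..\<nu>} \<Longrightarrow> transpose (P' t) = P' t"
    and fin: "P \<nu> = Q" "P' \<nu> = Q'"
    and gain: "\<And>t x. t \<in> {1..<\<nu>} \<Longrightarrow> transpose B *v (P (t+1) *v (A *v x - B *v (K t *v x))) = K t *v x"
      "\<And>t x. t \<in> {1..<\<nu>} \<Longrightarrow> transpose B *v (P' (t+1) *v (A *v x - B *v (K t *v x))) = K t *v x"
    and rec: "\<And>t x. t \<in> {1..<\<nu>} \<Longrightarrow> P t *v x = transpose A *v (P (t+1) *v (A *v x - B *v (K t *v x))) + Q *v x"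
      "\<And>t x. t \<in> {1..<\<nu>} \<Longrightarrow> P' t *v x = transpose A *v (P' (t+1) *v (A *v x - B *v (K t *v x))) + Q' *v x"
  shows "Q = Q'"
proof -
  obtain A' where A': "A ** A' = mat 1" "A' ** A = mat 1" using inv by (auto simp: invertible_def)
  have At0: "x = 0" if "transpose A *v x = 0" for x
  proof -
    have "transpose A' ** transpose A = mat 1" by (metis A'(1) matrix_transpose_mul transpose_mat)
    then show ?thesis using that by (metis matrix_vector_mul_assoc matrix_vector_mul_lid matrix_vector_mult_0_right)
  qed
  define D where "D t = P t - P' t" for t
  define C where "C t x = A *v x - B *v (K t *v x)" for t x
  have Dv: "D t *v x = P t *v x - P' t *v x" for t x
    by (simp add: D_def matrix_vector_mult_diff_rdistrib)
  have Dsym: "x \<bullet> (D t *v y) = y \<bullet> (D t *v x)" if "t \<in> {1..\<nu>}" for t x y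
    unfolding Dv inner_diff_right using sym[OF that] inner_symmetric_mult by metis
  have surj: "\<exists>x. C t x = y" if "t \<in> {1..<\<nu>}" for t y
    unfolding C_def by (rule closed_loop_matrix_surj[OF inv gain(1)[OF that]])
  \<comment> \<open>Both gain equations hold on the image of the closed loop, which is everything.
    Symmetry of the difference then moves \<open>B\<close> to the other side in
    \<open>DB\<close>.\<close>
  have BD: "transpose B *v (D (t+1) *v y) = 0" if t: "t \<in> {1..<\<nu>}" for t y
  proof -
    obtain x where "C t x = y" using surj[OF t] by blast
    then have "transpose B *v (P (t+1) *v y) = K t *v x" "transpose B *v (P' (t+1) *v y) = K t *v x"
      using gain[OF t, of x] by (simp_all add: C_def)
    then show ?thesis by (simp add: Dv matrix_vector_mult_diff_distrib)
  qed
  have DB: "D (t+1) *v (B *v u) = 0" if "t \<in> {1..<\<nu>}" for t u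
  proof (rule eq_0_if_inner_0)
    fix h
    have "h \<bullet> (D (t+1) *v (B *v u)) = u \<bullet> (transpose B *v (D (t+1) *v h))"
      using that by (subst Dsym) (auto simp: inner_transpose_mult)
    then show "h \<bullet> (D (t+1) *v (B *v u)) = 0" unfolding BD[OF that] by simp
  qed
  \<comment> \<open>Since the difference annihilates the range of \<open>B\<close>, the feedback
    drops out and the open-loop \<open>A\<close> remains.\<close>
  have Drec: "D t *v x = transpose A *v (D (t+1) *v (A *v x)) + D \<nu> *v x" if "t \<in> {1..<\<nu>}" for t x
  proof -
    have "D t *v x = transpose A *v (D (t+1) *v C t x) + D \<nu> *v x"
      unfolding Dv C_def fin rec(1)[OF that, of x] rec(2)[OF that, of x]
      by (simp add: matrix_vector_mult_diff_distrib algebra_simps)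
    also have "D (t+1) *v C t x = D (t+1) *v (A *v x)"
      unfolding C_def matrix_vector_mult_diff_distrib[of "D (t+1)"] DB[OF that] by simp
    finally show ?thesis .
  qed
  \<comment> \<open>Each further power of \<open>A\<close> costs one time step: the recursion at the
    preceding time isolates the term with \<open>A\<close>, and \<open>transpose A\<close> is
    cancelled by \<open>At0\<close>. Time 1 is the earliest at which the recursion is available,
    hence the bound on \<open>i + j\<close>.\<close>
  have hD: "\<forall>j. i + j + 2 \<le> \<nu> \<longrightarrow> D (\<nu> - j) *v (((*v) A ^^ i) (B *v u)) = 0" for i u
  proof (induction i)
    case 0
    show ?case
    proof (intro allI impI)
      fix j assume "0 + j + 2 \<le> \<nu>"
      then have "\<nu> - Suc j \<in> {1..<\<nu>}" "\<nu> - j = \<nu> - Suc j + 1" by auto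
      then show "D (\<nu> - j) *v (((*v) A ^^ 0) (B *v u)) = 0" using DB[of "\<nu> - Suc j" u] by (metis funpow_0)
    qed
  next
    case (Suc i)
    show ?case
    proof (intro allI impI)
      fix j assume j: "Suc i + j + 2 \<le> \<nu>"
      let ?v = "((*v) A ^^ i) (B *v u)"
      have "D (\<nu> - Suc j) *v ?v = 0" "D \<nu> *v ?v = 0"
        using Suc[rule_format, of "Suc j"] Suc[rule_format, of 0] j by auto
      moreover have "\<nu> - Suc j + 1 = \<nu> - j" using j by simp
      ultimately have "transpose A *v (D (\<nu> - j) *v (A *v ?v)) = 0"
        using Drec[of "\<nu> - Suc j" ?v] j by simp
      then show "D (\<nu> - j) *v (((*v) A ^^ Suc i) (B *v u)) = 0" using At0 by simp
    qed
  qed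
  \<comment> \<open>At the final time \<open>j = 0\<close> the powers up to \<open>\<nu> - 2\<close>
    are covered; \<open>CARD('n) + 1 \<le> \<nu>\<close> makes these all powers below
    \<open>CARD('n)\<close>.\<close>
  have *: "D \<nu> *v (((*v) A ^^ i) (B *v u)) = 0" if "i < CARD('n)" for i u
  proof -
    have "i + 0 + 2 \<le> \<nu>" using that n by linarith
    then have "D (\<nu> - 0) *v (((*v) A ^^ i) (B *v u)) = 0" using hD by blast
    then show ?thesis by simp
  qed
  have "D \<nu> *v z = 0" for z
  proof (rule controllable_orthogonal_zero[OF ctrl])
    fix j and u :: "real^'m" assume "j < CARD('n)"
    then have "z \<bullet> (D \<nu> *v (((*v) A ^^ j) (B *v u))) = 0" using * by simp
    then show "(D \<nu> *v z) \<bullet> (((*v) A ^^ j) (B *v u)) = 0"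
      using n by (subst inner_commute, subst Dsym) auto
  qed
  then have "D \<nu> = 0" by (simp add: matrix_eq)
  then show ?thesis by (simp add: D_def fin)
qed

section \<open>The weak law of large numbers\<close>

lemma truncation_L1_tendsto:
  fixes f :: "'a \<Rightarrow> real"
  assumes f: "integrable M f"
  shows "(\<lambda>k. \<integral>\<omega>. \<bar>f \<omega> - (if \<bar>f \<omega>\<bar> \<le> real k then f \<omega> else 0)\<bar> \<partial>M) \<longlonglongrightarrow> 0"
proof -
  have [measurable]: "f \<in> borel_measurable M" using f by simp
  have "(\<lambda>k. \<integral>\<omega>. \<bar>f \<omega> - (if \<bar>f \<omega>\<bar> \<le> real k then f \<omega> else 0)\<bar> \<partial>M) \<longlonglongrightarrow> (\<integral>\<omega>. 0 \<partial>M)"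
  proof (rule integral_dominated_convergence[where w="\<lambda>\<omega>. \<bar>f \<omega>\<bar>"])
    show "AE \<omega> in M. (\<lambda>k. \<bar>f \<omega> - (if \<bar>f \<omega>\<bar> \<le> real k then f \<omega> else 0)\<bar>) \<longlonglongrightarrow> 0"
    proof (rule AE_I2)
      fix \<omega>
      obtain K :: nat where "\<bar>f \<omega>\<bar> \<le> real K" using real_arch_simple by blast
      then have "\<forall>k\<ge>K. \<bar>f \<omega> - (if \<bar>f \<omega>\<bar> \<le> real k then f \<omega> else 0)\<bar> = 0" by auto
      then show "(\<lambda>k. \<bar>f \<omega> - (if \<bar>f \<omega>\<bar> \<le> real k then f \<omega> else 0)\<bar>) \<longlonglongrightarrow> 0"
        by (intro tendsto_eventually, unfold eventually_sequentially) blast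
    qed
  qed (use f in auto)
  then show ?thesis by simp
qed

lemma integral_eq_if_distr_eq:
  fixes g :: "'b \<Rightarrow> 'c::{banach, second_countable_topology}"
  assumes "distr M N X = distr M' N Y" "X \<in> measurable M N" "Y \<in> measurable M' N" "g \<in> borel_measurable N"
  shows "(\<integral>\<omega>. g (X \<omega>) \<partial>M) = (\<integral>\<omega>. g (Y \<omega>) \<partial>M')"
  using assms by (metis integral_distr)

lemma integrable_iff_if_distr_eq:
  fixes g :: "'b \<Rightarrow> 'c::{banach, second_countable_topology}"
  assumes "distr M N X = distr M' N Y" "X \<in> measurable M N" "Y \<in> measurable M' N" "g \<in> borel_measurable N"
  shows "integrable M (\<lambda>\<omega>. g (X \<omega>)) \<longleftrightarrow> integrable M' (\<lambda>\<omega>. g (Y \<omega>))"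
  using assms by (metis integrable_distr_eq)

context prob_space
begin

text \<open>Independence and zero means remove the off-diagonal products, leaving \<open>n\<close>
  of the \<open>n\<^sup>2\<close> terms.\<close>

lemma mean_square_average_le:
  fixes Z :: "nat \<Rightarrow> 'a \<Rightarrow> real"
  assumes ind: "indep_vars (\<lambda>_. borel) Z UNIV"
    and bnd: "\<And>i \<omega>. \<bar>Z i \<omega>\<bar> \<le> c" and mean: "\<And>i. expectation (Z i) = 0"
  shows "expectation (\<lambda>\<omega>. ((\<Sum>i<n. Z i \<omega>) / real n)\<^sup>2) \<le> c\<^sup>2 / real n"
proof (cases "n = 0")
  case False
  have [measurable]: "Z i \<in> borel_measurable M" for i
    using ind by (auto simp: indep_vars_def)
  have c: "0 \<le> c" using bnd[of 0 undefined] by linarith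
  have int: "integrable M (Z i)" for i
    by (rule integrable_const_bound[where B=c]) (auto simp: bnd)
  have int2: "integrable M (\<lambda>\<omega>. Z i \<omega> * Z j \<omega>)" for i j
    by (rule integrable_const_bound[where B="c * c"]) (auto simp: abs_mult bnd c intro!: mult_mono)
  have E: "expectation (\<lambda>\<omega>. Z i \<omega> * Z j \<omega>) \<le> (if i = j then c\<^sup>2 else 0)" for i j
  proof (cases "i = j")
    case True
    have "Z i \<omega> * Z i \<omega> \<le> c\<^sup>2" for \<omega>
      using bnd[of i \<omega>] c by (simp add: power2_eq_square[symmetric] abs_le_square_iff[symmetric])
    then have "expectation (\<lambda>\<omega>. Z i \<omega> * Z i \<omega>) \<le> expectation (\<lambda>_. c\<^sup>2)"
      by (intro integral_mono int2) auto
    then show ?thesis using True by (simp add: prob_space)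
  next
    case False
    have "indep_var (Pi\<^sub>M {i} (\<lambda>_. borel)) (\<lambda>\<omega>. restrict (\<lambda>k. Z k \<omega>) {i})
      (Pi\<^sub>M {j} (\<lambda>_. borel)) (\<lambda>\<omega>. restrict (\<lambda>k. Z k \<omega>) {j})"
      by (rule indep_var_restrict[OF ind]) (use False in auto)
    from indep_var_compose[OF this, of "\<lambda>f. f i" borel "\<lambda>f. f j" borel]
    have "indep_var borel (Z i) borel (Z j)" by (simp add: comp_def)
    then have "expectation (\<lambda>\<omega>. Z i \<omega> * Z j \<omega>) = expectation (Z i) * expectation (Z j)"
      by (rule indep_var_lebesgue_integral) (rule int)+
    then show ?thesis using False by (simp add: mean)
  qed
  have "expectation (\<lambda>\<omega>. (\<Sum>i<n. Z i \<omega>)\<^sup>2) = (\<Sum>i<n. \<Sum>j<n. expectation (\<lambda>\<omega>. Z i \<omega> * Z j \<omega>))"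
    by (simp add: power2_eq_square sum_product int2)
  also have "\<dots> \<le> (\<Sum>i<n. \<Sum>j<n. if i = j then c\<^sup>2 else 0)"
    by (intro sum_mono E)
  also have "\<dots> = real n * c\<^sup>2" by simp
  finally have "expectation (\<lambda>\<omega>. (\<Sum>i<n. Z i \<omega>)\<^sup>2) \<le> real n * c\<^sup>2" .
  then have "expectation (\<lambda>\<omega>. (\<Sum>i<n. Z i \<omega>)\<^sup>2) / (real n)\<^sup>2 \<le> real n * c\<^sup>2 / (real n)\<^sup>2"
    by (rule divide_right_mono) simp
  then show ?thesis using False by (simp add: power_divide power2_eq_square)
qed simp

text \<open>The statistics are quadratic in the state and the state has only second moments, so a
  variance bound does not apply directly. Truncation at level \<open>k\<close> splits the average
  into a bounded part, controlled in mean square, and a remainder that is uniformly small in mean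
  because the laws agree.\<close>

lemma L1_law_of_large_numbers_real:
  fixes X :: "nat \<Rightarrow> 'a \<Rightarrow> real"
  assumes ind: "indep_vars (\<lambda>_. borel) X UNIV"
    and id: "\<And>i. distr M borel (X i) = distr M borel (X 0)"
    and int: "integrable M (X 0)"
  shows "(\<lambda>n. expectation (\<lambda>\<omega>. \<bar>(\<Sum>i<n. X i \<omega>) / real n - expectation (X 0)\<bar>)) \<longlonglongrightarrow> 0"
proof (rule LIMSEQ_I)
  fix r :: real assume "0 < r"
  \<comment> \<open>The estimate will be \<open>3 * \<delta>\<close> plus a term below
    \<open>\<delta>\<close>, hence strictly less than \<open>r\<close>.\<close>
  define \<delta> where "\<delta> = r / 5"
  have \<delta>: "0 < \<delta>" using \<open>0 < r\<close> by (simp add: \<delta>_def)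
  have [measurable]: "X i \<in> borel_measurable M" for i
    using ind by (auto simp: indep_vars_def)
  have intX: "integrable M (X i)" for i
    by (rule integrable_iff_if_distr_eq[OF id[of i], where g="\<lambda>x. x", THEN iffD2]) (use int in measurable)
  obtain k where k: "expectation (\<lambda>\<omega>. \<bar>X 0 \<omega> - (if \<bar>X 0 \<omega>\<bar> \<le> real k then X 0 \<omega> else 0)\<bar>) < \<delta>"
    using LIMSEQ_D[OF truncation_L1_tendsto[OF int] \<delta>] by fastforce
  define T where "T x = (if \<bar>x\<bar> \<le> real k then x else 0)" for x :: real
  have [measurable]: "T \<in> borel_measurable borel" unfolding T_def by measurable
  have Tb: "\<bar>T x\<bar> \<le> real k" for x by (simp add: T_def)
  define m where "m = expectation (\<lambda>\<omega>. T (X 0 \<omega>))"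
  define \<mu> where "\<mu> = expectation (X 0)"
  have intT: "integrable M (\<lambda>\<omega>. T (X i \<omega>))" for i
    by (rule integrable_const_bound[where B="real k"]) (auto simp: Tb)
  have mi: "expectation (\<lambda>\<omega>. T (X i \<omega>)) = m" for i
    unfolding m_def by (rule integral_eq_if_distr_eq[OF id]) measurable
  have d: "expectation (\<lambda>\<omega>. \<bar>X i \<omega> - T (X i \<omega>)\<bar>) < \<delta>" for i
  proof -
    have "expectation (\<lambda>\<omega>. \<bar>X i \<omega> - T (X i \<omega>)\<bar>) = expectation (\<lambda>\<omega>. \<bar>X 0 \<omega> - T (X 0 \<omega>)\<bar>)"
      by (rule integral_eq_if_distr_eq[OF id[of i], where g="\<lambda>x. \<bar>x - T x\<bar>"]) measurable
    then show ?thesis using k by (simp add: T_def)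
  qed
  have mk: "\<bar>m\<bar> \<le> real k"
  proof -
    have "\<bar>m\<bar> \<le> expectation (\<lambda>\<omega>. \<bar>T (X 0 \<omega>)\<bar>)" unfolding m_def by (rule integral_abs_bound)
    also have "\<dots> \<le> expectation (\<lambda>_. real k)" using intT Tb by (intro integral_mono) auto
    finally show ?thesis by (simp add: prob_space)
  qed
  define Z where "Z i \<omega> = T (X i \<omega>) - m" for i \<omega>
  have Zind: "indep_vars (\<lambda>_. borel) Z UNIV"
    using indep_vars_compose2[OF ind, of "\<lambda>_ x. T x - m" "\<lambda>_. borel"] by (simp add: Z_def[abs_def])
  have Zb: "\<bar>Z i \<omega>\<bar> \<le> 2 * real k" for i \<omega>
    using Tb[of "X i \<omega>"] mk by (auto simp: Z_def)
  have Zm: "expectation (Z i) = 0" for i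
    using intT mi by (simp add: Z_def[abs_def] prob_space)
  have [measurable]: "Z i \<in> borel_measurable M" for i unfolding Z_def[abs_def] by measurable
  have m\<mu>: "\<bar>m - \<mu>\<bar> \<le> \<delta>"
  proof -
    have "m - \<mu> = expectation (\<lambda>\<omega>. T (X 0 \<omega>) - X 0 \<omega>)"
      using intT intX by (simp add: m_def \<mu>_def)
    also have "\<bar>\<dots>\<bar> \<le> expectation (\<lambda>\<omega>. \<bar>T (X 0 \<omega>) - X 0 \<omega>\<bar>)" by (rule integral_abs_bound)
    finally show ?thesis using d[of 0] by (simp add: abs_minus_commute)
  qed
  \<comment> \<open>One \<open>\<delta>\<close> pays for the truncated remainders, one for the shift
    \<open>m - \<mu>\<close> of the mean, and one for passing from the second to the first moment of
    \<open>?V\<close>.\<close>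
  have bound: "expectation (\<lambda>\<omega>. \<bar>(\<Sum>i<n. X i \<omega>) / real n - \<mu>\<bar>) \<le> 3 * \<delta> + (2 * real k)\<^sup>2 / (\<delta> * real n)"
    if n: "0 < n" for n
  proof -
    let ?V = "\<lambda>\<omega>. (\<Sum>i<n. Z i \<omega>) / real n"
    have intV2: "integrable M (\<lambda>\<omega>. (?V \<omega>)\<^sup>2)"
    proof (rule integrable_const_bound[where B="(2 * real k)\<^sup>2"])
      have "\<bar>?V \<omega>\<bar> \<le> 2 * real k" for \<omega>
      proof -
        have "\<bar>\<Sum>i<n. Z i \<omega>\<bar> \<le> (\<Sum>i<n. \<bar>Z i \<omega>\<bar>)" by (rule sum_abs)
        also have "\<dots> \<le> real n * (2 * real k)" using sum_bounded_above[of "{..<n}" "\<lambda>i. \<bar>Z i \<omega>\<bar>" "2 * real k"] Zb by simp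
        finally show ?thesis using n by (simp add: field_simps)
      qed
      then have "norm ((?V \<omega>)\<^sup>2) \<le> (2 * real k)\<^sup>2" for \<omega>
        using power_mono[of "\<bar>?V \<omega>\<bar>" "2 * real k" 2] unfolding real_norm_def power_abs[symmetric] by simp
      then show "AE x in M. norm ((?V x)\<^sup>2) \<le> (2 * real k)\<^sup>2"
        by (intro AE_I2)
    qed measurable
    have pt: "\<bar>(\<Sum>i<n. X i \<omega>) / real n - \<mu>\<bar> \<le>
      (\<Sum>i<n. \<bar>X i \<omega> - T (X i \<omega>)\<bar>) / real n + (\<delta> + (?V \<omega>)\<^sup>2 / \<delta>) + \<delta>" for \<omega>
    proof -
      have "(\<Sum>i<n. X i \<omega>) / real n - \<mu> = (\<Sum>i<n. X i \<omega> - T (X i \<omega>)) / real n + ?V \<omega> + (m - \<mu>)"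
        using n by (simp add: Z_def sum_subtractf diff_divide_distrib)
      moreover have "\<bar>(\<Sum>i<n. X i \<omega> - T (X i \<omega>)) / real n\<bar> \<le> (\<Sum>i<n. \<bar>X i \<omega> - T (X i \<omega>)\<bar>) / real n"
        by (simp add: divide_right_mono)
      \<comment> \<open>An elementary substitute for the Cauchy-Schwarz inequality: the first moment
        is bounded through the second up to \<open>\<delta>\<close>.\<close>
      moreover have "\<bar>?V \<omega>\<bar> \<le> \<delta> + (?V \<omega>)\<^sup>2 / \<delta>"
      proof (cases "\<bar>?V \<omega>\<bar> \<le> \<delta>")
        case True
        moreover have "0 \<le> (?V \<omega>)\<^sup>2 / \<delta>" using \<delta> by simp
        ultimately show ?thesis by linarith
      next
        case False
        then have "\<delta> * \<bar>?V \<omega>\<bar> \<le> \<bar>?V \<omega>\<bar> * \<bar>?V \<omega>\<bar>" by (intro mult_right_mono) auto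
        then have "\<bar>?V \<omega>\<bar> * \<delta> \<le> (?V \<omega>)\<^sup>2"
          unfolding power2_abs[of "?V \<omega>", symmetric] power2_eq_square by (simp only: mult.commute)
        then have "\<bar>?V \<omega>\<bar> \<le> (?V \<omega>)\<^sup>2 / \<delta>" unfolding pos_le_divide_eq[OF \<delta>] .
        then show ?thesis using \<delta> by linarith
      qed
      ultimately show ?thesis using m\<mu> by linarith
    qed
    have i1: "integrable M (\<lambda>\<omega>. \<bar>X i \<omega> - T (X i \<omega>)\<bar>)" for i using intX intT by auto
    have "expectation (\<lambda>\<omega>. \<bar>(\<Sum>i<n. X i \<omega>) / real n - \<mu>\<bar>) \<le>
      expectation (\<lambda>\<omega>. (\<Sum>i<n. \<bar>X i \<omega> - T (X i \<omega>)\<bar>) / real n + (\<delta> + (?V \<omega>)\<^sup>2 / \<delta>) + \<delta>)"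
      using intX i1 intV2 by (intro integral_mono pt) auto
    also have "\<dots> = (\<Sum>i<n. expectation (\<lambda>\<omega>. \<bar>X i \<omega> - T (X i \<omega>)\<bar>)) / real n
        + (\<delta> + expectation (\<lambda>\<omega>. (?V \<omega>)\<^sup>2) / \<delta>) + \<delta>"
      using i1 intV2 by (simp add: prob_space)
    also have "\<dots> \<le> \<delta> + (\<delta> + (2 * real k)\<^sup>2 / real n / \<delta>) + \<delta>"
    proof (intro add_mono divide_right_mono order_refl)
      have "(\<Sum>i<n. expectation (\<lambda>\<omega>. \<bar>X i \<omega> - T (X i \<omega>)\<bar>)) \<le> real n * \<delta>"
        using sum_bounded_above[of "{..<n}" _ \<delta>] d by (simp add: less_imp_le)
      then show "(\<Sum>i<n. expectation (\<lambda>\<omega>. \<bar>X i \<omega> - T (X i \<omega>)\<bar>)) / real n \<le> \<delta>"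
        using n by (simp add: field_simps)
      show "expectation (\<lambda>\<omega>. (?V \<omega>)\<^sup>2) \<le> (2 * real k)\<^sup>2 / real n"
        by (rule mean_square_average_le[OF Zind Zb Zm])
    qed (use \<delta> in auto)
    finally show ?thesis by (simp add: mult.commute)
  qed
  have "(\<lambda>n. (2 * real k)\<^sup>2 / \<delta> * inverse (real n)) \<longlonglongrightarrow> (2 * real k)\<^sup>2 / \<delta> * 0"
    by (intro tendsto_mult lim_inverse_n tendsto_const)
  from LIMSEQ_D[OF this \<delta>] obtain n0 where
    n0: "\<And>n. n0 \<le> n \<Longrightarrow> (2 * real k)\<^sup>2 / \<delta> * inverse (real n) < \<delta>" using \<delta> by (fastforce simp: abs_mult)
  show "\<exists>no. \<forall>n\<ge>no. norm (expectation (\<lambda>\<omega>. \<bar>(\<Sum>i<n. X i \<omega>) / real n - expectation (X 0)\<bar>) - 0) < r"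
  proof (intro exI allI impI)
    fix n assume n: "n \<ge> max 1 n0"
    have "expectation (\<lambda>\<omega>. \<bar>(\<Sum>i<n. X i \<omega>) / real n - \<mu>\<bar>) \<le> 3 * \<delta> + (2 * real k)\<^sup>2 / (\<delta> * real n)"
      using n by (intro bound) auto
    also have "\<dots> < 4 * \<delta>" using n0[of n] n by (simp add: divide_inverse mult_ac)
    also have "\<dots> < r" using \<open>0 < r\<close> by (simp add: \<delta>_def)
    finally show "norm (expectation (\<lambda>\<omega>. \<bar>(\<Sum>i<n. X i \<omega>) / real n - expectation (X 0)\<bar>) - 0) < r"
      by (simp add: \<mu>_def[symmetric])
  qed
qed

text \<open>Markov's inequality applied to the norm, which is bounded by the sum of the coordinate
  errors; each of these tends to 0 in mean.\<close>

lemma weak_law_of_large_numbers: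
  fixes X :: "nat \<Rightarrow> 'a \<Rightarrow> 'b::euclidean_space"
  assumes ind: "indep_vars (\<lambda>_. borel) X UNIV"
    and id: "\<And>i. distr M borel (X i) = distr M borel (X 0)"
    and int: "integrable M (X 0)" and e: "0 < e"
  shows "(\<lambda>n. prob {\<omega> \<in> space M. e \<le> norm ((1 / real n) *\<^sub>R (\<Sum>i<n. X i \<omega>) - expectation (X 0))}) \<longlonglongrightarrow> 0"
proof -
  have X[measurable]: "X i \<in> borel_measurable M" for i
    using ind by (auto simp: indep_vars_def)
  have intX: "integrable M (X i)" for i
    by (rule integrable_iff_if_distr_eq[OF id[of i], where g="\<lambda>x. x", THEN iffD2]) (use int in measurable)
  let ?D = "\<lambda>n \<omega>. (1 / real n) *\<^sub>R (\<Sum>i<n. X i \<omega>) - expectation (X 0)"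
  have L: "(\<lambda>n. expectation (\<lambda>\<omega>. \<bar>?D n \<omega> \<bullet> b\<bar>)) \<longlonglongrightarrow> 0" for b
  proof -
    have "(\<lambda>n. expectation (\<lambda>\<omega>. \<bar>(\<Sum>i<n. X i \<omega> \<bullet> b) / real n - expectation (\<lambda>\<omega>. X 0 \<omega> \<bullet> b)\<bar>)) \<longlonglongrightarrow> 0"
    proof (rule L1_law_of_large_numbers_real)
      show "indep_vars (\<lambda>_. borel) (\<lambda>i \<omega>. X i \<omega> \<bullet> b) UNIV"
        by (rule indep_vars_compose2[OF ind]) simp
      show "distr M borel (\<lambda>\<omega>. X i \<omega> \<bullet> b) = distr M borel (\<lambda>\<omega>. X 0 \<omega> \<bullet> b)" for i
      proof -
        have "distr M borel (\<lambda>\<omega>. X i \<omega> \<bullet> b) = distr (distr M borel (X i)) borel (\<lambda>x. x \<bullet> b)" for i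
          by (subst distr_distr) (auto simp: comp_def)
        then show ?thesis by (simp add: id[of i])
      qed
    qed (use int in auto)
    moreover have "?D n \<omega> \<bullet> b = (\<Sum>i<n. X i \<omega> \<bullet> b) / real n - expectation (\<lambda>\<omega>. X 0 \<omega> \<bullet> b)" for n \<omega>
      using int by (simp add: inner_diff_left inner_sum_left integral_inner_left)
    ultimately show ?thesis by simp
  qed
  have intD: "integrable M (?D n)" for n using intX by auto
  have "(\<lambda>n. (\<Sum>b\<in>Basis. expectation (\<lambda>\<omega>. \<bar>?D n \<omega> \<bullet> b\<bar>)) / e) \<longlonglongrightarrow> (\<Sum>b\<in>(Basis::'b set). 0) / e"
    using e by (intro tendsto_divide tendsto_sum L tendsto_const) auto
  then have lim: "(\<lambda>n. (\<Sum>b\<in>Basis. expectation (\<lambda>\<omega>. \<bar>?D n \<omega> \<bullet> b\<bar>)) / e) \<longlonglongrightarrow> 0" by simp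
  show ?thesis
  proof (rule tendsto_sandwich[OF _ _ tendsto_const lim]; intro always_eventually allI)
    fix n
    have "prob {\<omega> \<in> space M. e \<le> norm (?D n \<omega>)} \<le> expectation (\<lambda>\<omega>. norm (?D n \<omega>)) / e"
      using intD[of n] e by (intro integral_Markov_inequality_measure[where A="{}"]) auto
    also have "\<dots> \<le> (\<Sum>b\<in>Basis. expectation (\<lambda>\<omega>. \<bar>?D n \<omega> \<bullet> b\<bar>)) / e"
    proof (rule divide_right_mono)
      have "expectation (\<lambda>\<omega>. norm (?D n \<omega>)) \<le> expectation (\<lambda>\<omega>. \<Sum>b\<in>Basis. \<bar>?D n \<omega> \<bullet> b\<bar>)"
        using intD[of n] by (intro integral_mono integrable_norm integrable_sum norm_le_l1) auto
      also have "\<dots> = (\<Sum>b\<in>Basis. expectation (\<lambda>\<omega>. \<bar>?D n \<omega> \<bullet> b\<bar>))"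
        using intD[of n] by (intro Bochner_Integration.integral_sum) auto
      finally show "expectation (\<lambda>\<omega>. norm (?D n \<omega>)) \<le> (\<Sum>b\<in>Basis. expectation (\<lambda>\<omega>. \<bar>?D n \<omega> \<bullet> b\<bar>))" .
    qed (use e in simp)
    finally show "prob {\<omega> \<in> space M. e \<le> norm (?D n \<omega>)} \<le> (\<Sum>b\<in>Basis. expectation (\<lambda>\<omega>. \<bar>?D n \<omega> \<bullet> b\<bar>)) / e" .
  qed simp
qed

end

section \<open>The loss along a trajectory\<close>

text \<open>The contribution of the noise \<open>v\<close> to one step. The trace is the mean of the
  quadratic term when \<open>v\<close> is centred with covariance \<open>S\<close>, so the whole has
  mean zero if \<open>v\<close> is also independent of \<open>(u, x)\<close> and the moments
  exist.\<close>

definition stage_noise :: "real^'n^'n \<Rightarrow> real^'m^'n \<Rightarrow> real^'m^'m \<Rightarrow> real^'n^'n \<Rightarrow> real^'n \<Rightarrow>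
    real^'m \<Rightarrow> real^'n \<Rightarrow> real^'m \<Rightarrow> real" where
  "stage_noise A B S P' \<eta>' u x v =
    (P' *v (A *v x + B *v u) + \<eta>') \<bullet> (B *v v)
    + 1/2 * (v \<bullet> ((transpose B ** P' ** B) *v v) - trace (transpose B ** P' ** B ** S))"

text \<open>The value function at the successor is expanded around the noise-free successor
  \<open>y\<close>; the noise-free part completes half the stage form.\<close>

lemma stage_identity:
  assumes "transpose P' = P'" and x': "x' = A *v x + B *v (u + v)"
  shows "1/2 * \<xi> + 1/2 * (x \<bullet> (Q *v x)) + q \<bullet> x - 1/2 * trace (transpose B ** P' ** B ** S) + 1/2 * (u \<bullet> u)
    + (1/2 * (x' \<bullet> (P' *v x')) + \<eta>' \<bullet> x') - (1/2 * (x \<bullet> (P *v x)) + \<eta> \<bullet> x)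
    = 1/2 * stage_form A B Q q P \<eta> P' \<eta>' \<xi> u x 1 + stage_noise A B S P' \<eta>' u x v"
proof -
  define y where "y = A *v x + B *v u"
  define b where "b = B *v v"
  have x'2: "x' = y + b" by (simp add: x' y_def b_def matrix_vector_right_distrib)
  have "y \<bullet> (P' *v b) = b \<bullet> (P' *v y)" by (rule inner_symmetric_mult[OF assms(1)])
  moreover have "v \<bullet> ((transpose B ** P' ** B) *v v) = b \<bullet> (P' *v b)"
    by (simp add: matrix_vector_mul_assoc[symmetric] inner_transpose_mult b_def)
  ultimately show ?thesis
    unfolding stage_form_def stage_noise_def x'2 y_def[symmetric] b_def[symmetric]
    by (simp add: matrix_vector_right_distrib inner_add_left inner_add_right inner_commute[of "P' *v y"] algebra_simps)
qed

lemma est_loss_eq: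
  assumes sym: "\<And>t. t \<in> {1..\<nu>} \<Longrightarrow> transpose (P t) = P t" and s: "start \<nu> N \<le> \<nu>"
    and x: "\<And>t. t \<in> {start \<nu> N..<\<nu>} \<Longrightarrow> x (t+1) = A *v x t + B *v (u t + v t)"
  shows "est_loss B S \<nu> Q q P \<eta> \<xi> N x + (\<Sum>t = start \<nu> N..<\<nu>. 1/2 * (u t \<bullet> u t)) =
    (\<Sum>t = start \<nu> N..<\<nu>. 1/2 * stage_form A B Q (q t) (P t) (\<eta> t) (P (t+1)) (\<eta> (t+1)) (\<xi> t) (u t) (x t) 1
       + stage_noise A B S (P (t+1)) (\<eta> (t+1)) (u t) (x t) (v t))"
proof -
  let ?s = "start \<nu> N"
  let ?V = "\<lambda>t. 1/2 * (x t \<bullet> (P t *v x t)) + \<eta> t \<bullet> x t"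
  have "?s \<ge> 1" by (simp add: start_def)
  have "(\<Sum>t = ?s..<\<nu>. 1/2 * stage_form A B Q (q t) (P t) (\<eta> t) (P (t+1)) (\<eta> (t+1)) (\<xi> t) (u t) (x t) 1
       + stage_noise A B S (P (t+1)) (\<eta> (t+1)) (u t) (x t) (v t)) =
    (\<Sum>t = ?s..<\<nu>. (1/2 * \<xi> t + 1/2 * (x t \<bullet> (Q *v x t)) + q t \<bullet> x t
           - 1/2 * trace (transpose B ** P (t+1) ** B ** S)) + 1/2 * (u t \<bullet> u t) + (?V (Suc t) - ?V t))"
    using \<open>?s \<ge> 1\<close>
    by (intro sum.cong refl, subst stage_identity[symmetric, OF sym x]) auto
  also have "\<dots> = (\<Sum>t = ?s..<\<nu>. (1/2 * \<xi> t + 1/2 * (x t \<bullet> (Q *v x t)) + q t \<bullet> x t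
           - 1/2 * trace (transpose B ** P (t+1) ** B ** S))) + (\<Sum>t = ?s..<\<nu>. 1/2 * (u t \<bullet> u t)) + (?V \<nu> - ?V ?s)"
    unfolding sum.distrib using sum_Suc_diff'[OF s, of ?V] by simp
  finally show ?thesis by (simp add: est_loss_def Let_def)
qed

text \<open>The last bracket involves only the start value \<open>x s\<close>, the reference and the
  multipliers. For a fixed initial state no control law can influence it, so the agent in effect
  minimizes the expected loss plus control energy.\<close>

lemma tracking_cost_eq:
  assumes sym: "transpose Q = Q" and fin: "P \<nu> = Q" "\<eta> \<nu> = - (Q *v xr \<nu>)"
    and q: "\<And>t. t \<in> {start \<nu> N..<\<nu>} \<Longrightarrow> q t = - (Q *v xr t)"
  defines "s \<equiv> start \<nu> N"
  shows "tracking_cost Q xr \<nu> N x u = est_loss B S \<nu> Q q P \<eta> \<xi> N x + (\<Sum>t = s..<\<nu>. 1/2 * (u t \<bullet> u t))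
    + (1/2 * (xr \<nu> \<bullet> (Q *v xr \<nu>)) + 1/2 * (x s \<bullet> (P s *v x s)) + \<eta> s \<bullet> x s +
       (\<Sum>t = s..<\<nu>. 1/2 * (xr t \<bullet> (Q *v xr t)) - 1/2 * \<xi> t + 1/2 * trace (transpose B ** P (t+1) ** B ** S)))"
proof -
  have e: "1/2 * ((x t - xr t) \<bullet> (Q *v (x t - xr t))) =
    1/2 * (x t \<bullet> (Q *v x t)) + (- (Q *v xr t)) \<bullet> x t + 1/2 * (xr t \<bullet> (Q *v xr t))" for t
    using inner_symmetric_mult[OF sym, of "x t" "xr t"] inner_symmetric_mult[OF sym, of "xr t" "x t"]
    by (simp add: matrix_vector_mult_diff_distrib inner_diff_left inner_diff_right inner_commute[of "Q *v xr t"])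
  have "(\<Sum>t = s..<\<nu>. 1/2 * ((x t - xr t) \<bullet> (Q *v (x t - xr t))) + 1/2 * (norm (u t))\<^sup>2) =
    (\<Sum>t = s..<\<nu>. (1/2 * \<xi> t + 1/2 * (x t \<bullet> (Q *v x t)) + q t \<bullet> x t - 1/2 * trace (transpose B ** P (t+1) ** B ** S))
      + 1/2 * (u t \<bullet> u t)
      + (1/2 * (xr t \<bullet> (Q *v xr t)) - 1/2 * \<xi> t + 1/2 * trace (transpose B ** P (t+1) ** B ** S)))"
    unfolding e by (intro sum.cong refl) (simp add: q s_def power2_norm_eq_inner)
  then show ?thesis
    unfolding tracking_cost_def s_def[symmetric] est_loss_def Let_def e sum.distrib
    by (simp add: fin)
qed

section \<open>Independence of the noise from the information available to the agent\<close>

locale tracking_noise = prob_space M for M :: "'a measure" +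
  fixes xbar :: "'a \<Rightarrow> real^'n" and \<N> :: "'a \<Rightarrow> nat" and w :: "nat \<Rightarrow> 'a \<Rightarrow> real^'m" and \<Sigma>w :: "real^'m^'m"
  assumes xbar_rv[measurable]: "xbar \<in> borel_measurable M"
    and horizon_rv[measurable]: "\<N> \<in> measurable M (count_space UNIV)"
    and w_rv: "\<And>t. t \<ge> 1 \<Longrightarrow> w t \<in> borel_measurable M"
    and indep: "indep_sets
          (\<lambda>t. if t = 0
               then {(\<lambda>\<omega>. (xbar \<omega>, \<N> \<omega>)) -` S \<inter> space M |S. S \<in> sets (borel \<Otimes>\<^sub>M count_space UNIV)}
               else {w t -` S \<inter> space M |S. S \<in> sets borel}) UNIV"
    and w_sq: "\<And>t. t \<ge> 1 \<Longrightarrow> integrable M (\<lambda>\<omega>. (norm (w t \<omega>))\<^sup>2)"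
    and w_mean: "\<And>t. t \<ge> 1 \<Longrightarrow> expectation (w t) = 0"
    and w_cov: "\<And>t. t \<ge> 1 \<Longrightarrow> cov_matrix M (w t) = \<Sigma>w"
    and xbar_sq: "integrable M (\<lambda>\<omega>. (norm (xbar \<omega>))\<^sup>2)"
begin

definition gen :: "nat \<Rightarrow> 'a set set" where
  "gen t = (if t = 0
     then {(\<lambda>\<omega>. (xbar \<omega>, \<N> \<omega>)) -` S \<inter> space M |S. S \<in> sets (borel \<Otimes>\<^sub>M count_space UNIV)}
     else {w t -` S \<inter> space M |S. S \<in> sets borel})"

text \<open>Index 0 of \<open>gen\<close> carries the initial state and the horizon, so
  \<open>past t\<close> is generated by these and the noise strictly before \<open>t\<close>: what
  the control at time \<open>t\<close> may depend on.\<close>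

definition past :: "nat \<Rightarrow> 'a measure" where
  "past t = sigma (space M) (\<Union>i\<in>{..<t}. gen i)"

lemma gen_sets: "gen t \<subseteq> sets M"
proof (cases "t = 0")
  case True
  have "(\<lambda>\<omega>. (xbar \<omega>, \<N> \<omega>)) \<in> measurable M (borel \<Otimes>\<^sub>M count_space UNIV)" by measurable
  then show ?thesis using True by (auto simp: gen_def dest: measurable_sets)
next
  case False
  then have "w t \<in> borel_measurable M" using w_rv by simp
  then show ?thesis using False by (auto simp: gen_def dest: measurable_sets)
qed

lemma gen_Pow: "(\<Union>i\<in>I. gen i) \<subseteq> Pow (space M)"
  using gen_sets sets.space_closed by blast

lemma space_past [simp]: "space (past t) = space M"
  using gen_Pow by (simp add: past_def)

lemma sets_past: "sets (past t) = sigma_sets (space M) (\<Union>i\<in>{..<t}. gen i)"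
  using gen_Pow by (simp add: past_def)

lemma sets_past_subset: "sets (past t) \<subseteq> sets M"
  unfolding sets_past using gen_sets by (intro sets.sigma_sets_subset) blast

lemma measurable_from_past: "f \<in> measurable (past t) N \<Longrightarrow> f \<in> measurable M N"
  using sets_past_subset[of t] by (auto simp: measurable_def)

lemma measurable_past_init:
  assumes "1 \<le> t"
  shows "(\<lambda>\<omega>. (xbar \<omega>, \<N> \<omega>)) \<in> measurable (past t) (borel \<Otimes>\<^sub>M count_space UNIV)"
proof (rule measurableI)
  fix S :: "((real^'n) \<times> nat) set" assume "S \<in> sets (borel \<Otimes>\<^sub>M count_space UNIV)"
  then have "(\<lambda>\<omega>. (xbar \<omega>, \<N> \<omega>)) -` S \<inter> space M \<in> gen 0" by (auto simp: gen_def)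
  then show "(\<lambda>\<omega>. (xbar \<omega>, \<N> \<omega>)) -` S \<inter> space (past t) \<in> sets (past t)"
    using assms by (auto simp: sets_past intro!: sigma_sets.Basic bexI[of _ 0])
qed (auto simp: space_pair_measure)

lemma measurable_past_xbar: "1 \<le> t \<Longrightarrow> xbar \<in> borel_measurable (past t)"
  using measurable_compose[OF measurable_past_init measurable_fst] by simp

lemma measurable_past_horizon: "1 \<le> t \<Longrightarrow> \<N> \<in> measurable (past t) (count_space UNIV)"
  using measurable_compose[OF measurable_past_init measurable_snd] by simp

lemma measurable_past_w:
  assumes "1 \<le> i" "i < t"
  shows "w i \<in> borel_measurable (past t)"
proof (rule measurableI)
  fix S :: "(real^'m) set" assume "S \<in> sets borel"
  then have "w i -` S \<inter> space M \<in> gen i" using assms by (auto simp: gen_def)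
  then show "w i -` S \<inter> space (past t) \<in> sets (past t)"
    using assms by (auto simp: sets_past intro!: sigma_sets.Basic)
qed auto

lemma Int_stable_gen: "Int_stable (gen i)"
proof (rule Int_stableI)
  fix a b assume ab: "a \<in> gen i" "b \<in> gen i"
  show "a \<inter> b \<in> gen i"
  proof (cases "i = 0")
    case True
    then obtain S T where S: "a = (\<lambda>\<omega>. (xbar \<omega>, \<N> \<omega>)) -` S \<inter> space M" "b = (\<lambda>\<omega>. (xbar \<omega>, \<N> \<omega>)) -` T \<inter> space M"
      "S \<in> sets (borel \<Otimes>\<^sub>M count_space UNIV)" "T \<in> sets (borel \<Otimes>\<^sub>M count_space UNIV)"
      using ab by (auto simp: gen_def)
    then have "a \<inter> b = (\<lambda>\<omega>. (xbar \<omega>, \<N> \<omega>)) -` (S \<inter> T) \<inter> space M" by auto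
    moreover have "S \<inter> T \<in> sets (borel \<Otimes>\<^sub>M count_space UNIV)" using S by blast
    ultimately show ?thesis using True unfolding gen_def by (auto intro: exI[of _ "S \<inter> T"])
  next
    case False
    then obtain S T where S: "a = w i -` S \<inter> space M" "b = w i -` T \<inter> space M" "S \<in> sets borel" "T \<in> sets borel"
      using ab by (auto simp: gen_def)
    then have "a \<inter> b = w i -` (S \<inter> T) \<inter> space M" by auto
    moreover have "S \<inter> T \<in> sets borel" using S by blast
    ultimately show ?thesis using False unfolding gen_def by (auto intro: exI[of _ "S \<inter> T"])
  qed
qed

text \<open>The common source of both independences used later: of \<open>w t\<close> from
  \<open>past t\<close>, and of the whole noise from the initial data.\<close>

lemma indep_var_if_sigma_gen:
  assumes IJ: "I \<inter> J = {}"
    and X: "X \<in> measurable M S" "\<And>A. A \<in> sets S \<Longrightarrow> X -` A \<inter> space M \<in> sigma_sets (space M) (\<Union>i\<in>I. gen i)"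
    and Y: "Y \<in> measurable M T" "\<And>A. A \<in> sets T \<Longrightarrow> Y -` A \<inter> space M \<in> sigma_sets (space M) (\<Union>i\<in>J. gen i)"
  shows "indep_var S X T Y"
proof -
  have "indep_sets (\<lambda>j. sigma_sets (space M) (\<Union>i\<in>case_bool I J j. gen i)) UNIV"
  proof (rule indep_sets_collect_sigma)
    show "indep_sets gen (\<Union>j\<in>UNIV. case_bool I J j)"
      by (rule indep_sets_mono_index[OF subset_UNIV]) (use indep in \<open>simp add: gen_def[abs_def]\<close>)
    show "disjoint_family_on (case_bool I J) UNIV"
      using IJ by (auto simp: disjoint_family_on_def split: bool.splits)
  qed (rule Int_stable_gen)
  moreover have "(\<lambda>j. sigma_sets (space M) (\<Union>i\<in>case_bool I J j. gen i)) =
    case_bool (sigma_sets (space M) (\<Union>i\<in>I. gen i)) (sigma_sets (space M) (\<Union>i\<in>J. gen i))"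
    by (rule ext) (simp split: bool.split)
  ultimately have "indep_set (sigma_sets (space M) (\<Union>i\<in>I. gen i)) (sigma_sets (space M) (\<Union>i\<in>J. gen i))"
    unfolding indep_set_def by simp
  then have "indep_set (sigma_sets (space M) {X -` A \<inter> space M |A. A \<in> sets S})
      (sigma_sets (space M) {Y -` A \<inter> space M |A. A \<in> sets T})"
    unfolding indep_set_def
  proof (rule indep_sets_mono_sets)
    fix b :: bool
    have "sigma_sets (space M) {X -` A \<inter> space M |A. A \<in> sets S} \<subseteq> sigma_sets (space M) (\<Union>i\<in>I. gen i)"
      using X by (intro sigma_sets_mono) auto
    moreover have "sigma_sets (space M) {Y -` A \<inter> space M |A. A \<in> sets T} \<subseteq> sigma_sets (space M) (\<Union>i\<in>J. gen i)"
      using Y by (intro sigma_sets_mono) auto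
    ultimately show "case_bool (sigma_sets (space M) {X -` A \<inter> space M |A. A \<in> sets S})
        (sigma_sets (space M) {Y -` A \<inter> space M |A. A \<in> sets T}) b
      \<subseteq> case_bool (sigma_sets (space M) (\<Union>i\<in>I. gen i)) (sigma_sets (space M) (\<Union>i\<in>J. gen i)) b"
      by (cases b) auto
  qed
  then show ?thesis using X Y by (simp add: indep_var_eq)
qed

lemma past_product:
  fixes Z :: "'a \<Rightarrow> real" and h :: "real^'m \<Rightarrow> real"
  assumes "1 \<le> t" and Z: "Z \<in> borel_measurable (past t)" "integrable M Z"
    and h: "h \<in> borel_measurable borel" "integrable M (\<lambda>\<omega>. h (w t \<omega>))"
  shows "integrable M (\<lambda>\<omega>. Z \<omega> * h (w t \<omega>))"
    and "expectation (\<lambda>\<omega>. Z \<omega> * h (w t \<omega>)) = expectation Z * expectation (\<lambda>\<omega>. h (w t \<omega>))"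
proof -
  have i: "indep_var borel Z borel (\<lambda>\<omega>. h (w t \<omega>))"
  proof (rule indep_var_if_sigma_gen)
    show "{..<t} \<inter> {t} = {}" by auto
    show "Z -` A \<inter> space M \<in> sigma_sets (space M) (\<Union>i\<in>{..<t}. gen i)" if "A \<in> sets borel" for A
      using measurable_sets[OF Z(1) that] by (simp add: sets_past)
    show "(\<lambda>\<omega>. h (w t \<omega>)) -` A \<inter> space M \<in> sigma_sets (space M) (\<Union>i\<in>{t}. gen i)" if "A \<in> sets borel" for A
    proof -
      have "h -` A \<in> sets borel" using measurable_sets[OF h(1) that] by simp
      moreover have "(\<lambda>\<omega>. h (w t \<omega>)) -` A \<inter> space M = w t -` (h -` A) \<inter> space M" by auto
      ultimately show ?thesis using \<open>1 \<le> t\<close> by (auto simp: gen_def intro!: sigma_sets.Basic)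
    qed
  qed (use Z h in auto)
  show "integrable M (\<lambda>\<omega>. Z \<omega> * h (w t \<omega>))"
    by (rule indep_var_integrable[OF i]) (use assms in auto)
  show "expectation (\<lambda>\<omega>. Z \<omega> * h (w t \<omega>)) = expectation Z * expectation (\<lambda>\<omega>. h (w t \<omega>))"
    by (rule indep_var_lebesgue_integral[OF i]) (use assms in auto)
qed

end

section \<open>Square-integrable random vectors\<close>

definition (in prob_space) square_integrable :: "('a \<Rightarrow> 'b::euclidean_space) \<Rightarrow> bool" where
  "square_integrable X \<longleftrightarrow> X \<in> borel_measurable M \<and> integrable M (\<lambda>\<omega>. (norm (X \<omega>))\<^sup>2)"

context prob_space
begin

lemma square_integrable_inner:
  assumes "square_integrable X" "square_integrable Y"
  shows "integrable M (\<lambda>\<omega>. X \<omega> \<bullet> Y \<omega>)"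
proof (rule Bochner_Integration.integrable_bound)
  have [measurable]: "X \<in> borel_measurable M" "Y \<in> borel_measurable M"
    using assms by (auto simp: square_integrable_def)
  show "integrable M (\<lambda>\<omega>. (norm (X \<omega>))\<^sup>2 + (norm (Y \<omega>))\<^sup>2)"
    using assms by (auto simp: square_integrable_def)
  show "AE \<omega> in M. norm (X \<omega> \<bullet> Y \<omega>) \<le> norm ((norm (X \<omega>))\<^sup>2 + (norm (Y \<omega>))\<^sup>2)"
  proof (rule AE_I2)
    fix \<omega>
    have "\<bar>X \<omega> \<bullet> Y \<omega>\<bar> \<le> norm (X \<omega>) * norm (Y \<omega>)" by (rule Cauchy_Schwarz_ineq2)
    also have "\<dots> \<le> (norm (X \<omega>))\<^sup>2 + (norm (Y \<omega>))\<^sup>2"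
      using sum_squares_bound[of "norm (X \<omega>)" "norm (Y \<omega>)"]
        mult_nonneg_nonneg[OF norm_ge_zero norm_ge_zero, of "X \<omega>" "Y \<omega>"] by linarith
    finally show "norm (X \<omega> \<bullet> Y \<omega>) \<le> norm ((norm (X \<omega>))\<^sup>2 + (norm (Y \<omega>))\<^sup>2)" by simp
  qed
  show "(\<lambda>\<omega>. X \<omega> \<bullet> Y \<omega>) \<in> borel_measurable M" by measurable
qed

lemma square_integrable_const: "square_integrable (\<lambda>_. c)"
  by (simp add: square_integrable_def)

lemma square_integrable_add:
  assumes "square_integrable X" "square_integrable Y"
  shows "square_integrable (\<lambda>\<omega>. X \<omega> + Y \<omega>)"
proof -
  have "(norm (X \<omega> + Y \<omega>))\<^sup>2 = (norm (X \<omega>))\<^sup>2 + 2 * (X \<omega> \<bullet> Y \<omega>) + (norm (Y \<omega>))\<^sup>2" for \<omega>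
    by (simp add: power2_norm_eq_inner inner_add_left inner_add_right inner_commute)
  then show ?thesis
    using assms square_integrable_inner[OF assms] by (auto simp: square_integrable_def)
qed

lemma square_integrable_linear:
  fixes f :: "'b::euclidean_space \<Rightarrow> 'c::euclidean_space"
  assumes "linear f" "square_integrable X"
  shows "square_integrable (\<lambda>\<omega>. f (X \<omega>))"
proof -
  have bl: "bounded_linear f" using assms(1) by (rule linear_conv_bounded_linear[THEN iffD1])
  then obtain c where c: "\<And>x. norm (f x) \<le> norm x * c" "0 \<le> c" using bounded_linear.nonneg_bounded by blast
  have [measurable]: "f \<in> borel_measurable borel"
    using bl by (intro borel_measurable_continuous_onI linear_continuous_on)
  have [measurable]: "X \<in> borel_measurable M" using assms by (simp add: square_integrable_def)
  have "integrable M (\<lambda>\<omega>. (norm (f (X \<omega>)))\<^sup>2)"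
  proof (rule Bochner_Integration.integrable_bound)
    show "integrable M (\<lambda>\<omega>. (norm (X \<omega>))\<^sup>2 * c\<^sup>2)" using assms by (simp add: square_integrable_def)
    show "AE \<omega> in M. norm ((norm (f (X \<omega>)))\<^sup>2) \<le> norm ((norm (X \<omega>))\<^sup>2 * c\<^sup>2)"
      using c by (auto simp: power_mult_distrib[symmetric] intro!: power_mono)
  qed measurable
  then show ?thesis by (simp add: square_integrable_def)
qed

lemma square_integrable_matrix: "square_integrable X \<Longrightarrow> square_integrable (\<lambda>\<omega>. L *v X \<omega>)"
  for L :: "real^'p^'q"
  by (rule square_integrable_linear) auto

lemma square_integrable_diff:
  "square_integrable X \<Longrightarrow> square_integrable Y \<Longrightarrow> square_integrable (\<lambda>\<omega>. X \<omega> - Y \<omega>)"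
  using square_integrable_add[of X "\<lambda>\<omega>. - Y \<omega>"] square_integrable_linear[of uminus Y]
  by (simp add: linear_uminus)

lemma square_integrable_integrable:
  assumes "square_integrable X"
  shows "integrable M X"
proof -
  have "(\<lambda>\<omega>. \<Sum>b\<in>Basis. (X \<omega> \<bullet> b) *\<^sub>R b) = X" by (simp add: euclidean_representation)
  moreover have "integrable M (\<lambda>\<omega>. \<Sum>b\<in>Basis. (X \<omega> \<bullet> b) *\<^sub>R b)"
    using assms square_integrable_inner[OF assms square_integrable_const] by simp
  ultimately show ?thesis by simp
qed

lemma square_integrable_cond:
  assumes "square_integrable X" "{\<omega> \<in> space M. p \<omega>} \<in> sets M"
  shows "square_integrable (\<lambda>\<omega>. if p \<omega> then X \<omega> else 0)"
proof -
  have [measurable]: "Measurable.pred M p" "X \<in> borel_measurable M"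
    using assms by (auto simp: pred_def square_integrable_def)
  have "integrable M (\<lambda>\<omega>. (norm (if p \<omega> then X \<omega> else 0))\<^sup>2)"
    by (rule Bochner_Integration.integrable_bound[where f="\<lambda>\<omega>. (norm (X \<omega>))\<^sup>2"])
       (use assms in \<open>auto simp: square_integrable_def\<close>)
  then show ?thesis by (simp add: square_integrable_def)
qed

end

section \<open>Measurability and moments of closed-loop trajectories\<close>

lemma borel_measurable_matrix_vector_mult [measurable (raw)]:
  fixes L :: "real^'p^'q"
  assumes "f \<in> borel_measurable N"
  shows "(\<lambda>\<omega>. L *v f \<omega>) \<in> borel_measurable N"
  by (rule measurable_compose[OF assms])
    (intro borel_measurable_continuous_onI linear_continuous_on matrix_vector_mul_bounded_linear)

lemma borel_measurable_vec_component [measurable (raw)]: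
  fixes f :: "'z \<Rightarrow> real^'p"
  assumes "f \<in> borel_measurable N"
  shows "(\<lambda>\<omega>. f \<omega> $ i) \<in> borel_measurable N"
  using assms by (simp add: cart_eq_inner_axis)

lemma integrable_cond:
  fixes f :: "'a \<Rightarrow> real"
  assumes "integrable M f" "{\<omega> \<in> space M. p \<omega>} \<in> sets M"
  shows "integrable M (\<lambda>\<omega>. if p \<omega> then f \<omega> else 0)"
proof -
  have "integrable M (\<lambda>\<omega>. indicator {\<omega> \<in> space M. p \<omega>} \<omega> *\<^sub>R f \<omega>)"
    using assms by (intro integrable_mult_indicator)
  then show ?thesis
    by (rule Bochner_Integration.integrable_cong[THEN iffD1, rotated -1]) (auto simp: indicator_def)
qed

text \<open>Eliminating the controls makes the trajectory an explicit function of start time,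
  initial state and noise, so measurability with respect to the past can be read off the
  recursion.\<close>

primrec closed_loop :: "real^'n^'n \<Rightarrow> real^'m^'n \<Rightarrow> (nat \<Rightarrow> real^'n^'m) \<Rightarrow> (nat \<Rightarrow> real^'m) \<Rightarrow>
    nat \<Rightarrow> real^'n \<Rightarrow> (nat \<Rightarrow> real^'m) \<Rightarrow> nat \<Rightarrow> real^'n" where
  "closed_loop A B K k s x0 h 0 = 0"
| "closed_loop A B K k s x0 h (Suc t) =
    (if Suc t < s then 0 else if Suc t = s then x0
     else A *v closed_loop A B K k s x0 h t
       + B *v (- (K t *v closed_loop A B K k s x0 h t) - k t + h t))"

lemma state_eq_closed_loop:
  assumes "\<And>t. t \<in> {s..<T} \<Longrightarrow> u t = - (K t *v closed_loop A B K k s x0 w t) - k t" "t \<le> T"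
  shows "state A B s x0 u w t = closed_loop A B K k s x0 w t"
  using assms(2)
proof (induction t)
  case (Suc t)
  then show ?case using assms(1)[of t] by simp
qed simp

text \<open>With \<open>1 \<le> s\<close> the recursion first reads the noise at index
  \<open>s\<close>, so \<open>h 0\<close> never occurs, and the state at time \<open>t\<close> reads
  nothing from \<open>t\<close> on.\<close>

lemma closed_loop_restrict:
  assumes "1 \<le> s" "t \<le> T"
  shows "closed_loop A B K k s x0 (restrict h {1..<T}) t = closed_loop A B K k s x0 h t"
  using assms(2) by (induction t) (use assms(1) in auto)

lemma measurable_closed_loop:
  assumes X0: "X0 \<in> borel_measurable N" and \<sigma>: "\<sigma> \<in> measurable N (count_space UNIV)" "\<And>\<omega>. 1 \<le> \<sigma> \<omega>"
    and h: "\<And>i. 1 \<le> i \<Longrightarrow> i < T \<Longrightarrow> (\<lambda>\<omega>. h \<omega> i) \<in> borel_measurable N" and "t \<le> T"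
  shows "(\<lambda>\<omega>. closed_loop A B K k (\<sigma> \<omega>) (X0 \<omega>) (h \<omega>) t) \<in> borel_measurable N"
  using \<open>t \<le> T\<close>
proof (induction t)
  case (Suc t)
  note [measurable] = X0 \<sigma>(1)
  show ?case
  proof (cases "t = 0")
    \<comment> \<open>The recursive branch would read \<open>h 0\<close>, about which nothing is
      assumed; a start of at least 1 rules it out.\<close>
    case True
    have "(\<lambda>\<omega>. closed_loop A B K k (\<sigma> \<omega>) (X0 \<omega>) (h \<omega>) (Suc 0)) = (\<lambda>\<omega>. if 1 < \<sigma> \<omega> then 0 else X0 \<omega>)"
      using \<sigma>(2) by (auto simp: fun_eq_iff) (metis Suc_leI le_antisym less_irrefl not_less_eq_eq One_nat_def not_less)+
    then show ?thesis using True by simp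
  next
    case False
    have [measurable]: "(\<lambda>\<omega>. h \<omega> t) \<in> borel_measurable N" using False Suc.prems by (intro h) auto
    have [measurable]: "(\<lambda>\<omega>. closed_loop A B K k (\<sigma> \<omega>) (X0 \<omega>) (h \<omega>) t) \<in> borel_measurable N" using Suc by simp
    show ?thesis by simp
  qed
qed simp

context tracking_noise
begin

lemma w_square_integrable: "1 \<le> t \<Longrightarrow> square_integrable (w t)"
  using w_rv w_sq by (simp add: square_integrable_def)

lemma w_component:
  assumes "1 \<le> t"
  shows "integrable M (\<lambda>\<omega>. w t \<omega> $ i)" "expectation (\<lambda>\<omega>. w t \<omega> $ i) = 0"
  using square_integrable_integrable[OF w_square_integrable[OF assms]] w_mean[OF assms]
  by (simp_all add: cart_eq_inner_axis)

lemma w_component_product: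
  assumes "1 \<le> t"
  shows "integrable M (\<lambda>\<omega>. w t \<omega> $ i * w t \<omega> $ j)" "expectation (\<lambda>\<omega>. w t \<omega> $ i * w t \<omega> $ j) = \<Sigma>w $ i $ j"
proof -
  have "square_integrable (\<lambda>\<omega>. w t \<omega> $ i)" for i
    using square_integrable_linear[OF _ w_square_integrable[OF assms], of "\<lambda>v. v $ i"]
    by (simp add: linear_iff)
  from square_integrable_inner[OF this this] show "integrable M (\<lambda>\<omega>. w t \<omega> $ i * w t \<omega> $ j)" by simp
  show "expectation (\<lambda>\<omega>. w t \<omega> $ i * w t \<omega> $ j) = \<Sigma>w $ i $ j"
    using w_component[OF assms] by (simp add: w_cov[OF assms, symmetric] cov_matrix_def)
qed

lemma noise_quadratic:
  assumes "1 \<le> t"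
  shows "integrable M (\<lambda>\<omega>. w t \<omega> \<bullet> (S *v w t \<omega>))" "expectation (\<lambda>\<omega>. w t \<omega> \<bullet> (S *v w t \<omega>)) = trace (S ** \<Sigma>w)"
proof -
  have e: "w t \<omega> \<bullet> (S *v w t \<omega>) = (\<Sum>i\<in>UNIV. \<Sum>j\<in>UNIV. S $ i $ j * (w t \<omega> $ j * w t \<omega> $ i))" for \<omega>
    unfolding inner_matrix_mult_eq_sum by (intro sum.cong refl) (simp add: mult_ac)
  show "integrable M (\<lambda>\<omega>. w t \<omega> \<bullet> (S *v w t \<omega>))" "expectation (\<lambda>\<omega>. w t \<omega> \<bullet> (S *v w t \<omega>)) = trace (S ** \<Sigma>w)"
    unfolding e using w_component_product[OF assms] by (simp_all add: trace_def matrix_matrix_mult_def)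
qed

lemma noise_inner:
  fixes Z :: "'a \<Rightarrow> real^'m"
  assumes "1 \<le> t" "Z \<in> borel_measurable (past t)" "integrable M Z"
  shows "integrable M (\<lambda>\<omega>. Z \<omega> \<bullet> w t \<omega>)" "expectation (\<lambda>\<omega>. Z \<omega> \<bullet> w t \<omega>) = 0"
proof -
  have "integrable M (\<lambda>\<omega>. Z \<omega> $ i * w t \<omega> $ i) \<and> expectation (\<lambda>\<omega>. Z \<omega> $ i * w t \<omega> $ i) = 0" for i
    using past_product[OF assms(1), of "\<lambda>\<omega>. Z \<omega> $ i" "\<lambda>v. v $ i"] w_component[OF assms(1)] assms(2,3)
    by (simp add: cart_eq_inner_axis)
  then show "integrable M (\<lambda>\<omega>. Z \<omega> \<bullet> w t \<omega>)" "expectation (\<lambda>\<omega>. Z \<omega> \<bullet> w t \<omega>) = 0"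
    by (simp_all add: inner_vec_def)
qed

text \<open>The predicate \<open>p\<close> will say that the agent is already active at time
  \<open>t\<close>. It belongs to the past, so it can be moved into the coefficients of the noise
  without losing independence.\<close>

lemma expectation_stage_noise:
  assumes t: "1 \<le> t" and X: "X \<in> borel_measurable (past t)" "square_integrable X"
    and U: "U \<in> borel_measurable (past t)" "square_integrable U"
    and p: "{\<omega> \<in> space M. p \<omega>} \<in> sets (past t)"
  shows "integrable M (\<lambda>\<omega>. if p \<omega> then stage_noise A B \<Sigma>w P' \<eta>' (U \<omega>) (X \<omega>) (w t \<omega>) else 0)"
    and "expectation (\<lambda>\<omega>. if p \<omega> then stage_noise A B \<Sigma>w P' \<eta>' (U \<omega>) (X \<omega>) (w t \<omega>) else 0) = 0"
proof -
  define S where "S = transpose B ** P' ** B"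
  \<comment> \<open>The noise term is \<open>Z \<bullet> w t + c * h (w t)\<close>, where
    \<open>Z\<close> and \<open>c\<close> depend on the past only and \<open>w t\<close> and
    \<open>h (w t)\<close> have mean zero.\<close>
  define Z where "Z \<omega> = (if p \<omega> then transpose B *v (P' *v (A *v X \<omega> + B *v U \<omega>) + \<eta>') else 0)" for \<omega>
  define c where "c \<omega> = (if p \<omega> then 1/2 else (0::real))" for \<omega>
  define h where "h v = v \<bullet> (S *v v) - trace (S ** \<Sigma>w)" for v
  have [measurable]: "Measurable.pred (past t) p" using p by (simp add: pred_def)
  have pM: "{\<omega> \<in> space M. p \<omega>} \<in> sets M" using p sets_past_subset by blast
  have Zm: "Z \<in> borel_measurable (past t)" unfolding Z_def using X(1) U(1) by measurable
  have "square_integrable Z" unfolding Z_def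
    by (intro square_integrable_cond square_integrable_matrix square_integrable_add square_integrable_const X U pM)
  then have Zi: "integrable M Z" by (rule square_integrable_integrable)
  have cm: "c \<in> borel_measurable (past t)" unfolding c_def by measurable
  have ci: "integrable M c" unfolding c_def using integrable_cond[OF _ pM, of "\<lambda>_. 1/2"] by simp
  have hm: "h \<in> borel_measurable borel" unfolding h_def by measurable
  have hi: "integrable M (\<lambda>\<omega>. h (w t \<omega>))" "expectation (\<lambda>\<omega>. h (w t \<omega>)) = 0"
    unfolding h_def using noise_quadratic[OF t, of S] by (simp_all add: prob_space)
  have e: "(if p \<omega> then stage_noise A B \<Sigma>w P' \<eta>' (U \<omega>) (X \<omega>) (w t \<omega>) else 0) = Z \<omega> \<bullet> w t \<omega> + c \<omega> * h (w t \<omega>)" for \<omega>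
    unfolding stage_noise_def Z_def c_def h_def S_def
    by (simp add: inner_commute[of "transpose B *v _"] inner_transpose_mult) (simp add: inner_commute)
  show "integrable M (\<lambda>\<omega>. if p \<omega> then stage_noise A B \<Sigma>w P' \<eta>' (U \<omega>) (X \<omega>) (w t \<omega>) else 0)"
    "expectation (\<lambda>\<omega>. if p \<omega> then stage_noise A B \<Sigma>w P' \<eta>' (U \<omega>) (X \<omega>) (w t \<omega>) else 0) = 0"
    unfolding e using noise_inner[OF t Zm Zi] past_product[OF t cm ci hm hi(1)] hi(2) by simp_all
qed

lemma integrable_stage_form:
  assumes "square_integrable X" "square_integrable U"
  shows "integrable M (\<lambda>\<omega>. stage_form A B Q q P \<eta> P' \<eta>' \<xi> (U \<omega>) (X \<omega>) 1)"
  unfolding stage_form_def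
  by (intro Bochner_Integration.integrable_add Bochner_Integration.integrable_diff integrable_mult_right
    square_integrable_inner square_integrable_add square_integrable_matrix assms square_integrable_const) simp

text \<open>The lower summation limit is random. Rewriting the sum over the fixed range
  \<open>{1..<\<nu>}\<close> with the events \<open>\<sigma> \<le> t\<close>, which are decided by
  time \<open>t\<close>, lets every noise term be averaged separately.\<close>

lemma expectation_stage_sum:
  fixes A Q :: "real^'n^'n" and B :: "real^'m^'n" and P :: "nat \<Rightarrow> real^'n^'n" and q \<eta> :: "nat \<Rightarrow> real^'n"
    and \<xi> :: "nat \<Rightarrow> real" and X :: "nat \<Rightarrow> 'a \<Rightarrow> real^'n" and U :: "nat \<Rightarrow> 'a \<Rightarrow> real^'m"
  assumes \<sigma>: "\<And>t. 1 \<le> t \<Longrightarrow> {\<omega> \<in> space M. \<sigma> \<omega> \<le> t} \<in> sets (past t)" "\<And>\<omega>. 1 \<le> \<sigma> \<omega>"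
    and X: "\<And>t. t \<in> {1..<\<nu>} \<Longrightarrow> X t \<in> borel_measurable (past t)" "\<And>t. t \<in> {1..<\<nu>} \<Longrightarrow> square_integrable (X t)"
    and U: "\<And>t. t \<in> {1..<\<nu>} \<Longrightarrow> U t \<in> borel_measurable (past t)" "\<And>t. t \<in> {1..<\<nu>} \<Longrightarrow> square_integrable (U t)"
  defines "F \<equiv> \<lambda>t \<omega>. stage_form A B Q (q t) (P t) (\<eta> t) (P (t+1)) (\<eta> (t+1)) (\<xi> t) (U t \<omega>) (X t \<omega>) 1"
    and "G \<equiv> \<lambda>t \<omega>. stage_noise A B \<Sigma>w (P (t+1)) (\<eta> (t+1)) (U t \<omega>) (X t \<omega>) (w t \<omega>)"
  shows "integrable M (\<lambda>\<omega>. \<Sum>t = \<sigma> \<omega>..<\<nu>. F t \<omega>)"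
    and "integrable M (\<lambda>\<omega>. \<Sum>t = \<sigma> \<omega>..<\<nu>. 1/2 * F t \<omega> + G t \<omega>)"
    and "expectation (\<lambda>\<omega>. \<Sum>t = \<sigma> \<omega>..<\<nu>. 1/2 * F t \<omega> + G t \<omega>) = 1/2 * expectation (\<lambda>\<omega>. \<Sum>t = \<sigma> \<omega>..<\<nu>. F t \<omega>)"
proof -
  have s: "(\<Sum>t = \<sigma> \<omega>..<\<nu>. f t) = (\<Sum>t = 1..<\<nu>. if \<sigma> \<omega> \<le> t then f t else (0::real))" for f \<omega>
    using \<sigma>(2)[of \<omega>] by (subst sum.inter_filter[symmetric]) (auto intro!: sum.cong)
  have iF: "integrable M (\<lambda>\<omega>. if \<sigma> \<omega> \<le> t then F t \<omega> else 0)" if "t \<in> {1..<\<nu>}" for t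
    unfolding F_def using that \<sigma>(1)[of t] sets_past_subset
    by (intro integrable_cond integrable_stage_form X U) auto
  have iG: "integrable M (\<lambda>\<omega>. if \<sigma> \<omega> \<le> t then G t \<omega> else 0)"
    "expectation (\<lambda>\<omega>. if \<sigma> \<omega> \<le> t then G t \<omega> else 0) = 0" if "t \<in> {1..<\<nu>}" for t
    unfolding G_def using that \<sigma>(1)[of t]
    by (intro expectation_stage_noise X U; simp)+
  have e: "(if \<sigma> \<omega> \<le> t then 1/2 * F t \<omega> + G t \<omega> else 0) =
    1/2 * (if \<sigma> \<omega> \<le> t then F t \<omega> else 0) + (if \<sigma> \<omega> \<le> t then G t \<omega> else 0)" for t \<omega> by simp
  show "integrable M (\<lambda>\<omega>. \<Sum>t = \<sigma> \<omega>..<\<nu>. F t \<omega>)" unfolding s using iF by (intro Bochner_Integration.integrable_sum) auto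
  show "integrable M (\<lambda>\<omega>. \<Sum>t = \<sigma> \<omega>..<\<nu>. 1/2 * F t \<omega> + G t \<omega>)"
    unfolding s e using iF iG by (intro Bochner_Integration.integrable_sum Bochner_Integration.integrable_add integrable_mult_right) auto
  have "expectation (\<lambda>\<omega>. \<Sum>t = \<sigma> \<omega>..<\<nu>. 1/2 * F t \<omega> + G t \<omega>) =
    (\<Sum>t = 1..<\<nu>. 1/2 * expectation (\<lambda>\<omega>. if \<sigma> \<omega> \<le> t then F t \<omega> else 0) + expectation (\<lambda>\<omega>. if \<sigma> \<omega> \<le> t then G t \<omega> else 0))"
    unfolding s e using iF iG
    by (subst Bochner_Integration.integral_sum, intro Bochner_Integration.integrable_add integrable_mult_right, simp, simp)
       (intro sum.cong refl, subst Bochner_Integration.integral_add, auto intro!: integrable_mult_right simp del: if_split)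
  also have "\<dots> = (\<Sum>t = 1..<\<nu>. 1/2 * expectation (\<lambda>\<omega>. if \<sigma> \<omega> \<le> t then F t \<omega> else 0))"
    using iG(2) by (intro sum.cong refl) simp
  also have "\<dots> = 1/2 * expectation (\<lambda>\<omega>. \<Sum>t = \<sigma> \<omega>..<\<nu>. F t \<omega>)"
    unfolding s using iF by (subst Bochner_Integration.integral_sum) (auto simp: sum_distrib_left)
  finally show "expectation (\<lambda>\<omega>. \<Sum>t = \<sigma> \<omega>..<\<nu>. 1/2 * F t \<omega> + G t \<omega>) = 1/2 * expectation (\<lambda>\<omega>. \<Sum>t = \<sigma> \<omega>..<\<nu>. F t \<omega>)" .
qed

lemma square_integrable_closed_loop:
  assumes X0: "square_integrable X0" and \<sigma>: "\<sigma> \<in> measurable M (count_space UNIV)" "\<And>\<omega>. 1 \<le> \<sigma> \<omega>"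
  shows "square_integrable (\<lambda>\<omega>. closed_loop A B K k (\<sigma> \<omega>) (X0 \<omega>) (\<lambda>t. w t \<omega>) t)"
proof (induction t)
  case (Suc t)
  note [measurable] = \<sigma>(1)
  have p: "{\<omega> \<in> space M. \<sigma> \<omega> = Suc t} \<in> sets M" "{\<omega> \<in> space M. \<sigma> \<omega> < Suc t} \<in> sets M" by measurable
  let ?c = "\<lambda>\<omega>. closed_loop A B K k (\<sigma> \<omega>) (X0 \<omega>) (\<lambda>t. w t \<omega>) t"
  \<comment> \<open>The index \<open>max 1 t\<close> alters the expression only at
    \<open>t = 0\<close>, where the branch is empty because \<open>\<sigma>\<close> is at least 1;
    it avoids \<open>w 0\<close>, whose moments are unknown.\<close>
  have e: "closed_loop A B K k (\<sigma> \<omega>) (X0 \<omega>) (\<lambda>t. w t \<omega>) (Suc t) =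
    (if \<sigma> \<omega> = Suc t then X0 \<omega> else 0) + (if \<sigma> \<omega> < Suc t then A *v ?c \<omega> + B *v (w (max 1 t) \<omega> - K t *v ?c \<omega> - k t) else 0)" for \<omega>
    using \<sigma>(2)[of \<omega>] by (auto simp: algebra_simps)
  show ?case unfolding e
    by (intro square_integrable_add square_integrable_cond p X0 square_integrable_matrix square_integrable_diff
      square_integrable_const Suc w_square_integrable, simp)
qed (simp add: square_integrable_const)

end

section \<open>The optimal policy is the Riccati feedback\<close>

text \<open>Dependent choice runs forward, so the sequence is built in the reversed time
  \<open>\<nu> - t\<close>.\<close>

lemma backward_choice:
  assumes "I z0" and step: "\<And>t z'. I z' \<Longrightarrow> \<exists>z. I z \<and> R t z z'"
  shows "\<exists>f. f \<nu> = z0 \<and> (\<forall>t\<le>\<nu>. I (f t)) \<and> (\<forall>t<\<nu>. R t (f t) (f (Suc t)))"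
proof -
  have "\<exists>g. \<forall>j. (I (g j) \<and> (j = 0 \<longrightarrow> g j = z0)) \<and> R (\<nu> - Suc j) (g (Suc j)) (g j)"
    by (rule dependent_nat_choice) (use assms in auto)
  then obtain g where g: "\<And>j. I (g j)" "g 0 = z0" "\<And>j. R (\<nu> - Suc j) (g (Suc j)) (g j)" by blast
  have "R t (g (\<nu> - t)) (g (\<nu> - Suc t))" if "t < \<nu>" for t
    using g(3)[of "\<nu> - Suc t"] that by (simp add: Suc_diff_Suc)
  then show ?thesis using g(1,2) by (intro exI[of _ "\<lambda>t. g (\<nu> - t)"]) auto
qed

text \<open>The recursion is recorded through its effect, the completed square: \<open>F t\<close>
  is the Hessian in the control, and at \<open>c = 1\<close> the form vanishes exactly for the
  feedback \<open>- (K t *v x) - k t\<close>.\<close>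

definition riccati_solution :: "real^'n^'n \<Rightarrow> real^'m^'n \<Rightarrow> nat \<Rightarrow> real^'n^'n \<Rightarrow> (nat \<Rightarrow> real^'n) \<Rightarrow>
    (nat \<Rightarrow> real^'n^'n) \<Rightarrow> (nat \<Rightarrow> real^'n) \<Rightarrow> (nat \<Rightarrow> real) \<Rightarrow> (nat \<Rightarrow> real^'n^'m) \<Rightarrow> (nat \<Rightarrow> real^'m) \<Rightarrow>
    (nat \<Rightarrow> real^'m^'m) \<Rightarrow> bool" where
  "riccati_solution A B \<nu> Q q P \<eta> \<xi> K k F \<longleftrightarrow>
    P \<nu> = Q \<and> \<eta> \<nu> = q \<nu> \<and> (\<forall>t\<le>\<nu>. psd (P t)) \<and>
    (\<forall>t<\<nu>. pos_def (F t) \<and> (\<forall>u x c.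
       stage_form A B Q (q t) (P t) (\<eta> t) (P (t+1)) (\<eta> (t+1)) (\<xi> t) u x c =
       (u + K t *v x + c *\<^sub>R k t) \<bullet> (F t *v (u + K t *v x + c *\<^sub>R k t))))"

lemma riccati_solution_exists:
  fixes A :: "real^'n^'n" and B :: "real^'m^'n"
  assumes "psd Q"
  shows "\<exists>P \<eta> \<xi> K k F. riccati_solution A B \<nu> Q q P \<eta> \<xi> K k F"
proof -
  let ?R = "\<lambda>t z z'. case z of (P, \<eta>, \<xi>, K, k, F) \<Rightarrow> case z' of (P', \<eta>', _) \<Rightarrow>
    pos_def F \<and> (\<forall>u x c. stage_form A B Q (q t) P \<eta> P' \<eta>' \<xi> u x c =
       (u + K *v x + c *\<^sub>R k) \<bullet> (F *v (u + K *v x + c *\<^sub>R k)))"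
  have "\<exists>f. f \<nu> = (Q, q \<nu>, 0, 0, 0, 0) \<and> (\<forall>t\<le>\<nu>. psd (fst (f t))) \<and> (\<forall>t<\<nu>. ?R t (f t) (f (Suc t)))"
  proof (rule backward_choice)
    fix t and z' :: "(real^'n^'n) \<times> (real^'n) \<times> real \<times> (real^'n^'m) \<times> (real^'m) \<times> (real^'m^'m)"
    assume z': "psd (fst z')"
    obtain P' \<eta>' r where e: "z' = (P', \<eta>', r)" by (cases z') auto
    show "\<exists>z. psd (fst z) \<and> ?R t z z'"
    proof (rule riccati_step[of P' Q A B "q t" \<eta>'])
      fix K k P \<eta> \<xi> F
      assume "psd P" "pos_def F" "\<And>u x c. stage_form A B Q (q t) P \<eta> P' \<eta>' \<xi> u x c =
         (u + K *v x + c *\<^sub>R k) \<bullet> (F *v (u + K *v x + c *\<^sub>R k))"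
      then show "\<exists>z. psd (fst z) \<and> ?R t z z'"
        by (intro exI[of _ "(P, \<eta>, \<xi>, K, k, F)"]) (simp add: e)
    qed (use z' assms e in auto)
  qed (use assms in simp)
  then obtain f where f: "f \<nu> = (Q, q \<nu>, 0, 0, 0, 0)" "\<forall>t\<le>\<nu>. psd (fst (f t))" "\<forall>t<\<nu>. ?R t (f t) (f (Suc t))"
    by blast
  define P \<eta> \<xi> K k F where "P t = fst (f t)" and "\<eta> t = fst (snd (f t))" and "\<xi> t = fst (snd (snd (f t)))"
    and "K t = fst (snd (snd (snd (f t))))" and "k t = fst (snd (snd (snd (snd (f t)))))"
    and "F t = snd (snd (snd (snd (snd (f t)))))" for t
  have "riccati_solution A B \<nu> Q q P \<eta> \<xi> K k F"
    using f unfolding riccati_solution_def P_def \<eta>_def \<xi>_def K_def k_def F_def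
    by (simp add: split_beta)
  then show ?thesis by blast
qed

lemma pos_def_form_zero: "pos_def F \<Longrightarrow> v \<bullet> (F *v v) = 0 \<Longrightarrow> v = 0"
  unfolding pos_def_def by (metis less_irrefl)

lemma pos_def_form_nonneg: "pos_def F \<Longrightarrow> 0 \<le> v \<bullet> (F *v v)"
  unfolding pos_def_def by (metis inner_zero_left less_eq_real_def)

text \<open>Here the control is known as feedback of the actual state; in
  \<open>state_eq_closed_loop\<close> it is prescribed along the closed loop.\<close>

lemma state_feedback_eq_closed_loop:
  assumes "\<And>t. t \<in> {s..<T} \<Longrightarrow> u t = - (K t *v state A B s x0 u w t) - k t" "t \<le> T"
  shows "state A B s x0 u w t = closed_loop A B K k s x0 w t"
  using assms(2)
proof (induction t)
  case (Suc t)
  then show ?case using assms(1)[of t] by simp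
qed simp

context tracking_noise
begin

text \<open>A verification argument. For square-integrable controls the expected cost is a constant
  plus half the expected sum of stage forms, and the Riccati feedback makes all forms zero. An
  optimal law must therefore have forms with expected sum at most 0; being nonnegative they vanish
  almost surely, and definiteness of \<open>F t\<close> identifies the control.\<close>

lemma optimal_control_is_feedback:
  fixes A Q :: "real^'n^'n" and B :: "real^'m^'n"
  assumes ric: "riccati_solution A B \<nu> Q q P \<eta> \<xi> K k F" and Q: "psd Q"
    and q: "\<And>t. t \<in> {1..\<nu>} \<Longrightarrow> q t = - (Q *v xr t)" and N: "1 \<le> N" "1 \<le> \<nu>"
    and opt: "optimal_control M w A B Q xr \<nu> x0 N \<kappa>"
  defines "s \<equiv> start \<nu> N"
  shows "AE \<omega> in M. \<forall>t\<in>{s..<\<nu>}. \<kappa> t (restrict (\<lambda>t. w t \<omega>) {1..<t})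
    = - (K t *v closed_loop A B K k s x0 (\<lambda>t. w t \<omega>) t) - k t"
proof -
  have s: "1 \<le> s" "s \<le> \<nu>" using N by (auto simp: s_def start_def)
  define U where "U \<kappa> t \<omega> = control s \<kappa> (\<lambda>t. w t \<omega>) t" for \<kappa> :: "nat \<Rightarrow> (nat \<Rightarrow> real^'m) \<Rightarrow> real^'m" and t \<omega>
  define X where "X \<kappa> t \<omega> = state A B s x0 (control s \<kappa> (\<lambda>t. w t \<omega>)) (\<lambda>t. w t \<omega>) t" for \<kappa> t \<omega>
  define cost where "cost \<kappa> \<omega> = tracking_cost Q xr \<nu> N (\<lambda>t. X \<kappa> t \<omega>) (\<lambda>t. U \<kappa> t \<omega>)" for \<kappa> \<omega>
  define \<Phi> where "\<Phi> \<kappa> t \<omega> = stage_form A B Q (q t) (P t) (\<eta> t) (P (t+1)) (\<eta> (t+1)) (\<xi> t) (U \<kappa> t \<omega>) (X \<kappa> t \<omega>) 1" for \<kappa> t \<omega>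
  \<comment> \<open>The part of the cost that no control law can influence; it turns out to be the
    optimal value.\<close>
  define C where "C = 1/2 * (xr \<nu> \<bullet> (Q *v xr \<nu>)) + 1/2 * (x0 \<bullet> (P s *v x0)) + \<eta> s \<bullet> x0 +
       (\<Sum>t = s..<\<nu>. 1/2 * (xr t \<bullet> (Q *v xr t)) - 1/2 * \<xi> t + 1/2 * trace (transpose B ** P (t+1) ** B ** \<Sigma>w))"
  have fin: "P \<nu> = Q" "\<eta> \<nu> = - (Q *v xr \<nu>)" and Psd: "\<And>t. t \<le> \<nu> \<Longrightarrow> psd (P t)"
    and F: "\<And>t. t < \<nu> \<Longrightarrow> pos_def (F t)"
    and form: "\<And>t u x c. t < \<nu> \<Longrightarrow> stage_form A B Q (q t) (P t) (\<eta> t) (P (t+1)) (\<eta> (t+1)) (\<xi> t) u x c =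
       (u + K t *v x + c *\<^sub>R k t) \<bullet> (F t *v (u + K t *v x + c *\<^sub>R k t))"
    using ric q N by (auto simp: riccati_solution_def)
  have Umeas: "U \<kappa> t \<in> borel_measurable (past T)" if c: "causal \<kappa>" and "t \<le> T" for \<kappa> t T
  proof -
    have "(\<lambda>\<omega>. restrict (\<lambda>t. w t \<omega>) {1..<t}) \<in> measurable (past T) (Pi\<^sub>M {1..<t} (\<lambda>_. borel))"
      using \<open>t \<le> T\<close> by (intro measurable_restrict measurable_past_w) auto
    moreover have "\<kappa> t \<in> borel_measurable (Pi\<^sub>M {1..<t} (\<lambda>_. borel))" using c by (simp add: causal_def)
    ultimately have "(\<lambda>\<omega>. \<kappa> t (restrict (\<lambda>t. w t \<omega>) {1..<t})) \<in> borel_measurable (past T)"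
      by (rule measurable_compose)
    then show ?thesis by (cases "t < s") (auto simp: U_def[abs_def] control_def)
  qed
  have X_Suc: "X \<kappa> (Suc t) \<omega> = (if Suc t < s then 0 else if Suc t = s then x0 else A *v X \<kappa> t \<omega> + B *v (U \<kappa> t \<omega> + w t \<omega>))" for \<kappa> t \<omega>
    by (simp add: X_def U_def)
  have X_s: "X \<kappa> s \<omega> = x0" for \<kappa> \<omega>
    using s by (cases s) (auto simp: X_Suc)
  have Xmeas: "X \<kappa> t \<in> borel_measurable (past T)" if c: "causal \<kappa>" and "t \<le> T" for \<kappa> t T
    using \<open>t \<le> T\<close>
  proof (induction t)
    case (Suc t)
    show ?case
    proof (cases "Suc t \<le> s")
      case False
      then have [measurable]: "w t \<in> borel_measurable (past T)"
        using s Suc.prems by (intro measurable_past_w) auto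
      have [measurable]: "X \<kappa> t \<in> borel_measurable (past T)" "U \<kappa> t \<in> borel_measurable (past T)"
        using Suc c by (auto intro: Umeas)
      show ?thesis unfolding X_Suc[abs_def] using False by simp
    next
      case True
      then have "X \<kappa> (Suc t) = (\<lambda>_. if Suc t < s then 0 else x0)" by (auto simp: X_Suc fun_eq_iff)
      then show ?thesis by simp
    qed
  qed (simp add: X_def[abs_def])
  have cost_eq: "cost \<kappa> \<omega> = (\<Sum>t = s..<\<nu>. 1/2 * \<Phi> \<kappa> t \<omega>
      + stage_noise A B \<Sigma>w (P (t+1)) (\<eta> (t+1)) (U \<kappa> t \<omega>) (X \<kappa> t \<omega>) (w t \<omega>)) + C" for \<kappa> \<omega>
  proof -
    have "cost \<kappa> \<omega> = est_loss B \<Sigma>w \<nu> Q q P \<eta> \<xi> N (\<lambda>t. X \<kappa> t \<omega>) + (\<Sum>t = s..<\<nu>. 1/2 * (U \<kappa> t \<omega> \<bullet> U \<kappa> t \<omega>)) + C"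
      unfolding cost_def s_def
      by (subst tracking_cost_eq[where P=P and \<eta>=\<eta> and xr=xr and \<nu>=\<nu> and q=q and B=B and S=\<Sigma>w and \<xi>=\<xi>,
          OF psd_transpose[OF Q] fin])
         (use q s in \<open>auto simp: C_def X_s s_def[symmetric]\<close>)
    also have "est_loss B \<Sigma>w \<nu> Q q P \<eta> \<xi> N (\<lambda>t. X \<kappa> t \<omega>) + (\<Sum>t = s..<\<nu>. 1/2 * (U \<kappa> t \<omega> \<bullet> U \<kappa> t \<omega>)) =
      (\<Sum>t = s..<\<nu>. 1/2 * \<Phi> \<kappa> t \<omega>
      + stage_noise A B \<Sigma>w (P (t+1)) (\<eta> (t+1)) (U \<kappa> t \<omega>) (X \<kappa> t \<omega>) (w t \<omega>))"
      unfolding s_def \<Phi>_def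
      by (rule est_loss_eq) (use Psd s in \<open>auto simp: s_def[symmetric] psd_transpose X_Suc\<close>)
    finally show ?thesis .
  qed
  have E: "integrable M (\<lambda>\<omega>. \<Sum>t = s..<\<nu>. \<Phi> \<kappa> t \<omega>)" "integrable M (cost \<kappa>)"
      "expectation (cost \<kappa>) = 1/2 * expectation (\<lambda>\<omega>. \<Sum>t = s..<\<nu>. \<Phi> \<kappa> t \<omega>) + C"
    if c: "causal \<kappa>" and sq: "\<And>t. t \<in> {s..<\<nu>} \<Longrightarrow> square_integrable (U \<kappa> t)" for \<kappa>
  proof -
    have Usq: "square_integrable (U \<kappa> t)" if "t \<in> {1..<\<nu>}" for t
    proof (cases "t < s")
      case True
      then have "U \<kappa> t = (\<lambda>_. 0)" by (auto simp: U_def control_def)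
      then show ?thesis by (simp add: square_integrable_const)
    qed (use sq that in auto)
    have Xsq: "square_integrable (X \<kappa> t)" if "t \<le> \<nu>" for t
      using that
    proof (induction t)
      case (Suc t)
      show ?case
      proof (cases "Suc t \<le> s")
        case True
        then have "X \<kappa> (Suc t) = (\<lambda>_. if Suc t < s then 0 else x0)" by (auto simp: X_Suc fun_eq_iff)
        then show ?thesis by (simp only: square_integrable_const)
      next
        case False
        then have "X \<kappa> (Suc t) = (\<lambda>\<omega>. A *v X \<kappa> t \<omega> + B *v (U \<kappa> t \<omega> + w t \<omega>))" by (auto simp: X_Suc)
        moreover have "square_integrable (\<lambda>\<omega>. A *v X \<kappa> t \<omega> + B *v (U \<kappa> t \<omega> + w t \<omega>))"
          using False s Suc.prems Suc.IH
          by (intro square_integrable_add square_integrable_matrix Usq w_square_integrable) auto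
        ultimately show ?thesis by simp
      qed
    qed (simp add: X_def[abs_def] square_integrable_const)
    have p: "{\<omega> \<in> space M. s \<le> t} \<in> sets (past t)" for t
      by (cases "s \<le> t") (auto intro: sets.top[of "past t", simplified])
    note S = expectation_stage_sum[where \<sigma>="\<lambda>_. s" and X="X \<kappa>" and U="U \<kappa>" and \<nu>=\<nu> and A=A and B=B and Q=Q
        and P=P and q=q and \<eta>=\<eta> and \<xi>=\<xi>, OF p s(1) Xmeas[OF c order_refl] _ Umeas[OF c order_refl] Usq, folded \<Phi>_def]
    show "integrable M (\<lambda>\<omega>. \<Sum>t = s..<\<nu>. \<Phi> \<kappa> t \<omega>)" by (rule S(1)) (use Xsq in auto)
    have i: "integrable M (\<lambda>\<omega>. \<Sum>t = s..<\<nu>. 1/2 * \<Phi> \<kappa> t \<omega>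
      + stage_noise A B \<Sigma>w (P (t+1)) (\<eta> (t+1)) (U \<kappa> t \<omega>) (X \<kappa> t \<omega>) (w t \<omega>))" by (rule S(2)) (use Xsq in auto)
    then show "integrable M (cost \<kappa>)" unfolding cost_eq[abs_def] by simp
    show "expectation (cost \<kappa>) = 1/2 * expectation (\<lambda>\<omega>. \<Sum>t = s..<\<nu>. \<Phi> \<kappa> t \<omega>) + C"
      unfolding cost_eq[abs_def] using S(3) Xsq i by (simp add: prob_space)
  qed
  have cost_nonneg: "0 \<le> cost \<kappa> \<omega>" for \<kappa> \<omega>
    unfolding cost_def tracking_cost_def
    using psd_form_nonneg[OF Q] by (intro add_nonneg_nonneg sum_nonneg mult_nonneg_nonneg) auto
  have ec: "expected_cost M w A B Q xr \<nu> x0 N \<kappa> = (\<integral>\<^sup>+\<omega>. ennreal (cost \<kappa> \<omega>) \<partial>M)" for \<kappa>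
    unfolding expected_cost_def cost_def X_def U_def s_def Let_def ..
  \<comment> \<open>The state is reconstructed from the past noise by \<open>closed_loop\<close>, so
    that the feedback is an admissible causal law.\<close>
  define \<kappa>b where "\<kappa>b t h = - (K t *v closed_loop A B K k s x0 h t) - k t" for t h
  let ?cl = "\<lambda>t \<omega>. closed_loop A B K k s x0 (\<lambda>t. w t \<omega>) t"
  have cb: "causal \<kappa>b"
    unfolding causal_def \<kappa>b_def
  proof (intro allI)
    fix t
    have [measurable]: "(\<lambda>h. closed_loop A B K k s x0 h t) \<in> borel_measurable (Pi\<^sub>M {1..<t} (\<lambda>_. borel))"
      by (rule measurable_closed_loop[where T=t]) (use s in auto)
    show "(\<lambda>h. - (K t *v closed_loop A B K k s x0 h t) - k t) \<in> borel_measurable (Pi\<^sub>M {1..<t} (\<lambda>_. borel))"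
      by measurable
  qed
  have Ub: "U \<kappa>b t \<omega> = - (K t *v ?cl t \<omega>) - k t" if "t \<in> {s..<\<nu>}" for t \<omega>
    using that closed_loop_restrict[OF s(1) order_refl[of t], where A=A and B=B and K=K and k=k and ?x0.0=x0 and h="\<lambda>t. w t \<omega>"]
    by (simp add: U_def control_def \<kappa>b_def)
  have Xb: "X \<kappa>b t \<omega> = ?cl t \<omega>" if "t \<le> \<nu>" for t \<omega>
    unfolding X_def using that by (intro state_eq_closed_loop[where T=\<nu>]) (use Ub in \<open>auto simp: U_def\<close>)
  have clsq: "square_integrable (?cl t)" for t
    using square_integrable_closed_loop[of "\<lambda>_. x0" "\<lambda>_. s"] s by (simp add: square_integrable_const)
  have "square_integrable (U \<kappa>b t)" if "t \<in> {s..<\<nu>}" for t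
  proof -
    have "U \<kappa>b t = (\<lambda>\<omega>. 0 - K t *v ?cl t \<omega> - k t)" using Ub[OF that] by auto
    moreover have "square_integrable (\<lambda>\<omega>. 0 - K t *v ?cl t \<omega> - k t)"
      by (intro square_integrable_diff square_integrable_const square_integrable_matrix clsq)
    ultimately show ?thesis by simp
  qed
  note Eb = E[OF cb this]
  have "\<Phi> \<kappa>b t \<omega> = 0" if "t \<in> {s..<\<nu>}" for t \<omega>
    unfolding \<Phi>_def using that Ub[OF that] Xb[of t \<omega>] by (simp add: form[simplified])
  then have "expectation (cost \<kappa>b) = C" using Eb(3) by simp
  then have C: "0 \<le> C" "expected_cost M w A B Q xr \<nu> x0 N \<kappa>b = ennreal C"
    using cost_nonneg Bochner_Integration.integral_nonneg[of M "cost \<kappa>b"] Eb(2)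
    by (auto simp: ec nn_integral_eq_integral)
  have c: "causal \<kappa>" and le: "(\<integral>\<^sup>+\<omega>. ennreal (cost \<kappa> \<omega>) \<partial>M) \<le> ennreal C"
    using opt cb C unfolding optimal_control_def ec by metis+
  have [measurable]: "U \<kappa> t \<in> borel_measurable M" "X \<kappa> t \<in> borel_measurable M" for t
    using measurable_from_past[OF Umeas[OF c order_refl]] measurable_from_past[OF Xmeas[OF c order_refl]] by auto
  have cm[measurable]: "cost \<kappa> \<in> borel_measurable M"
    unfolding cost_def[abs_def] tracking_cost_def by measurable
  have ci: "integrable M (cost \<kappa>)"
    by (rule integrableI_nonneg) (use cost_nonneg le in \<open>auto intro: le_less_trans\<close>)
  \<comment> \<open>A causal law carries no moment condition. Optimality bounds its expected cost by
    \<open>C\<close>, and the nonnegative cost dominates each control energy; only now may its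
    expected cost be split.\<close>
  have "square_integrable (U \<kappa> t)" if "t \<in> {s..<\<nu>}" for t
  proof -
    have "integrable M (\<lambda>\<omega>. (norm (U \<kappa> t \<omega>))\<^sup>2)"
    proof (rule Bochner_Integration.integrable_bound)
      show "integrable M (\<lambda>\<omega>. 2 * cost \<kappa> \<omega>)" using ci by simp
      have "(norm (U \<kappa> t \<omega>))\<^sup>2 \<le> 2 * cost \<kappa> \<omega>" for \<omega>
      proof -
        have "1/2 * (norm (U \<kappa> t \<omega>))\<^sup>2 \<le> 1/2 * ((X \<kappa> t \<omega> - xr t) \<bullet> (Q *v (X \<kappa> t \<omega> - xr t))) + 1/2 * (norm (U \<kappa> t \<omega>))\<^sup>2"
          using psd_form_nonneg[OF Q] by simp
        also have "\<dots> \<le> (\<Sum>t = s..<\<nu>. 1/2 * ((X \<kappa> t \<omega> - xr t) \<bullet> (Q *v (X \<kappa> t \<omega> - xr t))) + 1/2 * (norm (U \<kappa> t \<omega>))\<^sup>2)"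
          by (rule member_le_sum[OF that, where f="\<lambda>t. 1/2 * ((X \<kappa> t \<omega> - xr t) \<bullet> (Q *v (X \<kappa> t \<omega> - xr t))) + 1/2 * (norm (U \<kappa> t \<omega>))\<^sup>2"])
             (use psd_form_nonneg[OF Q] in auto)
        also have "\<dots> \<le> cost \<kappa> \<omega>"
          unfolding cost_def tracking_cost_def s_def using psd_form_nonneg[OF Q] by simp
        finally show ?thesis by simp
      qed
      then show "AE \<omega> in M. norm ((norm (U \<kappa> t \<omega>))\<^sup>2) \<le> norm (2 * cost \<kappa> \<omega>)"
        using cost_nonneg by simp
    qed measurable
    then show ?thesis by (simp add: square_integrable_def)
  qed
  note Ek = E[OF c this]
  have "ennreal (expectation (cost \<kappa>)) \<le> ennreal C"
    using le nn_integral_eq_integral[OF ci] cost_nonneg by simp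
  then have "expectation (\<lambda>\<omega>. \<Sum>t = s..<\<nu>. \<Phi> \<kappa> t \<omega>) \<le> 0" using Ek(3) C by simp
  moreover have nn: "0 \<le> \<Phi> \<kappa> t \<omega>" if "t \<in> {s..<\<nu>}" for t \<omega>
    unfolding \<Phi>_def using that F by (simp add: form[simplified] pos_def_form_nonneg)
  ultimately have "expectation (\<lambda>\<omega>. \<Sum>t = s..<\<nu>. \<Phi> \<kappa> t \<omega>) = 0"
    by (intro antisym Bochner_Integration.integral_nonneg sum_nonneg) auto
  moreover have "AE \<omega> in M. 0 \<le> (\<Sum>t = s..<\<nu>. \<Phi> \<kappa> t \<omega>)"
    using nn by (intro AE_I2 sum_nonneg)
  ultimately have "AE \<omega> in M. (\<Sum>t = s..<\<nu>. \<Phi> \<kappa> t \<omega>) = 0"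
    using integral_nonneg_eq_0_iff_AE[OF Ek(1)] by blast
  then show ?thesis
  proof (rule AE_mp, intro AE_I2 impI ballI)
    fix \<omega> t assume z: "(\<Sum>t = s..<\<nu>. \<Phi> \<kappa> t \<omega>) = 0" and t: "t \<in> {s..<\<nu>}"
    have U: "U \<kappa> t \<omega> = - (K t *v X \<kappa> t \<omega>) - k t" if "t \<in> {s..<\<nu>}" for t
    proof -
      have "\<Phi> \<kappa> t \<omega> = 0" using z nn that sum_nonneg_eq_0_iff[of "{s..<\<nu>}" "\<lambda>t. \<Phi> \<kappa> t \<omega>"] by auto
      then have "U \<kappa> t \<omega> + K t *v X \<kappa> t \<omega> + 1 *\<^sub>R k t = 0"
        unfolding \<Phi>_def using that by (intro pos_def_form_zero[OF F]) (auto simp: form[simplified])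
      then show ?thesis by (simp add: eq_neg_iff_add_eq_0 algebra_simps)
    qed
    have "X \<kappa> t \<omega> = ?cl t \<omega>"
      unfolding X_def using t U
      by (intro state_feedback_eq_closed_loop[where T=\<nu>]) (auto simp: U_def X_def)
    then show "\<kappa> t (restrict (\<lambda>t. w t \<omega>) {1..<t}) = - (K t *v ?cl t \<omega>) - k t"
      using U[OF t] t by (simp add: U_def control_def)
  qed
qed

text \<open>For each fixed realization of the initial data the feedback identity fails only on a
  null set of noise, but this set varies with the realization. Independence makes the joint law a
  product, so the joint exceptional set is null because almost all its sections are.\<close>

lemma agent_state_eq_closed_loop:
  fixes A Q :: "real^'n^'n" and B :: "real^'m^'n"
  assumes ric: "riccati_solution A B \<nu> Q q P \<eta> \<xi> K k F" and Q: "psd Q"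
    and q: "\<And>t. t \<in> {1..\<nu>} \<Longrightarrow> q t = - (Q *v xr t)" and \<nu>: "1 \<le> \<nu>"
    and N: "AE \<omega> in M. 1 \<le> \<N> \<omega>"
    and pol: "optimal_policy M xbar \<N> w A B Q xr \<nu> \<kappa>"
  shows "AE \<omega> in M. \<forall>t\<le>\<nu>. agent_state xbar \<N> w A B \<nu> \<kappa> t \<omega> =
    closed_loop A B K k (start \<nu> (\<N> \<omega>)) (xbar \<omega>) (\<lambda>t. w t \<omega>) t"
proof -
  let ?T = "Pi\<^sub>M {1..<\<nu>} (\<lambda>_. borel) :: (nat \<Rightarrow> real^'m) measure"
  let ?S = "borel \<Otimes>\<^sub>M count_space UNIV :: ((real^'n) \<times> nat) measure"
  let ?C = "?S \<Otimes>\<^sub>M ?T"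
  have start1: "1 \<le> start \<nu> N" for N by (simp add: start_def)
  define G where "G x0 N h \<longleftrightarrow> (\<forall>t\<in>{1..<\<nu>}. start \<nu> N \<le> t \<longrightarrow>
    \<kappa> x0 N t (restrict h {1..<t}) = - (K t *v closed_loop A B K k (start \<nu> N) x0 h t) - k t)" for x0 N h
  have \<kappa>m: "(\<lambda>(x0, h). \<kappa> x0 N t h) \<in> borel_measurable (borel \<Otimes>\<^sub>M Pi\<^sub>M {1..<t} (\<lambda>_. borel))" for N t
    using pol by (simp add: optimal_policy_def)
  have cl: "(\<lambda>z. closed_loop A B K k (start \<nu> (snd (fst (fst z)))) (fst (fst (fst z))) (snd (snd z)) t)
      \<in> borel_measurable (?C \<Otimes>\<^sub>M ?C)" if "t \<le> \<nu>" for t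
    by (rule measurable_closed_loop[where T=\<nu>]) (use that start1 in auto)
  \<comment> \<open>The policy is jointly measurable only for a fixed horizon; the horizon takes
    countably many values.\<close>
  have km: "(\<lambda>z. \<kappa> (fst (fst (fst z))) (snd (fst (fst z))) t (restrict (snd (snd z)) {1..<t}))
      \<in> borel_measurable (?C \<Otimes>\<^sub>M ?C)" if t: "t < \<nu>" for t
  proof -
    have r: "(\<lambda>z. restrict (snd (snd z)) {1..<t}) \<in> measurable (?C \<Otimes>\<^sub>M ?C) (Pi\<^sub>M {1..<t} (\<lambda>_. borel))"
      using t by (intro measurable_restrict) auto
    have "(\<lambda>z. \<kappa> (fst (fst (fst z))) N t (restrict (snd (snd z)) {1..<t})) \<in> borel_measurable (?C \<Otimes>\<^sub>M ?C)" for N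
      using measurable_compose[OF measurable_Pair[OF _ r] \<kappa>m[of N t], of "\<lambda>z. fst (fst (fst z))"] by simp
    then show ?thesis by (rule measurable_compose_countable) simp
  qed
  \<comment> \<open>The first factor supplies the initial data and the second the noise; the
    remaining components are the padding.\<close>
  define Bad where "Bad = {z \<in> space (?C \<Otimes>\<^sub>M ?C). \<not> G (fst (fst (fst z))) (snd (fst (fst z))) (snd (snd z))}"
  have Bad: "Bad \<in> sets (?C \<Otimes>\<^sub>M ?C)"
  proof -
    have "Measurable.pred (?C \<Otimes>\<^sub>M ?C) (\<lambda>z. \<not> G (fst (fst (fst z))) (snd (fst (fst z))) (snd (snd z)))"
      unfolding G_def
    proof (intro pred_intros_logic pred_intros_finite)
      fix t assume "t \<in> {1..<\<nu>}"
      then have [measurable]: "(\<lambda>z. closed_loop A B K k (start \<nu> (snd (fst (fst z)))) (fst (fst (fst z))) (snd (snd z)) t)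
          \<in> borel_measurable (?C \<Otimes>\<^sub>M ?C)"
        "(\<lambda>z. \<kappa> (fst (fst (fst z))) (snd (fst (fst z))) t (restrict (snd (snd z)) {1..<t}))
          \<in> borel_measurable (?C \<Otimes>\<^sub>M ?C)"
        by (intro cl km; simp)+
      show "Measurable.pred (?C \<Otimes>\<^sub>M ?C) (\<lambda>z. \<kappa> (fst (fst (fst z))) (snd (fst (fst z))) t (restrict (snd (snd z)) {1..<t}) =
        - (K t *v closed_loop A B K k (start \<nu> (snd (fst (fst z)))) (fst (fst (fst z))) (snd (snd z)) t) - k t)"
        by measurable
    qed measurable
    then show ?thesis unfolding Bad_def by (simp add: pred_def)
  qed
  txt \<open>Independence of two variables requires a common codomain, hence the padding.\<close>
  define Y where "Y \<omega> = ((xbar \<omega>, \<N> \<omega>), restrict (\<lambda>_. 0) {1..<\<nu>} :: nat \<Rightarrow> real^'m)" for \<omega>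
  define W where "W \<omega> = ((0 :: real^'n, 0 :: nat), restrict (\<lambda>t. w t \<omega>) {1..<\<nu>})" for \<omega>
  have wm: "(\<lambda>\<omega>. restrict (\<lambda>t. w t \<omega>) {1..<\<nu>}) \<in> measurable M' ?T"
    if "\<And>i. i \<in> {1..<\<nu>} \<Longrightarrow> w i \<in> borel_measurable M'" for M'
    using that by (intro measurable_restrict)
  have Wm: "W \<in> measurable M' ?C" if "\<And>i. i \<in> {1..<\<nu>} \<Longrightarrow> w i \<in> borel_measurable M'" for M'
    unfolding W_def using wm[OF that] by (intro measurable_Pair) auto
  have WM: "W \<in> measurable M ?C" using w_rv by (intro Wm) auto
  have YM: "Y \<in> measurable M ?C"
    unfolding Y_def by (intro measurable_Pair) (auto simp: space_PiM)
  have ind: "indep_var ?C Y ?C W"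
  proof (rule indep_var_if_sigma_gen[of "{..<1}" "{1..<\<nu>}"])
    have "(\<lambda>\<omega>. (xbar \<omega>, \<N> \<omega>)) \<in> measurable (past 1) ?S" by (rule measurable_past_init) simp
    then have "Y \<in> measurable (past 1) ?C"
      unfolding Y_def by (intro measurable_Pair) (auto simp: space_PiM)
    then show "Y -` E \<inter> space M \<in> sigma_sets (space M) (\<Union>i\<in>{..<1}. gen i)" if "E \<in> sets ?C" for E
      using measurable_sets[of Y "past 1" ?C E] that by (simp add: sets_past)
    define N where "N = sigma (space M) (\<Union>i\<in>{1..<\<nu>}. gen i)"
    have N: "space N = space M" "sets N = sigma_sets (space M) (\<Union>i\<in>{1..<\<nu>}. gen i)"
      using gen_Pow by (simp_all add: N_def)
    have "W \<in> measurable N ?C"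
    proof (rule Wm)
      fix i assume i: "i \<in> {1..<\<nu>}"
      show "w i \<in> borel_measurable N"
      proof (rule measurableI)
        fix E :: "(real^'m) set" assume "E \<in> sets borel"
        then have "w i -` E \<inter> space M \<in> gen i" using i by (auto simp: gen_def)
        then show "w i -` E \<inter> space N \<in> sets N" unfolding N using i by (intro sigma_sets.Basic) auto
      qed auto
    qed
    then show "W -` E \<inter> space M \<in> sigma_sets (space M) (\<Union>i\<in>{1..<\<nu>}. gen i)" if "E \<in> sets ?C" for E
      using measurable_sets[of W N ?C E] that N by simp
  qed (use WM YM in auto)
  interpret W: prob_space "distr M ?C W" using WM by (rule prob_space_distr)
  \<comment> \<open>The section of \<open>Bad\<close> at the initial data of \<open>\<omega>\<close>
    is null, by the verification argument for this fixed realization.\<close>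
  have "AE \<omega> in M. emeasure (distr M ?C W) (Pair (Y \<omega>) -` Bad) = 0"
    using pol[unfolded optimal_policy_def, THEN conjunct2] N
  proof eventually_elim
    case (elim \<omega>)
    have "AE \<omega>' in M. \<forall>t\<in>{start \<nu> (\<N> \<omega>)..<\<nu>}. \<kappa> (xbar \<omega>) (\<N> \<omega>) t (restrict (\<lambda>t. w t \<omega>') {1..<t})
        = - (K t *v closed_loop A B K k (start \<nu> (\<N> \<omega>)) (xbar \<omega>) (\<lambda>t. w t \<omega>') t) - k t"
      by (rule optimal_control_is_feedback[OF ric Q q elim(2) \<nu> elim(1)])
    then have "AE \<omega>' in M. G (xbar \<omega>) (\<N> \<omega>) (restrict (\<lambda>t. w t \<omega>') {1..<\<nu>})"
    proof eventually_elim
      case (elim \<omega>')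
      show ?case unfolding G_def
      proof (intro ballI impI)
        fix t assume t: "t \<in> {1..<\<nu>}" "start \<nu> (\<N> \<omega>) \<le> t"
        then have "{1..<\<nu>} \<inter> {1..<t} = {1..<t}" by auto
        then show "\<kappa> (xbar \<omega>) (\<N> \<omega>) t (restrict (restrict (\<lambda>t. w t \<omega>') {1..<\<nu>}) {1..<t}) =
          - (K t *v closed_loop A B K k (start \<nu> (\<N> \<omega>)) (xbar \<omega>) (restrict (\<lambda>t. w t \<omega>') {1..<\<nu>}) t) - k t"
          using elim t start1 by (subst closed_loop_restrict) (auto simp: restrict_restrict)
      qed
    qed
    then have "AE \<omega>' in M. \<not> (Y \<omega>, W \<omega>') \<in> Bad"
      by (rule AE_mp) (auto simp: Bad_def Y_def W_def)
    moreover have "{\<omega>' \<in> space M. (Y \<omega>, W \<omega>') \<in> Bad} \<in> sets M"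
      using measurable_sets[OF WM sets_Pair1[OF Bad, of "Y \<omega>"]]
      by (simp add: vimage_def Collect_conj_eq Int_commute)
    ultimately have "emeasure M {\<omega>' \<in> space M. (Y \<omega>, W \<omega>') \<in> Bad} = 0"
      by (subst (asm) AE_iff_measurable) auto
    moreover have "W -` (Pair (Y \<omega>) -` Bad) \<inter> space M = {\<omega>' \<in> space M. (Y \<omega>, W \<omega>') \<in> Bad}" by auto
    ultimately show ?case
      using emeasure_distr[OF WM sets_Pair1[OF Bad]] by simp
  qed
  then have "(\<integral>\<^sup>+\<omega>. emeasure (distr M ?C W) (Pair (Y \<omega>) -` Bad) \<partial>M) = 0"
    by (subst nn_integral_cong_AE[where v="\<lambda>_. 0"]) auto
  also have "(\<integral>\<^sup>+\<omega>. emeasure (distr M ?C W) (Pair (Y \<omega>) -` Bad) \<partial>M) =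
      (\<integral>\<^sup>+y. emeasure (distr M ?C W) (Pair y -` Bad) \<partial>distr M ?C Y)"
  proof (rule nn_integral_distr[symmetric, OF YM])
    have "Bad \<in> sets (?C \<Otimes>\<^sub>M distr M ?C W)" using Bad by (simp cong: sets_pair_measure_cong)
    from W.measurable_emeasure_Pair[OF this]
    show "(\<lambda>y. emeasure (distr M ?C W) (Pair y -` Bad)) \<in> borel_measurable (distr M ?C Y)" by simp
  qed
  also have "\<dots> = emeasure (distr M ?C Y \<Otimes>\<^sub>M distr M ?C W) Bad"
    using Bad by (intro W.emeasure_pair_measure_alt[symmetric]) (simp cong: sets_pair_measure_cong)
  also have "\<dots> = emeasure (distr M (?C \<Otimes>\<^sub>M ?C) (\<lambda>\<omega>. (Y \<omega>, W \<omega>))) Bad"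
    using ind by (simp add: indep_var_distribution_eq)
  also have "\<dots> = emeasure M ((\<lambda>\<omega>. (Y \<omega>, W \<omega>)) -` Bad \<inter> space M)"
    using YM WM Bad by (intro emeasure_distr measurable_Pair)
  finally have "AE \<omega> in M. (Y \<omega>, W \<omega>) \<notin> Bad"
    by (intro AE_I[where N="(\<lambda>\<omega>. (Y \<omega>, W \<omega>)) -` Bad \<inter> space M"])
       (auto intro!: measurable_sets[OF measurable_Pair[OF YM WM] Bad])
  then show ?thesis
  proof (rule AE_mp, intro AE_I2 impI allI)
    fix \<omega> t assume \<omega>: "\<omega> \<in> space M" "(Y \<omega>, W \<omega>) \<notin> Bad" and t: "t \<le> \<nu>"
    have "Y \<omega> \<in> space ?C" "W \<omega> \<in> space ?C" using YM WM \<omega>(1) by (auto dest: measurable_space)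
    then have G: "G (xbar \<omega>) (\<N> \<omega>) (restrict (\<lambda>t. w t \<omega>) {1..<\<nu>})"
      using \<omega> by (simp add: Bad_def space_pair_measure Y_def W_def)
    let ?s = "start \<nu> (\<N> \<omega>)"
    show "agent_state xbar \<N> w A B \<nu> \<kappa> t \<omega> = closed_loop A B K k ?s (xbar \<omega>) (\<lambda>t. w t \<omega>) t"
      unfolding agent_state_def Let_def
    proof (rule state_eq_closed_loop[where T=\<nu>])
      fix t assume t: "t \<in> {?s..<\<nu>}"
      then have "{1..<\<nu>} \<inter> {1..<t} = {1..<t}" "t \<in> {1..<\<nu>}" using start1[of "\<N> \<omega>"] by auto
      moreover have "closed_loop A B K k ?s (xbar \<omega>) (restrict (\<lambda>t. w t \<omega>) {1..<\<nu>}) t =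
        closed_loop A B K k ?s (xbar \<omega>) (\<lambda>t. w t \<omega>) t"
        using t by (intro closed_loop_restrict start1) auto
      ultimately show "control ?s (\<kappa> (xbar \<omega>) (\<N> \<omega>)) (\<lambda>t. w t \<omega>) t =
        - (K t *v closed_loop A B K k ?s (xbar \<omega>) (\<lambda>t. w t \<omega>) t) - k t"
        using G[unfolded G_def, rule_format, of t] t by (simp add: control_def restrict_restrict)
    qed (rule t)
  qed
qed

end

section \<open>Minimizers of the expected loss\<close>

lemma matrix_eq_0_if_transpose_mult_0: "(\<And>h. transpose L *v h = 0) \<Longrightarrow> L = 0" for L :: "real^'p^'q"
proof -
  assume "\<And>h. transpose L *v h = 0"
  then have "transpose L = 0" by (simp add: matrix_eq)
  then show "L = 0" by (simp add: transpose_def vec_eq_iff)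
qed

lemma affine_zero_imp_linear_part_zero:
  fixes L :: "real^'p^'q"
  assumes "\<And>x. L *v x + g = 0"
  shows "L = 0"
  using assms assms[of 0] by (simp add: matrix_eq)

context tracking_noise
begin

text \<open>If \<open>a \<bullet> xbar\<close> is constant on the event, \<open>a\<close> is a null
  vector of the conditional covariance matrix.\<close>

lemma initial_state_nondegenerate:
  assumes cov: "pos_def (cov_matrix (uniform_measure M {\<omega> \<in> space M. \<N> \<omega> = \<nu>}) xbar)"
    and pos: "0 < prob {\<omega> \<in> space M. \<N> \<omega> = \<nu>}"
    and ae: "AE \<omega> in M. \<N> \<omega> = \<nu> \<longrightarrow> a \<bullet> xbar \<omega> + b = 0"
  shows "a = 0"
proof (rule ccontr)
  assume "a \<noteq> 0"
  define E where "E = {\<omega> \<in> space M. \<N> \<omega> = \<nu>}"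
  define U where "U = uniform_measure M E"
  have E: "E \<in> sets M" unfolding E_def by measurable
  have E0: "emeasure M E \<noteq> 0" using pos by (simp add: E_def emeasure_eq_measure)
  interpret U: prob_space U
    unfolding U_def using E0 by (intro prob_space_uniform_measure) auto
  have [measurable]: "xbar \<in> borel_measurable U" by (simp add: U_def)
  have "integrable U (\<lambda>\<omega>. (norm (xbar \<omega>))\<^sup>2)"
  proof (rule integrableI_bounded)
    have "(\<integral>\<^sup>+\<omega>. ennreal (norm ((norm (xbar \<omega>))\<^sup>2)) \<partial>U) =
        (\<integral>\<^sup>+\<omega>. ennreal (norm ((norm (xbar \<omega>))\<^sup>2)) * indicator E \<omega> \<partial>M) / emeasure M E"
      unfolding U_def using E by (intro nn_integral_uniform_measure) auto
    moreover have "(\<integral>\<^sup>+\<omega>. ennreal (norm ((norm (xbar \<omega>))\<^sup>2)) * indicator E \<omega> \<partial>M) < \<infinity>"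
    proof (rule le_less_trans)
      show "(\<integral>\<^sup>+\<omega>. ennreal (norm ((norm (xbar \<omega>))\<^sup>2)) * indicator E \<omega> \<partial>M) \<le> (\<integral>\<^sup>+\<omega>. ennreal (norm ((norm (xbar \<omega>))\<^sup>2)) \<partial>M)"
        by (intro nn_integral_mono) (auto simp: indicator_def)
      show "\<dots> < \<infinity>" using xbar_sq unfolding integrable_iff_bounded by blast
    qed
    ultimately show "(\<integral>\<^sup>+\<omega>. ennreal (norm ((norm (xbar \<omega>))\<^sup>2)) \<partial>U) < \<infinity>"
      using E0 by (simp add: less_top[symmetric] ennreal_divide_eq_top_iff)
  qed measurable
  then have sq: "U.square_integrable xbar" by (simp add: U.square_integrable_def)
  define \<mu> where "\<mu> = (\<chi> i. U.expectation (\<lambda>\<omega>. xbar \<omega> $ i))"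
  have aeU: "AE \<omega> in U. a \<bullet> xbar \<omega> = - b"
    unfolding U_def
    by (rule AE_uniform_measureI[OF E]) (use ae in \<open>auto simp: E_def eq_neg_iff_add_eq_0\<close>)
  have comp: "integrable U (\<lambda>\<omega>. xbar \<omega> $ i)" for i
    using U.square_integrable_integrable[OF sq] by (simp add: cart_eq_inner_axis)
  have "U.expectation (\<lambda>\<omega>. a \<bullet> xbar \<omega>) = a \<bullet> \<mu>"
    unfolding inner_vec_def \<mu>_def using comp by simp
  moreover have "U.expectation (\<lambda>\<omega>. a \<bullet> xbar \<omega>) = U.expectation (\<lambda>_. - b)"
    by (rule integral_cong_AE) (use aeU in auto)
  ultimately have a\<mu>: "a \<bullet> \<mu> = - b" by (simp add: U.prob_space)
  have sqc: "U.square_integrable (\<lambda>\<omega>. xbar \<omega> $ i - \<mu> $ i)" for i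
  proof (rule U.square_integrable_diff[OF _ U.square_integrable_const])
    show "U.square_integrable (\<lambda>\<omega>. xbar \<omega> $ i)"
      using U.square_integrable_linear[OF _ sq, of "\<lambda>v. v $ i"] by (simp add: linear_iff)
  qed
  have prod: "integrable U (\<lambda>\<omega>. (xbar \<omega> $ i - \<mu> $ i) * (xbar \<omega> $ j - \<mu> $ j))" for i j
    using U.square_integrable_inner[OF sqc sqc] by simp
  have "cov_matrix U xbar *v a = 0"
  proof (rule vec_eq_iff[THEN iffD2], rule allI)
    fix i
    have "(cov_matrix U xbar *v a) $ i =
      (\<Sum>j\<in>UNIV. U.expectation (\<lambda>\<omega>. (xbar \<omega> $ i - \<mu> $ i) * (xbar \<omega> $ j - \<mu> $ j)) * a $ j)"
      by (simp add: matrix_vector_mult_def cov_matrix_def \<mu>_def)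
    also have "\<dots> = U.expectation (\<lambda>\<omega>. \<Sum>j\<in>UNIV. (xbar \<omega> $ i - \<mu> $ i) * (xbar \<omega> $ j - \<mu> $ j) * a $ j)"
      using prod by simp
    also have "\<dots> = U.expectation (\<lambda>\<omega>. 0)"
    proof (rule integral_cong_AE)
      show "AE \<omega> in U. (\<Sum>j\<in>UNIV. (xbar \<omega> $ i - \<mu> $ i) * (xbar \<omega> $ j - \<mu> $ j) * a $ j) = 0"
        using aeU
      proof eventually_elim
        case (elim \<omega>)
        have "(\<Sum>j\<in>UNIV. (xbar \<omega> $ i - \<mu> $ i) * (xbar \<omega> $ j - \<mu> $ j) * a $ j) =
          (xbar \<omega> $ i - \<mu> $ i) * (a \<bullet> xbar \<omega> - a \<bullet> \<mu>)"
          by (simp add: inner_vec_def sum_distrib_left sum_subtractf[symmetric] algebra_simps)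
        then show ?case using elim a\<mu> by simp
      qed
    qed measurable
    finally show "(cov_matrix U xbar *v a) $ i = 0 $ i" by simp
  qed
  then show False using cov \<open>a \<noteq> 0\<close> unfolding U_def E_def pos_def_def by force
qed

text \<open>An affine relation for the state at \<open>t + 1\<close> splits into a part
  \<open>Z\<close> known at time \<open>t\<close> and a multiple of \<open>w t\<close>. Independence
  forces \<open>Z\<close> to vanish, which is an affine relation at time \<open>t\<close> with the
  vector \<open>a\<close> pulled back by the closed loop. By induction the pullback is 0, and
  surjectivity of the closed loop gives \<open>a = 0\<close>.\<close>

lemma closed_loop_nondegenerate:
  assumes cov: "pos_def (cov_matrix (uniform_measure M {\<omega> \<in> space M. \<N> \<omega> = \<nu>}) xbar)"
    and pos: "0 < prob {\<omega> \<in> space M. \<N> \<omega> = \<nu>}"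
    and surj: "\<And>t y. t \<in> {1..<\<nu>} \<Longrightarrow> \<exists>x. A *v x - B *v (K t *v x) = y"
    and t: "1 \<le> t" "t \<le> \<nu>"
    and ae: "AE \<omega> in M. \<N> \<omega> = \<nu> \<longrightarrow>
      a \<bullet> closed_loop A B K k (start \<nu> (\<N> \<omega>)) (xbar \<omega>) (\<lambda>t. w t \<omega>) t + b = 0"
  shows "a = 0"
  using t ae
proof (induction t arbitrary: a b rule: dec_induct)
  case base
  show ?case
  proof (rule initial_state_nondegenerate[OF cov pos])
    show "AE \<omega> in M. \<N> \<omega> = \<nu> \<longrightarrow> a \<bullet> xbar \<omega> + b = 0"
      using base(2) by eventually_elim (auto simp: start_def)
  qed
next
  case (step t)
  let ?X = "\<lambda>\<omega>. closed_loop A B K k (start \<nu> (\<N> \<omega>)) (xbar \<omega>) (\<lambda>t. w t \<omega>) t"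
  have t: "1 \<le> t" "t < \<nu>" using step by auto
  have hm: "\<N> \<in> measurable (past t) (count_space UNIV)" by (rule measurable_past_horizon[OF t(1)])
  define G where "G = transpose (A - B ** K t)"
  have Gv: "(G *v a) \<bullet> x = a \<bullet> (A *v x - B *v (K t *v x))" for x
    unfolding G_def
    by (simp add: inner_commute[of "transpose _ *v _"] inner_transpose_mult matrix_vector_mult_diff_rdistrib
        matrix_vector_mul_assoc[symmetric]) (simp add: inner_commute)
  define Z where "Z \<omega> = (if \<N> \<omega> = \<nu> then (G *v a) \<bullet> ?X \<omega> + (b - a \<bullet> (B *v k t)) else 0)" for \<omega>
  have Xm[measurable]: "?X \<in> borel_measurable (past t)"
  proof (rule measurable_closed_loop[where T=t])
    show "(\<lambda>\<omega>. start \<nu> (\<N> \<omega>)) \<in> measurable (past t) (count_space UNIV)"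
      using hm by (rule measurable_compose) simp
  qed (use t in \<open>auto intro: measurable_past_xbar measurable_past_w simp: start_def\<close>)
  have Xsq: "square_integrable ?X"
    by (rule square_integrable_closed_loop) (use xbar_sq in \<open>auto simp: square_integrable_def start_def\<close>)
  have pm: "{\<omega> \<in> space M. \<N> \<omega> = \<nu>} \<in> sets M" by measurable
  have Zsq: "square_integrable Z"
  proof -
    have "square_integrable (\<lambda>\<omega>. (G *v a) \<bullet> ?X \<omega>)"
      using square_integrable_linear[OF _ Xsq, of "\<lambda>v. (G *v a) \<bullet> v"] by (simp add: linear_iff inner_add_right)
    then show ?thesis unfolding Z_def by (intro square_integrable_cond square_integrable_add square_integrable_const pm)
  qed
  have Zm: "Z \<in> borel_measurable (past t)"
    unfolding Z_def using hm by measurable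
  define h where "h v = a \<bullet> (B *v v)" for v
  have hi: "integrable M (\<lambda>\<omega>. h (w t \<omega>))" "expectation (\<lambda>\<omega>. h (w t \<omega>)) = 0"
  proof -
    have e: "h v = (transpose B *v a) \<bullet> v" for v
      by (metis h_def inner_commute inner_transpose_mult)
    show "integrable M (\<lambda>\<omega>. h (w t \<omega>))" "expectation (\<lambda>\<omega>. h (w t \<omega>)) = 0"
      unfolding e using square_integrable_integrable[OF w_square_integrable[OF t(1)]] w_mean[OF t(1)] by auto
  qed
  have hb: "h \<in> borel_measurable borel" unfolding h_def by measurable
  note Zi = square_integrable_integrable[OF Zsq]
  note ZY = past_product[OF t(1) Zm Zi hb hi(1)]
  have Z2: "integrable M (\<lambda>\<omega>. Z \<omega> * Z \<omega>)" using square_integrable_inner[OF Zsq Zsq] by simp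
  \<comment> \<open>Multiplying the relation by \<open>Z\<close> prepares for expectations: the
    mixed term has mean zero, so the mean of the square of \<open>Z\<close> is zero.\<close>
  have "AE \<omega> in M. Z \<omega> * Z \<omega> + Z \<omega> * h (w t \<omega>) = 0"
    using step.prems(2)
  proof eventually_elim
    case (elim \<omega>)
    show ?case
    proof (cases "\<N> \<omega> = \<nu>")
      case True
      then have "a \<bullet> (A *v ?X \<omega> + B *v (- (K t *v ?X \<omega>) - k t + w t \<omega>)) + b = 0"
        using elim t by (simp add: start_def)
      moreover have "- (K t *v ?X \<omega>) - k t + w t \<omega> = w t \<omega> - K t *v ?X \<omega> - k t" by simp
      ultimately have "a \<bullet> (A *v ?X \<omega> + B *v (w t \<omega> - K t *v ?X \<omega> - k t)) + b = 0" by simp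
      then have "Z \<omega> + h (w t \<omega>) = 0"
        using True by (simp add: Z_def h_def Gv inner_add_right inner_diff_right matrix_vector_right_distrib
            matrix_vector_mult_diff_distrib)
      then show ?thesis by (simp add: distrib_left[symmetric])
    qed (simp add: Z_def)
  qed
  then have "expectation (\<lambda>\<omega>. Z \<omega> * Z \<omega> + Z \<omega> * h (w t \<omega>)) = expectation (\<lambda>_. 0)"
    using Z2 ZY(1) by (intro integral_cong_AE) auto
  then have "expectation (\<lambda>\<omega>. Z \<omega> * Z \<omega>) = 0" using Z2 ZY hi by simp
  then have "AE \<omega> in M. Z \<omega> * Z \<omega> = 0"
    using integral_nonneg_eq_0_iff_AE[OF Z2] by simp
  then have "AE \<omega> in M. \<N> \<omega> = \<nu> \<longrightarrow> (G *v a) \<bullet> ?X \<omega> + (b - a \<bullet> (B *v k t)) = 0"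
    by eventually_elim (auto simp: Z_def)
  then have "G *v a = 0" using step.IH t by simp
  then have "a \<bullet> (A *v x - B *v (K t *v x)) = 0" for x using Gv[of x] by simp
  then show ?case using surj[of t a] t by (metis atLeastLessThan_iff inner_eq_zero_iff)
qed

lemma closed_loop_nondegenerate_matrix:
  fixes L :: "real^'n^'p"
  assumes "pos_def (cov_matrix (uniform_measure M {\<omega> \<in> space M. \<N> \<omega> = \<nu>}) xbar)"
    and "0 < prob {\<omega> \<in> space M. \<N> \<omega> = \<nu>}"
    and "\<And>t y. t \<in> {1..<\<nu>} \<Longrightarrow> \<exists>x. A *v x - B *v (K t *v x) = y"
    and "1 \<le> t" "t \<le> \<nu>"
    and ae: "AE \<omega> in M. \<N> \<omega> = \<nu> \<longrightarrow>
      L *v closed_loop A B K k (start \<nu> (\<N> \<omega>)) (xbar \<omega>) (\<lambda>t. w t \<omega>) t + g = 0"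
  shows "L = 0"
proof (rule matrix_eq_0_if_transpose_mult_0)
  fix h
  show "transpose L *v h = 0"
  proof (rule closed_loop_nondegenerate[OF assms(1-5)])
    show "AE \<omega> in M. \<N> \<omega> = \<nu> \<longrightarrow>
      (transpose L *v h) \<bullet> closed_loop A B K k (start \<nu> (\<N> \<omega>)) (xbar \<omega>) (\<lambda>t. w t \<omega>) t + h \<bullet> g = 0"
      using ae
    proof eventually_elim
      case (elim \<omega>)
      let ?X = "closed_loop A B K k (start \<nu> (\<N> \<omega>)) (xbar \<omega>) (\<lambda>t. w t \<omega>) t"
      have "(transpose L *v h) \<bullet> ?X + h \<bullet> g = h \<bullet> (L *v ?X + g)"
        by (simp add: inner_add_right inner_commute[of "transpose L *v h"] inner_transpose_mult) (simp add: inner_commute)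
      then show ?case using elim by auto
    qed
  qed
qed

text \<open>The subtracted energy depends on the gains only, not on the candidate \<open>Q\<close>,
  \<open>P\<close>, \<open>\<eta>\<close>, \<open>\<xi>\<close>. Comparing expected losses of two
  candidates therefore amounts to comparing expected stage forms along the same trajectory.\<close>

lemma population_loss:
  fixes A Q :: "real^'n^'n" and B :: "real^'m^'n" and K :: "nat \<Rightarrow> real^'n^'m" and k :: "nat \<Rightarrow> real^'m"
    and P :: "nat \<Rightarrow> real^'n^'n" and q \<eta> :: "nat \<Rightarrow> real^'n" and \<xi> :: "nat \<Rightarrow> real"
  assumes sym: "\<And>t. t \<in> {1..\<nu>} \<Longrightarrow> transpose (P t) = P t"
    and N: "AE \<omega> in M. 1 \<le> \<N> \<omega>" and \<nu>: "1 \<le> \<nu>"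
  defines "X \<equiv> \<lambda>t \<omega>. closed_loop A B K k (start \<nu> (\<N> \<omega>)) (xbar \<omega>) (\<lambda>t. w t \<omega>) t"
    and "U \<equiv> \<lambda>t \<omega>. - (K t *v closed_loop A B K k (start \<nu> (\<N> \<omega>)) (xbar \<omega>) (\<lambda>t. w t \<omega>) t) - k t"
    and "\<Phi> \<equiv> \<lambda>\<omega>. \<Sum>t = start \<nu> (\<N> \<omega>)..<\<nu>. stage_form A B Q (q t) (P t) (\<eta> t) (P (t+1)) (\<eta> (t+1)) (\<xi> t)
      (- (K t *v closed_loop A B K k (start \<nu> (\<N> \<omega>)) (xbar \<omega>) (\<lambda>t. w t \<omega>) t) - k t)
      (closed_loop A B K k (start \<nu> (\<N> \<omega>)) (xbar \<omega>) (\<lambda>t. w t \<omega>) t) 1"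
  assumes int: "integrable M (\<lambda>\<omega>. est_loss B \<Sigma>w \<nu> Q q P \<eta> \<xi> (\<N> \<omega>) (\<lambda>t. X t \<omega>))"
  shows "integrable M \<Phi>"
    and "expectation (\<lambda>\<omega>. est_loss B \<Sigma>w \<nu> Q q P \<eta> \<xi> (\<N> \<omega>) (\<lambda>t. X t \<omega>)) =
      1/2 * expectation \<Phi> - expectation (\<lambda>\<omega>. \<Sum>t = start \<nu> (\<N> \<omega>)..<\<nu>. 1/2 * (U t \<omega> \<bullet> U t \<omega>))"
proof -
  have hm: "\<N> \<in> measurable (past t) (count_space UNIV)" if "1 \<le> t" for t by (rule measurable_past_horizon[OF that])
  have Xm: "X t \<in> borel_measurable (past t)" if t: "t \<in> {1..<\<nu>}" for t
    unfolding X_def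
  proof (rule measurable_closed_loop[where T=t])
    show "(\<lambda>\<omega>. start \<nu> (\<N> \<omega>)) \<in> measurable (past t) (count_space UNIV)"
      using t by (intro measurable_compose[OF hm]) auto
  qed (use t in \<open>auto intro: measurable_past_xbar measurable_past_w simp: start_def\<close>)
  have Xsq: "square_integrable (X t)" for t
    unfolding X_def
    by (rule square_integrable_closed_loop) (use xbar_sq in \<open>auto simp: square_integrable_def start_def\<close>)
  have U: "U t \<omega> = 0 - K t *v X t \<omega> - k t" for t \<omega> by (simp add: U_def X_def)
  have Um: "U t \<in> borel_measurable (past t)" if "t \<in> {1..<\<nu>}" for t
    unfolding U[abs_def] using Xm[OF that] by measurable
  have Usq: "square_integrable (U t)" for t
    unfolding U[abs_def] by (intro square_integrable_diff square_integrable_const square_integrable_matrix Xsq)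
  have \<sigma>: "{\<omega> \<in> space M. start \<nu> (\<N> \<omega>) \<le> t} \<in> sets (past t)" if "1 \<le> t" for t
  proof -
    have "{\<omega> \<in> space (past t). start \<nu> (\<N> \<omega>) \<le> t} \<in> sets (past t)" using hm[OF that] by measurable
    then show ?thesis by simp
  qed
  have start1: "1 \<le> start \<nu> N" for N by (simp add: start_def)
  note S = expectation_stage_sum[where \<sigma>="\<lambda>\<omega>. start \<nu> (\<N> \<omega>)" and X=X and U=U and \<nu>=\<nu> and A=A and B=B and Q=Q
        and P=P and q=q and \<eta>=\<eta> and \<xi>=\<xi>, OF \<sigma> start1 Xm Xsq Um Usq]
  have \<Phi>: "\<Phi> = (\<lambda>\<omega>. \<Sum>t = start \<nu> (\<N> \<omega>)..<\<nu>.
      stage_form A B Q (q t) (P t) (\<eta> t) (P (t+1)) (\<eta> (t+1)) (\<xi> t) (U t \<omega>) (X t \<omega>) 1)"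
    by (simp add: \<Phi>_def U_def X_def)
  show "integrable M \<Phi>" unfolding \<Phi> by (rule S(1))
  let ?H = "\<lambda>\<omega>. \<Sum>t = start \<nu> (\<N> \<omega>)..<\<nu>.
     1/2 * stage_form A B Q (q t) (P t) (\<eta> t) (P (t+1)) (\<eta> (t+1)) (\<xi> t) (U t \<omega>) (X t \<omega>) 1
       + stage_noise A B \<Sigma>w (P (t+1)) (\<eta> (t+1)) (U t \<omega>) (X t \<omega>) (w t \<omega>)"
  let ?L = "\<lambda>\<omega>. est_loss B \<Sigma>w \<nu> Q q P \<eta> \<xi> (\<N> \<omega>) (\<lambda>t. X t \<omega>)"
  let ?V = "\<lambda>\<omega>. \<Sum>t = start \<nu> (\<N> \<omega>)..<\<nu>. 1/2 * (U t \<omega> \<bullet> U t \<omega>)"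
  have iH: "integrable M ?H" by (rule S(2))
  have ae: "AE \<omega> in M. ?V \<omega> = ?H \<omega> - ?L \<omega>"
    using N
  proof eventually_elim
    case (elim \<omega>)
    have "?L \<omega> + ?V \<omega> = ?H \<omega>"
    proof (rule est_loss_eq)
      show "start \<nu> (\<N> \<omega>) \<le> \<nu>" using elim \<nu> by (simp add: start_def)
      show "X (t + 1) \<omega> = A *v X t \<omega> + B *v (U t \<omega> + w t \<omega>)" if "t \<in> {start \<nu> (\<N> \<omega>)..<\<nu>}" for t
        using that by (simp add: X_def U_def)
    qed (rule sym)
    then show ?case by simp
  qed
  have Vm: "?V \<in> borel_measurable M"
  proof -
    have s: "(\<Sum>t = start \<nu> (\<N> \<omega>)..<\<nu>. f t) = (\<Sum>t = 1..<\<nu>. if start \<nu> (\<N> \<omega>) \<le> t then f t else (0::real))" for f \<omega>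
      using start1[of "\<N> \<omega>"] by (subst sum.inter_filter[symmetric]) (auto intro!: sum.cong)
    have [measurable]: "U t \<in> borel_measurable M" for t using Usq by (simp add: square_integrable_def)
    show ?thesis unfolding s by measurable
  qed
  have "expectation ?V = expectation (\<lambda>\<omega>. ?H \<omega> - ?L \<omega>)"
    by (rule integral_cong_AE[OF Vm _ ae]) (intro borel_measurable_integrable Bochner_Integration.integrable_diff iH int)
  also have "\<dots> = expectation ?H - expectation ?L" using iH int by simp
  finally show "expectation ?L = 1/2 * expectation \<Phi> - expectation ?V" unfolding \<Phi> using S(3) by simp
qed

text \<open>The forms of the Riccati solution vanish under its own feedback, so \<open>le\<close>
  leaves no room for the nonnegative forms of the other candidate along the trajectory.\<close>

lemma population_minimizer_weight:
  fixes A Q Q' :: "real^'n^'n" and B :: "real^'m^'n"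
  assumes ctrl: "controllable A B" and inv: "invertible A" and \<nu>: "CARD('n) + 1 \<le> \<nu>"
    and cov: "pos_def (cov_matrix (uniform_measure M {\<omega> \<in> space M. \<N> \<omega> = \<nu>}) xbar)"
    and pos: "0 < prob {\<omega> \<in> space M. \<N> \<omega> = \<nu>}" and N: "AE \<omega> in M. 1 \<le> \<N> \<omega>"
    and ric: "riccati_solution A B \<nu> Q' q' P' \<eta>' \<xi>' K k F" and Q': "psd Q'"
    and Q: "psd Q" and P: "\<And>t. t \<in> {1..\<nu>} \<Longrightarrow> psd (P t)" and fin: "P \<nu> = Q"
    and lmi: "\<And>t u x c. t \<in> {1..<\<nu>} \<Longrightarrow>
      0 \<le> stage_form A B Q (q t) (P t) (\<eta> t) (P (t+1)) (\<eta> (t+1)) (\<xi> t) u x c"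
  defines "X \<equiv> \<lambda>t \<omega>. closed_loop A B K k (start \<nu> (\<N> \<omega>)) (xbar \<omega>) (\<lambda>t. w t \<omega>) t"
  assumes int: "integrable M (\<lambda>\<omega>. est_loss B \<Sigma>w \<nu> Q q P \<eta> \<xi> (\<N> \<omega>) (\<lambda>t. X t \<omega>))"
      "integrable M (\<lambda>\<omega>. est_loss B \<Sigma>w \<nu> Q' q' P' \<eta>' \<xi>' (\<N> \<omega>) (\<lambda>t. X t \<omega>))"
    and le: "expectation (\<lambda>\<omega>. est_loss B \<Sigma>w \<nu> Q q P \<eta> \<xi> (\<N> \<omega>) (\<lambda>t. X t \<omega>))
      \<le> expectation (\<lambda>\<omega>. est_loss B \<Sigma>w \<nu> Q' q' P' \<eta>' \<xi>' (\<N> \<omega>) (\<lambda>t. X t \<omega>))"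
  shows "Q = Q'"
proof -
  define U where "U t \<omega> = - (K t *v X t \<omega>) - k t" for t \<omega>
  have \<nu>1: "1 \<le> \<nu>" using \<nu> by simp
  have P': "\<And>t. t \<le> \<nu> \<Longrightarrow> psd (P' t)" "P' \<nu> = Q'" "\<And>t. t \<in> {1..\<nu>} \<Longrightarrow> psd (P' t)"
    and F: "\<And>t. t < \<nu> \<Longrightarrow> pos_def (F t)"
    and form: "\<And>t u x c. t < \<nu> \<Longrightarrow> stage_form A B Q' (q' t) (P' t) (\<eta>' t) (P' (t+1)) (\<eta>' (t+1)) (\<xi>' t) u x c =
       (u + K t *v x + c *\<^sub>R k t) \<bullet> (F t *v (u + K t *v x + c *\<^sub>R k t))"
    using ric by (auto simp: riccati_solution_def)
  have form0: "stage_form A B Q' (q' t) (P' t) (\<eta>' t) (P' (t+1)) (\<eta>' (t+1)) (\<xi>' t) (- (K t *v x) - k t) x 1 = 0"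
    if "t < \<nu>" for t x
    by (subst form[OF that]) simp
  let ?\<Phi> = "\<lambda>\<omega>. \<Sum>t = start \<nu> (\<N> \<omega>)..<\<nu>. stage_form A B Q (q t) (P t) (\<eta> t) (P (t+1)) (\<eta> (t+1)) (\<xi> t) (U t \<omega>) (X t \<omega>) 1"
  let ?\<Phi>' = "\<lambda>\<omega>. \<Sum>t = start \<nu> (\<N> \<omega>)..<\<nu>. stage_form A B Q' (q' t) (P' t) (\<eta>' t) (P' (t+1)) (\<eta>' (t+1)) (\<xi>' t) (U t \<omega>) (X t \<omega>) 1"
  have z: "?\<Phi>' \<omega> = 0" for \<omega> by (intro sum.neutral ballI) (simp only: U_def form0 atLeastLessThan_iff)
  have start1: "1 \<le> start \<nu> N" for N by (simp add: start_def)
  note p1 = population_loss[where \<nu>=\<nu> and P=P and A=A and B=B and K=K and k=k and Q=Q and q=q and \<eta>=\<eta> and \<xi>=\<xi>, OF psd_transpose[OF P] N \<nu>1 int(1)[unfolded X_def]]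
  note p2 = population_loss[where \<nu>=\<nu> and P=P' and A=A and B=B and K=K and k=k and Q=Q' and q=q' and \<eta>=\<eta>' and \<xi>=\<xi>', OF psd_transpose[OF P'(3)] N \<nu>1 int(2)[unfolded X_def]]
  have nn: "0 \<le> ?\<Phi> \<omega>" for \<omega>
    using start1[of "\<N> \<omega>"] by (intro sum_nonneg lmi) auto
  have i1: "integrable M ?\<Phi>" using p1(1) unfolding U_def X_def .
  have "expectation ?\<Phi> \<le> expectation ?\<Phi>'" 
    using p1(2) p2(2) le unfolding U_def X_def by linarith
  then have "expectation ?\<Phi> \<le> 0" unfolding z by simp
  then have "expectation ?\<Phi> = 0"
    using nn by (intro antisym Bochner_Integration.integral_nonneg) auto
  then have "AE \<omega> in M. ?\<Phi> \<omega> = 0"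
    using integral_nonneg_eq_0_iff_AE[OF i1] nn by blast
  then have ae: "AE \<omega> in M. \<forall>t\<in>{start \<nu> (\<N> \<omega>)..<\<nu>}.
      stage_form A B Q (q t) (P t) (\<eta> t) (P (t+1)) (\<eta> (t+1)) (\<xi> t) (- (K t *v X t \<omega>) - k t) (X t \<omega>) 1 = 0"
  proof eventually_elim
    case (elim \<omega>)
    show ?case
      using elim start1[of "\<N> \<omega>"] unfolding U_def
      by (subst (asm) sum_nonneg_eq_0_iff) (auto intro!: lmi simp del: One_nat_def)
  qed
  \<comment> \<open>After substitution of the feedback both gradient equations are affine in the
    state. Their linear parts are the gain equation and the Riccati recursion written with the gain
    \<open>K t\<close>.\<close>
  have grad: "(transpose B ** P (t+1) ** (A - B ** K t) - K t) *v x
        + (transpose B *v (\<eta> (t+1) - P (t+1) *v (B *v k t)) - k t) = 0"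
      "(transpose A ** P (t+1) ** (A - B ** K t) + Q - P t) *v x
        + (transpose A *v (\<eta> (t+1) - P (t+1) *v (B *v k t)) + q t - \<eta> t) = 0"
    if nonneg: "\<And>u x c. 0 \<le> stage_form A B Q (q t) (P t) (\<eta> t) (P (t+1)) (\<eta> (t+1)) (\<xi> t) u x c"
      and zero: "stage_form A B Q (q t) (P t) (\<eta> t) (P (t+1)) (\<eta> (t+1)) (\<xi> t) (- (K t *v x) - k t) x 1 = 0"
      and psds: "psd (P (t+1))" "psd (P t)" "psd Q"
    for Q :: "real^'n^'n" and q P \<eta> \<xi> t x
  proof -
    have y: "A *v x + B *v (- (K t *v x) - k t) = (A - B ** K t) *v x - B *v k t"
      by (simp add: matrix_vector_mult_diff_rdistrib matrix_vector_mul_assoc[symmetric]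
          matrix_vector_mult_diff_distrib linear_neg[OF matrix_vector_mul_linear])
    note g = stage_form_gradient_zero[OF nonneg zero psds[THEN psd_transpose], unfolded y]
    show "(transpose B ** P (t+1) ** (A - B ** K t) - K t) *v x
        + (transpose B *v (\<eta> (t+1) - P (t+1) *v (B *v k t)) - k t) = 0"
      using g(1) by (simp add: matrix_vector_mult_diff_rdistrib matrix_vector_mul_assoc[symmetric]
          matrix_vector_mult_diff_distrib matrix_vector_right_distrib algebra_simps)
    show "(transpose A ** P (t+1) ** (A - B ** K t) + Q - P t) *v x
        + (transpose A *v (\<eta> (t+1) - P (t+1) *v (B *v k t)) + q t - \<eta> t) = 0"
      using g(2) by (simp add: matrix_vector_mult_diff_rdistrib matrix_vector_mult_add_rdistrib matrix_vector_mul_assoc[symmetric]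
          matrix_vector_mult_diff_distrib matrix_vector_right_distrib algebra_simps)
  qed
  \<comment> \<open>The forms of the Riccati solution vanish at every state, so the linear parts can
    be compared pointwise.\<close>
  have gain': "transpose B ** P' (t+1) ** (A - B ** K t) - K t = 0"
    "transpose A ** P' (t+1) ** (A - B ** K t) + Q' - P' t = 0" if t: "t \<in> {1..<\<nu>}" for t
  proof -
    have "0 \<le> stage_form A B Q' (q' t) (P' t) (\<eta>' t) (P' (t+1)) (\<eta>' (t+1)) (\<xi>' t) u x c" for u x c
      using t by (subst form) (auto intro: pos_def_form_nonneg F)
    note g = grad[of Q' q' t P' \<eta>' \<xi>', OF this form0 P'(1) P'(1) Q']
    show "transpose B ** P' (t+1) ** (A - B ** K t) - K t = 0"
      by (rule affine_zero_imp_linear_part_zero[OF g(1)]) (use t in auto)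
    show "transpose A ** P' (t+1) ** (A - B ** K t) + Q' - P' t = 0"
      by (rule affine_zero_imp_linear_part_zero[OF g(2)]) (use t in auto)
  qed
  have surj: "\<exists>x. A *v x - B *v (K t *v x) = y" if t: "t \<in> {1..<\<nu>}" for t y
  proof (rule closed_loop_matrix_surj[OF inv])
    fix x
    have "(transpose B ** P' (t+1) ** (A - B ** K t) - K t) *v x = 0" using gain'(1)[OF t] by simp
    then show "transpose B *v (P' (t+1) *v (A *v x - B *v (K t *v x))) = K t *v x"
      by (simp add: matrix_vector_mult_diff_rdistrib matrix_vector_mul_assoc[symmetric])
  qed
  \<comment> \<open>For the other candidate the equations hold only almost surely along trajectories
    of full horizon; nondegeneracy of the state makes the linear parts vanish. Full horizon gives
    start 1, so all times are covered.\<close>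
  have gain: "transpose B ** P (t+1) ** (A - B ** K t) - K t = 0"
    "transpose A ** P (t+1) ** (A - B ** K t) + Q - P t = 0" if t: "t \<in> {1..<\<nu>}" for t
  proof -
    have t': "1 \<le> t" "t \<le> \<nu>" using t by auto
    have Z: "AE \<omega> in M. \<N> \<omega> = \<nu> \<longrightarrow>
      stage_form A B Q (q t) (P t) (\<eta> t) (P (t+1)) (\<eta> (t+1)) (\<xi> t) (- (K t *v X t \<omega>) - k t) (X t \<omega>) 1 = 0"
      using ae
    proof eventually_elim
      case (elim \<omega>)
      have "t \<in> {start \<nu> (\<N> \<omega>)..<\<nu>}" if "\<N> \<omega> = \<nu>" using t that by (simp add: start_def)
      then show ?case using elim by blast
    qed
    have "psd (P (t+1))" "psd (P t)" using t by (auto intro: P)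
    note g = grad[of Q q t P \<eta> \<xi>, OF lmi[OF t] _ this Q]
    have "AE \<omega> in M. \<N> \<omega> = \<nu> \<longrightarrow> (transpose B ** P (t+1) ** (A - B ** K t) - K t) *v X t \<omega>
        + (transpose B *v (\<eta> (t+1) - P (t+1) *v (B *v k t)) - k t) = 0"
      using Z by eventually_elim (blast intro: g(1))
    then show "transpose B ** P (t+1) ** (A - B ** K t) - K t = 0"
      unfolding X_def by (rule closed_loop_nondegenerate_matrix[OF cov pos surj t', rotated])
    have "AE \<omega> in M. \<N> \<omega> = \<nu> \<longrightarrow> (transpose A ** P (t+1) ** (A - B ** K t) + Q - P t) *v X t \<omega>
        + (transpose A *v (\<eta> (t+1) - P (t+1) *v (B *v k t)) + q t - \<eta> t) = 0"
      using Z by eventually_elim (blast intro: g(2))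
    then show "transpose A ** P (t+1) ** (A - B ** K t) + Q - P t = 0"
      unfolding X_def by (rule closed_loop_nondegenerate_matrix[OF cov pos surj t', rotated])
  qed
  have expand: "transpose L *v (R *v (A *v x - B *v (K t *v x))) = (transpose L ** R ** (A - B ** K t)) *v x"
    for L :: "real^'p^'n" and R x t
    by (simp add: matrix_vector_mult_diff_rdistrib matrix_vector_mul_assoc[symmetric])
  show ?thesis
  proof (rule equal_gains_imp_equal_weight[where P=P and P'=P' and K=K and \<nu>=\<nu> and Q=Q and Q'=Q', OF ctrl inv \<nu> _ _ fin P'(2)])
    fix t x assume t: "t \<in> {1..<\<nu>}"
    show "transpose B *v (P (t + 1) *v (A *v x - B *v (K t *v x))) = K t *v x"
      using gain(1)[OF t] unfolding expand by simp
    show "transpose B *v (P' (t + 1) *v (A *v x - B *v (K t *v x))) = K t *v x"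
      using gain'(1)[OF t] unfolding expand by simp
    show "P t *v x = transpose A *v (P (t + 1) *v (A *v x - B *v (K t *v x))) + Q *v x"
      using gain(2)[OF t] unfolding expand by (simp add: matrix_vector_mult_add_rdistrib[symmetric])
    show "P' t *v x = transpose A *v (P' (t + 1) *v (A *v x - B *v (K t *v x))) + Q' *v x"
      using gain'(2)[OF t] unfolding expand by (simp add: matrix_vector_mult_add_rdistrib[symmetric])
  qed (use P P' in \<open>auto simp: psd_transpose\<close>)
qed

end

section \<open>The objective as a function of the statistics\<close>

lemma norm_matrix_vector_mult_le: "norm (S *v x) \<le> norm S * norm x" for S :: "real^'p^'q"
proof -
  have "norm (S *v x) = L2_set (\<lambda>i. norm (S $ i \<bullet> x)) UNIV"
    unfolding norm_vec_def[of "S *v x"] by (simp add: matrix_vector_mult_def inner_vec_def)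
  also have "\<dots> \<le> L2_set (\<lambda>i. norm (S $ i) * norm x) UNIV"
    by (intro L2_set_mono) (auto simp: Cauchy_Schwarz_ineq2)
  also have "\<dots> = norm S * norm x"
    by (simp add: norm_vec_def[of S] L2_set_left_distrib)
  finally show ?thesis .
qed

lemma abs_form_le: "\<bar>x \<bullet> (S *v x)\<bar> \<le> norm S * (norm x)\<^sup>2" for S :: "real^'p^'p"
proof -
  have "\<bar>x \<bullet> (S *v x)\<bar> \<le> norm x * norm (S *v x)" by (rule Cauchy_Schwarz_ineq2)
  also have "\<dots> \<le> norm x * (norm S * norm x)"
    by (intro mult_left_mono norm_matrix_vector_mult_le) simp
  finally show ?thesis by (simp add: power2_eq_square mult_ac)
qed

text \<open>Testing with the sum and the difference of two basis vectors, whose squared norm is at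
  most 4, bounds every entry by \<open>2 * b\<close>, because the diagonal is nonnegative. The norm
  is then bounded crudely by the sum of all entries.\<close>

lemma norm_psd_le:
  fixes S :: "real^'p^'p"
  assumes S: "psd S" and b: "\<And>x. x \<bullet> (S *v x) \<le> b * (norm x)\<^sup>2" "0 \<le> b"
  shows "norm S \<le> 2 * b * (real CARD('p))\<^sup>2"
proof -
  have entry: "\<bar>S $ i $ j\<bar> \<le> 2 * b" for i j
  proof -
    let ?e = "\<lambda>i. axis i 1 :: real^'p"
    have e: "?e i \<bullet> (S *v ?e j) = S $ i $ j" for i j
      by (simp add: inner_axis' matrix_vector_mult_basis column_def)
    have sym: "S $ i $ j = S $ j $ i"
      using psd_transpose[OF S] by (metis transpose_def vec_lambda_beta)
    have n: "(norm (?e i + r *\<^sub>R ?e j))\<^sup>2 \<le> 4" if "\<bar>r\<bar> = 1" for r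
    proof -
      have "norm (?e i + r *\<^sub>R ?e j) \<le> norm (?e i) + norm (r *\<^sub>R ?e j)" by (rule norm_triangle_ineq)
      also have "\<dots> = 2" using that by (simp add: norm_axis_1)
      finally show ?thesis using power_mono[of "norm (?e i + r *\<^sub>R ?e j)" 2 2] by simp
    qed
    have q: "(?e i + r *\<^sub>R ?e j) \<bullet> (S *v (?e i + r *\<^sub>R ?e j)) = S $ i $ i + 2 * r * S $ i $ j + r\<^sup>2 * S $ j $ j" for r
      using sym by (simp add: matrix_vector_right_distrib matrix_vector_mult_scaleR inner_add_left inner_add_right e power2_eq_square algebra_simps)
    have "S $ i $ i + 2 * r * S $ i $ j + r\<^sup>2 * S $ j $ j \<le> 4 * b" if "\<bar>r\<bar> = 1" for r
      unfolding q[symmetric] using order_trans[OF b(1) mult_left_mono[OF n[OF that] b(2)]] by (simp add: mult.commute)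
    from this[of 1] this[of "-1"] have "S $ i $ i + 2 * S $ i $ j + S $ j $ j \<le> 4 * b" "S $ i $ i - 2 * S $ i $ j + S $ j $ j \<le> 4 * b"
      by auto
    moreover have "0 \<le> S $ i $ i" "0 \<le> S $ j $ j"
      using psd_form_nonneg[OF S, of "?e i"] psd_form_nonneg[OF S, of "?e j"] by (simp_all add: e)
    ultimately show ?thesis by linarith
  qed
  have "norm S \<le> (\<Sum>i\<in>UNIV. norm (S $ i))" unfolding norm_vec_def[of S] by (rule L2_set_le_sum) simp
  also have "\<dots> \<le> (\<Sum>i\<in>(UNIV::'p set). \<Sum>j\<in>(UNIV::'p set). 2 * b)"
    by (intro sum_mono order_trans[OF norm_le_l1_cart] sum_mono entry)
  finally show ?thesis by (simp add: power2_eq_square mult_ac)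
qed

lemma tendsto_matrix_vector_mult [tendsto_intros]:
  fixes f :: "'z \<Rightarrow> real^'p^'q"
  assumes "(f \<longlongrightarrow> a) G" "(g \<longlongrightarrow> b) G"
  shows "((\<lambda>x. f x *v g x) \<longlongrightarrow> a *v b) G"
  by (rule vec_tendstoI) (auto simp: matrix_vector_mult_def intro!: tendsto_intros assms)

lemma psd_limit:
  assumes S: "\<And>k::nat. psd (S k)" and L: "S \<longlonglongrightarrow> L"
  shows "psd L"
  unfolding psd_def
proof (intro conjI allI)
  have t: "(\<lambda>k. x \<bullet> (S k *v y)) \<longlonglongrightarrow> x \<bullet> (L *v y)" for x y
    by (intro tendsto_intros L)
  show "transpose L = L"
  proof (rule symmetric_matrixI)
    fix x y
    have "x \<bullet> (S k *v y) = y \<bullet> (S k *v x)" for k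
      by (rule inner_symmetric_mult[OF psd_transpose[OF S]])
    then show "x \<bullet> (L *v y) = y \<bullet> (L *v x)" using t[of x y] t[of y x] by (simp add: LIMSEQ_unique)
  qed
  show "0 \<le> v \<bullet> (L *v v)" for v
    by (rule LIMSEQ_le_const[OF t]) (use psd_form_nonneg[OF S] in auto)
qed

lemma finite_family_convergent_subsequence:
  fixes f :: "'i \<Rightarrow> nat \<Rightarrow> 'b::heine_borel"
  assumes "finite I" "\<And>i. i \<in> I \<Longrightarrow> bounded (range (f i))"
  shows "\<exists>r l. strict_mono r \<and> (\<forall>i\<in>I. (\<lambda>k. f i (r k)) \<longlonglongrightarrow> l i)"
  using assms
proof (induction I)
  case empty
  show ?case by (intro exI[of _ id]) (simp add: strict_mono_id)
next
  case (insert i I)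
  then obtain r l where r: "strict_mono r" "\<forall>i\<in>I. (\<lambda>k. f i (r k)) \<longlonglongrightarrow> l i" by auto
  have "bounded (range (f i))" using insert.prems by simp
  then have "bounded (range (\<lambda>k. f i (r k)))" by (rule bounded_subset) auto
  then obtain a r' where r': "strict_mono r'" "((\<lambda>k. f i (r k)) \<circ> r') \<longlonglongrightarrow> a"
    using bounded_imp_convergent_subsequence by blast
  have "(\<lambda>k. f j (r (r' k))) \<longlonglongrightarrow> l j" if "j \<in> I" for j
    using LIMSEQ_subseq_LIMSEQ[OF r(2)[rule_format, OF that] r'(1)] by (simp add: comp_def)
  then show ?case
    using r' strict_mono_o[OF r(1) r'(1)] insert.hyps
    by (intro exI[of _ "r \<circ> r'"] exI[of _ "l(i := a)"]) (auto simp: comp_def)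
qed

lemma linear_trace_sandwich: "linear (\<lambda>P. trace (transpose B ** P ** B ** S))"
  for B :: "real^'m^'n" and S :: "real^'m^'m"
proof (rule linearI)
  have r: "(X + Y) ** Z = X ** Z + Y ** Z" for X Y :: "real^'p^'q" and Z :: "real^'r^'p"
    by (simp add: matrix_matrix_mult_def vec_eq_iff sum.distrib distrib_right)
  show "trace (transpose B ** (P + P') ** B ** S) = trace (transpose B ** P ** B ** S) + trace (transpose B ** P' ** B ** S)" for P P'
    by (simp add: matrix_add_ldistrib r trace_add)
  have c: "X ** (c *\<^sub>R Y) = c *\<^sub>R (X ** Y)" "(c *\<^sub>R X) ** Y = c *\<^sub>R (X ** Y)"
    for X :: "real^'p^'q" and Y :: "real^'r^'p" and c
    by (simp_all add: matrix_matrix_mult_def vec_eq_iff sum_distrib_left mult_ac)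
  show "trace (transpose B ** (c *\<^sub>R P) ** B ** S) = c *\<^sub>R trace (transpose B ** P ** B ** S)" for c P
    by (simp add: c trace_def sum_distrib_left)
qed

text \<open>With \<open>P = 0\<close> and \<open>\<beta> = 0\<close> the form is the sum of two nonnegative forms and \<open>norm (u + c B\<^sup>T \<eta>')\<^sup>2\<close>.\<close>

lemma stage_form_zero_completion_nonneg:
  assumes "psd P'" "psd Q"
  shows "0 \<le> stage_form A B Q q 0 (q + transpose A *v \<eta>') P' \<eta>' ((norm (transpose B *v \<eta>'))\<^sup>2) u x c"
proof -
  let ?y = "A *v x + B *v u" and ?b = "transpose B *v \<eta>'"
  have 1: "\<eta>' \<bullet> (A *v x) = (transpose A *v \<eta>') \<bullet> x" "\<eta>' \<bullet> (B *v u) = ?b \<bullet> u"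
    by (metis inner_commute inner_transpose_mult)+
  have 2: "(u + c *\<^sub>R b) \<bullet> (u + c *\<^sub>R b) = u \<bullet> u + 2 * c * (b \<bullet> u) + c\<^sup>2 * (b \<bullet> b)" for b
    by (simp add: inner_add_left inner_add_right power2_eq_square inner_commute[of u b] distrib_left)
  have "stage_form A B Q q 0 (q + transpose A *v \<eta>') P' \<eta>' ((norm ?b)\<^sup>2) u x c =
    ?y \<bullet> (P' *v ?y) + x \<bullet> (Q *v x) + (u + c *\<^sub>R ?b) \<bullet> (u + c *\<^sub>R ?b)"
    unfolding stage_form_def inner_add_right[of \<eta>'] 1 2 inner_add_left[of q] power2_norm_eq_inner
    by (simp add: distrib_left)
  then show ?thesis
    using psd_form_nonneg[OF assms(1), of ?y] psd_form_nonneg[OF assms(2), of x]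
    by (simp add: add_nonneg_nonneg)
qed

section \<open>Statistics in which the loss is linear\<close>

definition outer_square :: "real^'n \<Rightarrow> real^'n^'n" where
  "outer_square v = (\<chi> i j. v $ i * v $ j)"

definition stat_of :: "real^'n \<Rightarrow> (real^'n^'n) \<times> (real^'n) \<times> real" where
  "stat_of v = (outer_square v, v, 1)"

text \<open>The linear extension of \<open>est_loss\<close> from a single trajectory to averages:
  \<open>Z t\<close> stands for a mean of \<open>stat_of\<close>. The weight 1 in
  \<open>stat_of\<close> carries the terms that do not depend on the state.\<close>

definition stat_loss :: "real^'m^'n \<Rightarrow> real^'m^'m \<Rightarrow> nat \<Rightarrow> real^'n^'n \<Rightarrow> (nat \<Rightarrow> real^'n) \<Rightarrow>
    (nat \<Rightarrow> real^'n^'n) \<Rightarrow> (nat \<Rightarrow> real^'n) \<Rightarrow> (nat \<Rightarrow> real) \<Rightarrow> nat \<Rightarrow>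
    (nat \<Rightarrow> (real^'n^'n) \<times> (real^'n) \<times> real) \<Rightarrow> real" where
  "stat_loss B S \<nu> Q q P \<eta> \<xi> N Z =
    ((1/2) *\<^sub>R P \<nu>, \<eta> \<nu>, 0) \<bullet> Z \<nu> - ((1/2) *\<^sub>R P (start \<nu> N), \<eta> (start \<nu> N), 0) \<bullet> Z (start \<nu> N)
    + (\<Sum>t = start \<nu> N..<\<nu>.
        ((1/2) *\<^sub>R Q, q t, 1/2 * \<xi> t - 1/2 * trace (transpose B ** P (t+1) ** B ** S)) \<bullet> Z t)"

lemma inner_outer_square: "M \<bullet> outer_square v = v \<bullet> (M *v v)"
  unfolding inner_matrix_mult_eq_sum
  by (simp add: inner_vec_def[of M] inner_vec_def[of "M $ _"] outer_square_def mult_ac)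

lemma est_loss_eq_stat_loss: "est_loss B S \<nu> Q q P \<eta> \<xi> N x = stat_loss B S \<nu> Q q P \<eta> \<xi> N (\<lambda>t. stat_of (x t))"
  by (simp add: est_loss_def stat_loss_def stat_of_def Let_def inner_outer_square
      scaleR_matrix_vector_assoc[symmetric] algebra_simps)

lemma stat_loss_sum: "stat_loss B S \<nu> Q q P \<eta> \<xi> N (\<lambda>t. \<Sum>i\<in>I. Z i t) = (\<Sum>i\<in>I. stat_loss B S \<nu> Q q P \<eta> \<xi> N (Z i))"
  unfolding stat_loss_def inner_sum_right sum.distrib sum_subtractf by (simp add: sum.swap[of _ I])

lemma stat_loss_scaleR: "stat_loss B S \<nu> Q q P \<eta> \<xi> N (\<lambda>t. c *\<^sub>R Z t) = c * stat_loss B S \<nu> Q q P \<eta> \<xi> N Z"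
  unfolding stat_loss_def inner_scaleR_right by (simp add: sum_distrib_left algebra_simps)

lemma stat_loss_zero: "stat_loss B S \<nu> Q q P \<eta> \<xi> N (\<lambda>t. 0) = 0"
  by (simp add: stat_loss_def)

lemma stat_loss_cong:
  assumes "\<And>t. t \<in> {start \<nu> N..<\<nu>} \<Longrightarrow> q t = q' t" "start \<nu> N \<le> \<nu>"
    "\<And>t. start \<nu> N \<le> t \<Longrightarrow> t \<le> \<nu> \<Longrightarrow> P t = P' t" "\<And>t. start \<nu> N \<le> t \<Longrightarrow> t \<le> \<nu> \<Longrightarrow> \<eta> t = \<eta>' t"
    "\<And>t. t \<in> {start \<nu> N..<\<nu>} \<Longrightarrow> \<xi> t = \<xi>' t"
  shows "stat_loss B S \<nu> Q q P \<eta> \<xi> N Z = stat_loss B S \<nu> Q q' P' \<eta>' \<xi>' N Z"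
  unfolding stat_loss_def using assms by (intro arg_cong2[where f="(+)"] arg_cong2[where f="(-)"] sum.cong) auto

lemma tendsto_stat_loss:
  assumes s: "start \<nu> N \<le> \<nu>" "1 \<le> s0" "s0 \<le> start \<nu> N"
    and Q: "Q \<longlonglongrightarrow> Q'" and q: "\<And>t. t \<in> {start \<nu> N..<\<nu>} \<Longrightarrow> (\<lambda>k. q k t) \<longlonglongrightarrow> q' t"
    and P: "\<And>t. t \<in> {s0..\<nu>} \<Longrightarrow> (\<lambda>k. P k t) \<longlonglongrightarrow> P' t"
    and \<eta>: "\<And>t. t \<in> {s0..\<nu>} \<Longrightarrow> (\<lambda>k. \<eta> k t) \<longlonglongrightarrow> \<eta>' t"
    and \<xi>: "\<And>t. t \<in> {s0..<\<nu>} \<Longrightarrow> (\<lambda>k. \<xi> k t) \<longlonglongrightarrow> \<xi>' t"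
    and Z: "\<And>t. t \<in> {1..\<nu>} \<Longrightarrow> (\<lambda>k. Z k t) \<longlonglongrightarrow> Z' t"
  shows "(\<lambda>k::nat. stat_loss B S \<nu> (Q k) (q k) (P k) (\<eta> k) (\<xi> k) N (Z k)) \<longlonglongrightarrow> stat_loss B S \<nu> Q' q' P' \<eta>' \<xi>' N Z'"
proof -
  have tr: "(\<lambda>k. trace (transpose B ** P k (t+1) ** B ** S)) \<longlonglongrightarrow> trace (transpose B ** P' (t+1) ** B ** S)"
    if "t \<in> {start \<nu> N..<\<nu>}" for t
    using that s
    by (intro bounded_linear.tendsto[OF linear_conv_bounded_linear[THEN iffD1, OF linear_trace_sandwich]] P) auto
  show ?thesis
    unfolding stat_loss_def using s
    by (intro tendsto_intros tendsto_Pair Q q P \<eta> \<xi> Z tr) auto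
qed

section \<open>Existence and stability of minimizers\<close>

lemma norm_triple_le: "norm (a, b, c :: real) \<le> norm a + norm b + \<bar>c\<bar>"
  using norm_Pair_le[of a "(b, c)"] norm_Pair_le[of b c] by simp

lemma psd_0: "psd 0"
  by (simp add: psd_def transpose_def vec_eq_iff)

locale est_problem =
  fixes A :: "real^'n^'n" and B :: "real^'m^'n" and \<Sigma>w :: "real^'m^'m" and xr :: "nat \<Rightarrow> real^'n"
    and \<phi> :: real and \<nu>1 \<nu>2 :: nat
  assumes horizons: "1 \<le> \<nu>1" "\<nu>1 \<le> \<nu>2" and radius: "0 \<le> \<phi>"
begin

text \<open>The constraints of (EST) from time \<open>s\<close> on, with \<open>q\<close>
  eliminated. The start of the longest horizon that occurs will be taken for \<open>s\<close>, so
  that the objective controls all remaining variables.\<close>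

definition feasible_from :: "nat \<Rightarrow> real^'n^'n \<Rightarrow> (nat \<Rightarrow> real^'n^'n) \<Rightarrow> (nat \<Rightarrow> real^'n) \<Rightarrow> (nat \<Rightarrow> real) \<Rightarrow> bool" where
  "feasible_from s Q P \<eta> \<xi> \<longleftrightarrow> Q \<in> psd_ball \<phi> \<and> P \<nu>2 = Q \<and> \<eta> \<nu>2 = - (Q *v xr \<nu>2) \<and>
    (\<forall>t\<in>{s..\<nu>2}. psd (P t)) \<and>
    (\<forall>t\<in>{s..<\<nu>2}. \<forall>u x c. 0 \<le> stage_form A B Q (- (Q *v xr t)) (P t) (\<eta> t) (P (t+1)) (\<eta> (t+1)) (\<xi> t) u x c)"

definition objective :: "(nat \<Rightarrow> nat \<Rightarrow> (real^'n^'n) \<times> (real^'n) \<times> real) \<Rightarrow>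
    real^'n^'n \<Rightarrow> (nat \<Rightarrow> real^'n^'n) \<Rightarrow> (nat \<Rightarrow> real^'n) \<Rightarrow> (nat \<Rightarrow> real) \<Rightarrow> real" where
  "objective S Q P \<eta> \<xi> = (\<Sum>N = \<nu>1..\<nu>2. stat_loss B \<Sigma>w \<nu>2 Q (\<lambda>t. - (Q *v xr t)) P \<eta> \<xi> N (S N))"

lemma start_bounds: "N \<in> {\<nu>1..\<nu>2} \<Longrightarrow> 1 \<le> start \<nu>2 N \<and> start \<nu>2 N \<le> \<nu>2"
  using horizons by (auto simp: start_def)

lemma est_feasible_iff:
  "est_feasible A B xr \<phi> \<nu>2 Q q P \<eta> \<xi> \<longleftrightarrow>
    feasible_from 1 Q P \<eta> \<xi> \<and> (\<forall>t\<in>{1..\<nu>2}. q t = - (Q *v xr t))"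
proof (cases "(\<forall>t\<in>{1..\<nu>2}. q t = - (Q *v xr t)) \<and> (\<forall>t\<in>{1..\<nu>2}. psd (P t)) \<and> Q \<in> psd_ball \<phi>")
  case True
  have "psd (lmi_block A B Q q P \<eta> \<xi> t) \<longleftrightarrow>
    (\<forall>u x c. 0 \<le> stage_form A B Q (- (Q *v xr t)) (P t) (\<eta> t) (P (t+1)) (\<eta> (t+1)) (\<xi> t) u x c)"
    if "t \<in> {1..<\<nu>2}" for t
    using True that
    by (subst psd_lmi_block_iff) (auto intro!: psd_transpose simp: psd_ball_def)
  moreover have "q \<nu>2 = - (Q *v xr \<nu>2)" using True horizons by simp
  ultimately show ?thesis using True unfolding est_feasible_def feasible_from_def by auto
qed (auto simp: est_feasible_def feasible_from_def)

lemma feasible_from_mono: "feasible_from s Q P \<eta> \<xi> \<Longrightarrow> s \<le> s' \<Longrightarrow> feasible_from s' Q P \<eta> \<xi>"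
  by (auto simp: feasible_from_def)

text \<open>Earlier constraints can always be satisfied without touching the later variables, so a
  minimizer of the truncated problem yields a feasible point of (EST).\<close>

lemma feasible_from_extend:
  assumes f: "feasible_from s Q P \<eta> \<xi>" and s: "1 \<le> s" "s \<le> \<nu>2"
  obtains P' \<eta>' \<xi>' where "feasible_from 1 Q P' \<eta>' \<xi>'"
    "\<And>t. s \<le> t \<Longrightarrow> P' t = P t" "\<And>t. s \<le> t \<Longrightarrow> \<eta>' t = \<eta> t" "\<And>t. s \<le> t \<Longrightarrow> \<xi>' t = \<xi> t"
proof -
  have Q: "psd Q" using f by (simp add: feasible_from_def psd_ball_def)
  let ?R = "\<lambda>t z z'. \<forall>u x c. 0 \<le> stage_form A B Q (- (Q *v xr t)) (fst z) (fst (snd z)) (fst z') (fst (snd z')) (snd (snd z)) u x c"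
  have "\<exists>g. g s = (P s, \<eta> s, \<xi> s) \<and> (\<forall>t\<le>s. psd (fst (g t))) \<and> (\<forall>t<s. ?R t (g t) (g (Suc t)))"
  proof (rule backward_choice)
    show "psd (fst (P s, \<eta> s, \<xi> s))" using f s by (simp add: feasible_from_def)
    fix t and z' :: "(real^'n^'n) \<times> (real^'n) \<times> real"
    assume z': "psd (fst z')"
    \<comment> \<open>With \<open>P = 0\<close> and this \<open>\<eta>\<close> the vector
      \<open>\<beta>\<close> vanishes; the slack is the one that completes the square in the
      control.\<close>
    let ?z = "(0, - (Q *v xr t) + transpose A *v fst (snd z'), (norm (transpose B *v fst (snd z')))\<^sup>2)"
    have "?R t ?z z'"
      unfolding fst_conv snd_conv using stage_form_zero_completion_nonneg[OF z' Q] by blast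
    moreover have "psd (fst ?z)" using psd_0 by simp
    ultimately show "\<exists>z. psd (fst z) \<and> ?R t z z'" by blast
  qed
  then obtain g where g: "g s = (P s, \<eta> s, \<xi> s)" "\<forall>t\<le>s. psd (fst (g t))" "\<forall>t<s. ?R t (g t) (g (Suc t))" by blast
  define P' where "P' t = (if t < s then fst (g t) else P t)" for t
  define \<eta>' where "\<eta>' t = (if t < s then fst (snd (g t)) else \<eta> t)" for t
  define \<xi>' where "\<xi>' t = (if t < s then snd (snd (g t)) else \<xi> t)" for t
  have le: "P' t = fst (g t)" "\<eta>' t = fst (snd (g t))" if "t \<le> s" for t
    using that g(1) by (auto simp: P'_def \<eta>'_def)
  have "feasible_from 1 Q P' \<eta>' \<xi>'"
    unfolding feasible_from_def
  proof (intro conjI ballI allI)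
    show "Q \<in> psd_ball \<phi>" "P' \<nu>2 = Q" "\<eta>' \<nu>2 = - (Q *v xr \<nu>2)"
      using f s by (auto simp: feasible_from_def P'_def \<eta>'_def)
    show "psd (P' t)" if "t \<in> {1..\<nu>2}" for t
      using that f g(2) by (auto simp: P'_def feasible_from_def)
    show "0 \<le> stage_form A B Q (- (Q *v xr t)) (P' t) (\<eta>' t) (P' (t+1)) (\<eta>' (t+1)) (\<xi>' t) u x c"
      if "t \<in> {1..<\<nu>2}" for t u x c
    proof (cases "t < s")
      case True
      then show ?thesis using g(3) le[of t] le[of "Suc t"] by (simp add: \<xi>'_def)
    next
      case False
      then show ?thesis using that f by (auto simp: feasible_from_def P'_def \<eta>'_def \<xi>'_def)
    qed
  qed
  then show ?thesis by (rule that) (auto simp: P'_def \<eta>'_def \<xi>'_def)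
qed

lemma feasible_exists: "\<exists>Q P \<eta> \<xi>. feasible_from 1 Q P \<eta> \<xi>"
proof -
  have "feasible_from \<nu>2 0 (\<lambda>_. 0) (\<lambda>_. 0) (\<lambda>_. 0)"
    using radius psd_0 by (simp add: feasible_from_def psd_ball_def)
  then obtain P \<eta> \<xi> where "feasible_from 1 0 P \<eta> \<xi>"
    by (rule feasible_from_extend) (use horizons in auto)
  then show ?thesis by blast
qed

lemma objective_cong:
  assumes s: "1 \<le> s" "s \<le> \<nu>2"
    and z: "\<And>N t. N \<in> {\<nu>1..\<nu>2} \<Longrightarrow> start \<nu>2 N < s \<Longrightarrow> t \<in> {1..\<nu>2} \<Longrightarrow> S N t = 0"
    and eq: "\<And>t. s \<le> t \<Longrightarrow> P' t = P t" "\<And>t. s \<le> t \<Longrightarrow> \<eta>' t = \<eta> t" "\<And>t. s \<le> t \<Longrightarrow> \<xi>' t = \<xi> t"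
  shows "objective S Q P' \<eta>' \<xi>' = objective S Q P \<eta> \<xi>"
  unfolding objective_def
proof (rule sum.cong[OF refl])
  fix N assume N: "N \<in> {\<nu>1..\<nu>2}"
  show "stat_loss B \<Sigma>w \<nu>2 Q (\<lambda>t. - (Q *v xr t)) P' \<eta>' \<xi>' N (S N) = stat_loss B \<Sigma>w \<nu>2 Q (\<lambda>t. - (Q *v xr t)) P \<eta> \<xi> N (S N)"
  proof (cases "start \<nu>2 N < s")
    case True
    then have "S N t = 0" if "t \<in> {1..\<nu>2}" for t using z N that by blast
    then show ?thesis using start_bounds[OF N] by (simp add: stat_loss_def)
  next
    case False
    then show ?thesis using start_bounds[OF N] by (intro stat_loss_cong) (auto simp: eq)
  qed
qed

text \<open>At \<open>u = 0\<close>, \<open>x = 0\<close>, \<open>c = 1\<close> the form equals the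
  slack.\<close>

lemma slack_nonneg: "feasible_from s Q P \<eta> \<xi> \<Longrightarrow> t \<in> {s..<\<nu>2} \<Longrightarrow> 0 \<le> \<xi> t"
  unfolding feasible_from_def
  by (elim conjE) (drule bspec[where x=t], assumption, drule spec[where x=0], drule spec[where x=0], drule spec[where x=1],
    simp add: stage_form_def)

text \<open>At \<open>u = 0\<close>, \<open>c = 0\<close> the constraint bounds
  \<open>x \<bullet> (P t *v x)\<close> by the same form one step later plus the state cost. So the
  bound on \<open>Q\<close> propagates backward, uniformly in all feasible points.\<close>

lemma feasible_psd_bounded:
  assumes "s \<le> \<nu>2"
  shows "\<exists>C\<ge>0. \<forall>Q P \<eta> \<xi>. feasible_from s Q P \<eta> \<xi> \<longrightarrow> (\<forall>t\<in>{s..\<nu>2}. norm (P t) \<le> C)"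
proof -
  have "\<exists>C\<ge>0. \<forall>Q P \<eta> \<xi>. feasible_from s Q P \<eta> \<xi> \<longrightarrow> (\<forall>t\<in>{n..\<nu>2}. norm (P t) \<le> C)" if "s \<le> n" "n \<le> \<nu>2" for n
    using that(2,1)
  proof (induction n rule: inc_induct)
    case base
    show ?case by (intro exI[of _ \<phi>]) (auto simp: feasible_from_def psd_ball_def radius)
  next
    case (step n)
    then have "\<exists>C\<ge>0. \<forall>Q P \<eta> \<xi>. feasible_from s Q P \<eta> \<xi> \<longrightarrow> (\<forall>t\<in>{Suc n..\<nu>2}. norm (P t) \<le> C)"
      by (meson le_SucI)
    then obtain C where C: "0 \<le> C" "\<And>Q P \<eta> \<xi>. feasible_from s Q P \<eta> \<xi> \<Longrightarrow> (\<forall>t\<in>{Suc n..\<nu>2}. norm (P t) \<le> C)"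
      by blast
    define b where "b = C * (norm A)\<^sup>2 + \<phi>"
    have b: "0 \<le> b" using C radius by (simp add: b_def)
    have "norm (P n) \<le> 2 * b * (real CARD('n))\<^sup>2" if f: "feasible_from s Q P \<eta> \<xi>" for Q P \<eta> \<xi>
    proof (rule norm_psd_le[OF _ _ b])
      show "psd (P n)" using f step by (auto simp: feasible_from_def)
      fix x
      have "0 \<le> stage_form A B Q (- (Q *v xr n)) (P n) (\<eta> n) (P (n+1)) (\<eta> (n+1)) (\<xi> n) 0 x 0"
        using f step by (auto simp: feasible_from_def)
      then have "x \<bullet> (P n *v x) \<le> (A *v x) \<bullet> (P (n+1) *v (A *v x)) + x \<bullet> (Q *v x)"
        by (simp add: stage_form_def)
      also have "(A *v x) \<bullet> (P (n+1) *v (A *v x)) \<le> C * ((norm A)\<^sup>2 * (norm x)\<^sup>2)"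
      proof -
        have "(A *v x) \<bullet> (P (n+1) *v (A *v x)) \<le> norm (P (n+1)) * (norm (A *v x))\<^sup>2"
          using abs_form_le[of "A *v x" "P (n+1)"] by simp
        also have "\<dots> \<le> C * (norm A * norm x)\<^sup>2"
          using C(2)[OF f] step C(1) by (intro mult_mono power_mono norm_matrix_vector_mult_le) auto
        finally show ?thesis by (simp add: power_mult_distrib)
      qed
      also have "x \<bullet> (Q *v x) \<le> \<phi> * (norm x)\<^sup>2"
      proof -
        have "norm Q \<le> \<phi>" using f by (simp add: feasible_from_def psd_ball_def)
        then have "norm Q * (norm x)\<^sup>2 \<le> \<phi> * (norm x)\<^sup>2" by (intro mult_right_mono) auto
        then show ?thesis using abs_form_le[of x Q] by linarith
      qed
      finally show "x \<bullet> (P n *v x) \<le> b * (norm x)\<^sup>2" by (simp add: b_def algebra_simps)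
    qed
    then have "\<forall>t\<in>{n..\<nu>2}. norm (P t) \<le> max C (2 * b * (real CARD('n))\<^sup>2)" if f: "feasible_from s Q P \<eta> \<xi>" for Q P \<eta> \<xi>
      using C(2)[OF f] f by (metis atLeastAtMost_iff le_max_iff_disj le_neq_implies_less Suc_leI)
    then show ?case using C(1) by (intro exI[of _ "max C (2 * b * (real CARD('n))\<^sup>2)"]) auto
  qed
  then show ?thesis using assms by blast
qed

text \<open>The slack \<open>\<xi> t\<close> controls \<open>\<beta> t\<close> quadratically, so \<open>\<eta>\<close> grows sublinearly in the sum of the slacks.\<close>

lemma feasible_eta_sublinear:
  assumes s: "1 \<le> s" "s \<le> \<nu>2" and \<delta>: "0 < \<delta>"
  shows "\<exists>C\<ge>0. \<forall>Q P \<eta> \<xi>. feasible_from s Q P \<eta> \<xi> \<longrightarrow>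
    (\<forall>t\<in>{s..\<nu>2}. norm (\<eta> t) \<le> C + \<delta> * (\<Sum>r = s..<\<nu>2. \<xi> r))"
proof -
  have X0: "0 \<le> (\<Sum>r = s..<\<nu>2. \<xi> r)" if "feasible_from s Q P \<eta> \<xi>" for Q P \<eta> \<xi>
    using slack_nonneg[OF that] by (intro sum_nonneg)
  have qb: "norm (Q *v xr t) \<le> \<phi> * norm (xr t)" if "feasible_from s Q P \<eta> \<xi>" for Q P \<eta> \<xi> t
  proof -
    have "norm Q \<le> \<phi>" using that by (simp add: feasible_from_def psd_ball_def)
    then show ?thesis by (intro order_trans[OF norm_matrix_vector_mult_le] mult_right_mono) auto
  qed
  \<comment> \<open>The claim is needed for every \<open>\<delta>\<close> at once, since the
    inductive step uses it with a smaller one.\<close>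
  have "\<forall>\<delta>>0. \<exists>C\<ge>0. \<forall>Q P \<eta> \<xi>. feasible_from s Q P \<eta> \<xi> \<longrightarrow>
      (\<forall>t\<in>{n..\<nu>2}. norm (\<eta> t) \<le> C + \<delta> * (\<Sum>r = s..<\<nu>2. \<xi> r))" if "s \<le> n" "n \<le> \<nu>2" for n
    using that(2,1)
  proof (induction n rule: inc_induct)
    case base
    show ?case
    proof (intro allI impI exI conjI ballI)
      fix \<delta> :: real and Q P \<eta> \<xi> t assume d: "0 < \<delta>" and f: "feasible_from s Q P \<eta> \<xi>" and t: "t \<in> {\<nu>2..\<nu>2}"
      have "\<eta> t = - (Q *v xr \<nu>2)" using f t by (simp add: feasible_from_def)
      then show "norm (\<eta> t) \<le> \<phi> * norm (xr \<nu>2) + \<delta> * (\<Sum>r = s..<\<nu>2. \<xi> r)"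
        using qb[OF f, of \<nu>2] mult_nonneg_nonneg[OF less_imp_le[OF d] X0[OF f]] by simp
    qed (use radius in simp)
  next
    case (step n)
    show ?case
    proof (intro allI impI)
      fix \<delta> :: real assume d: "0 < \<delta>"
      obtain CP where CP: "0 \<le> CP" "\<And>Q P \<eta> \<xi> t. feasible_from s Q P \<eta> \<xi> \<Longrightarrow> t \<in> {s..\<nu>2} \<Longrightarrow> norm (P t) \<le> CP"
        using feasible_psd_bounded[OF s(2)] by blast
      define a where "a = norm (transpose A) + 1"
      have a: "0 < a" by (simp add: a_def add_nonneg_pos)
      \<comment> \<open>Half of \<open>\<delta>\<close> goes to the transported
        \<open>\<eta> (n+1)\<close>, where the factor \<open>a\<close> compensates for the norm of
        \<open>transpose A\<close>; the other half goes to \<open>\<beta>\<close>.\<close>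
      have "0 < \<delta> / (2 * a)" "0 < \<delta>" using d a by auto
      then obtain C C1 where
        C: "0 \<le> C" "\<And>Q P \<eta> \<xi>. feasible_from s Q P \<eta> \<xi> \<Longrightarrow>
          (\<forall>t\<in>{Suc n..\<nu>2}. norm (\<eta> t) \<le> C + \<delta> / (2 * a) * (\<Sum>r = s..<\<nu>2. \<xi> r))"
        and C1: "0 \<le> C1" "\<And>Q P \<eta> \<xi>. feasible_from s Q P \<eta> \<xi> \<Longrightarrow>
          (\<forall>t\<in>{Suc n..\<nu>2}. norm (\<eta> t) \<le> C1 + \<delta> * (\<Sum>r = s..<\<nu>2. \<xi> r))"
        using step by (metis le_SucI)
      define g where "g = CP * (norm A)\<^sup>2 + \<phi>"
      have g: "0 \<le> g" using CP radius by (simp add: g_def)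
      define C2 where "C2 = \<phi> * norm (xr n) + a * C + g / (2 * \<delta>)"
      have C2: "0 \<le> C2" using radius a C g d by (simp add: C2_def)
      have *: "norm (\<eta> n) \<le> C2 + \<delta> * (\<Sum>r = s..<\<nu>2. \<xi> r)" if f: "feasible_from s Q P \<eta> \<xi>" for Q P \<eta> \<xi>
      proof -
        define \<beta> where "\<beta> = - (Q *v xr n) + transpose A *v \<eta> (n+1) - \<eta> n"
        let ?X = "\<Sum>r = s..<\<nu>2. \<xi> r"
        have \<xi>X: "\<xi> n \<le> ?X"
          using slack_nonneg[OF f] step by (intro member_le_sum) auto
        have form: "- 2 * (\<beta> \<bullet> x) \<le> g * (norm x)\<^sup>2 + \<xi> n" for x
        proof -
          have "0 \<le> stage_form A B Q (- (Q *v xr n)) (P n) (\<eta> n) (P (n+1)) (\<eta> (n+1)) (\<xi> n) 0 x 1"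
            using f step by (auto simp: feasible_from_def)
          also have "\<dots> = (A *v x) \<bullet> (P (n+1) *v (A *v x)) + x \<bullet> (Q *v x) - x \<bullet> (P n *v x) + 2 * (\<beta> \<bullet> x) + \<xi> n"
            by (simp add: stage_form_def \<beta>_def inner_add_left inner_diff_left inner_commute[of "transpose A *v _" x] inner_transpose_mult inner_commute[of "\<eta> _" "A *v x"])
          also have "(A *v x) \<bullet> (P (n+1) *v (A *v x)) \<le> CP * ((norm A)\<^sup>2 * (norm x)\<^sup>2)"
          proof -
            have "(A *v x) \<bullet> (P (n+1) *v (A *v x)) \<le> norm (P (n+1)) * (norm (A *v x))\<^sup>2"
              using abs_form_le[of "A *v x" "P (n+1)"] by simp
            also have "\<dots> \<le> CP * (norm A * norm x)\<^sup>2"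
              using CP(2)[OF f, of "n+1"] step CP(1) by (intro mult_mono power_mono norm_matrix_vector_mult_le) auto
            finally show ?thesis by (simp add: power_mult_distrib)
          qed
          also have "x \<bullet> (Q *v x) \<le> \<phi> * (norm x)\<^sup>2"
          proof -
            have "norm Q \<le> \<phi>" using f by (simp add: feasible_from_def psd_ball_def)
            then have "norm Q * (norm x)\<^sup>2 \<le> \<phi> * (norm x)\<^sup>2" by (intro mult_right_mono) auto
            then show ?thesis using abs_form_le[of x Q] by linarith
          qed
          finally show ?thesis
            using psd_form_nonneg[of "P n" x] f step by (simp add: feasible_from_def g_def algebra_simps)
        qed
        have "norm \<beta> \<le> g / (2 * \<delta>) + \<delta> / 2 * \<xi> n"
        proof (cases "\<beta> = 0")
          case True
          then show ?thesis using g d slack_nonneg[OF f, of n] step by simp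
        next
          case False
          \<comment> \<open>A test vector opposite to \<open>\<beta>\<close> of length
            \<open>1 / \<delta>\<close>; this length makes the slack enter the bound for
            \<open>norm \<beta>\<close> with factor \<open>\<delta> / 2\<close>.\<close>
          define x where "x = (- (1 / (\<delta> * norm \<beta>))) *\<^sub>R \<beta>"
          have "\<beta> \<bullet> x = - (norm \<beta> / \<delta>)" using False d by (simp add: x_def power2_norm_eq_inner[symmetric] power2_eq_square)
          moreover have "norm x = 1 / \<delta>" using False d by (simp add: x_def)
          ultimately have "2 * (norm \<beta> / \<delta>) \<le> g * (1 / \<delta>)\<^sup>2 + \<xi> n" using form[of x] by simp
          then have "\<delta> / 2 * (2 * (norm \<beta> / \<delta>)) \<le> \<delta> / 2 * (g * (1 / \<delta>)\<^sup>2 + \<xi> n)" using d by (intro mult_left_mono) auto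
          moreover have "\<delta> / 2 * (2 * (norm \<beta> / \<delta>)) = norm \<beta>" using d by simp
          moreover have "\<delta> / 2 * (g * (1 / \<delta>)\<^sup>2 + \<xi> n) = g / (2 * \<delta>) + \<delta> / 2 * \<xi> n"
            using d by (simp add: power2_eq_square distrib_left)
          ultimately show ?thesis by linarith
        qed
        also have "\<dots> \<le> g / (2 * \<delta>) + \<delta> / 2 * ?X" using \<xi>X d by simp
        finally have \<beta>b: "norm \<beta> \<le> g / (2 * \<delta>) + \<delta> / 2 * ?X" .
        have "norm (transpose A *v \<eta> (n+1)) \<le> a * (C + \<delta> / (2 * a) * ?X)"
          using C(2)[OF f] step a
          by (intro order_trans[OF norm_matrix_vector_mult_le] mult_mono) (auto simp: a_def)
        also have "\<dots> = a * C + \<delta> / 2 * ?X" using a by (simp add: field_simps)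
        finally have "norm (transpose A *v \<eta> (n+1)) \<le> a * C + \<delta> / 2 * ?X" .
        moreover have "\<eta> n = - (Q *v xr n) + (transpose A *v \<eta> (n+1) + - \<beta>)" by (simp add: \<beta>_def)
        then have "norm (\<eta> n) \<le> norm (Q *v xr n) + (norm (transpose A *v \<eta> (n+1)) + norm \<beta>)"
          using norm_triangle_ineq[of "- (Q *v xr n)" "transpose A *v \<eta> (n+1) + - \<beta>"]
            norm_triangle_ineq[of "transpose A *v \<eta> (n+1)" "- \<beta>"] by simp
        ultimately show ?thesis using \<beta>b qb[OF f, of n] by (simp add: C2_def)
      qed
      show "\<exists>C\<ge>0. \<forall>Q P \<eta> \<xi>. feasible_from s Q P \<eta> \<xi> \<longrightarrow>
          (\<forall>t\<in>{n..\<nu>2}. norm (\<eta> t) \<le> C + \<delta> * (\<Sum>r = s..<\<nu>2. \<xi> r))"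
      proof (intro exI[of _ "max C1 C2"] conjI allI impI ballI)
        fix Q P \<eta> \<xi> t assume f: "feasible_from s Q P \<eta> \<xi>" and t: "t \<in> {n..\<nu>2}"
        show "norm (\<eta> t) \<le> max C1 C2 + \<delta> * (\<Sum>r = s..<\<nu>2. \<xi> r)"
        proof (cases "t = n")
          case True
          show ?thesis unfolding True using *[OF f] by linarith
        next
          case False
          then have "t \<in> {Suc n..\<nu>2}" using t by auto
          then have "norm (\<eta> t) \<le> C1 + \<delta> * (\<Sum>r = s..<\<nu>2. \<xi> r)" using C1(2)[OF f] by blast
          then show ?thesis by linarith
        qed
      qed (use C1 in simp)
    qed
  qed
  then show ?thesis using s \<delta> by blast
qed

end

context est_problem
begin

text \<open>The last component of \<open>S N t\<close> is the relative frequency of the horizon length \<open>N\<close>, so \<open>N0\<close> is the longest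
  horizon length that occurs.\<close>

definition informative :: "real \<Rightarrow> real \<Rightarrow> nat \<Rightarrow> (nat \<Rightarrow> nat \<Rightarrow> (real^'n^'n) \<times> (real^'n) \<times> real) \<Rightarrow> bool" where
  "informative c L N0 S \<longleftrightarrow> N0 \<in> {\<nu>1..\<nu>2} \<and>
    (\<forall>N\<in>{\<nu>1..\<nu>2}. \<forall>t\<in>{1..\<nu>2}. norm (S N t) \<le> L \<and> 0 \<le> snd (snd (S N t)) \<and> (N0 < N \<longrightarrow> S N t = 0)) \<and>
    (\<forall>t\<in>{1..\<nu>2}. c \<le> snd (snd (S N0 t)))"

text \<open>The slacks carry nonnegative frequencies as weights, at least \<open>c\<close> for
  \<open>N0\<close>, which gains \<open>c / 2\<close> times their sum. \<open>P\<close> and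
  \<open>Q\<close> are bounded, and the indefinite terms linear in \<open>\<eta>\<close> grow with
  an arbitrarily small multiple of that sum.\<close>

lemma objective_coercive:
  assumes c: "0 < c" and L: "0 \<le> L" and N0: "N0 \<in> {\<nu>1..\<nu>2}"
  shows "\<exists>C. \<forall>S Q P \<eta> \<xi>. informative c L N0 S \<longrightarrow> feasible_from (start \<nu>2 N0) Q P \<eta> \<xi> \<longrightarrow>
    c / 4 * (\<Sum>t = start \<nu>2 N0..<\<nu>2. \<xi> t) - C \<le> objective S Q P \<eta> \<xi>"
proof -
  define s where "s = start \<nu>2 N0"
  have s: "1 \<le> s" "s \<le> \<nu>2" using start_bounds[OF N0] by (auto simp: s_def)
  obtain CP where CP: "0 \<le> CP" "\<And>Q P \<eta> \<xi> t. feasible_from s Q P \<eta> \<xi> \<Longrightarrow> t \<in> {s..\<nu>2} \<Longrightarrow> norm (P t) \<le> CP"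
    using feasible_psd_bounded[OF s(2)] by blast
  define D where "D = real (Suc \<nu>2)"
  \<comment> \<open>Two boundary terms for each of at most \<open>D\<close> horizons cost
    \<open>2 * D * L * \<delta>\<close> times the slack sum. This choice makes that at most
    \<open>c / 4\<close>, half of the gain; \<open>L + 1\<close> avoids division by zero.\<close>
  define \<delta> where "\<delta> = c / (8 * D * (L + 1))"
  have D: "0 < D" and \<delta>: "0 < \<delta>" using c L by (auto simp: D_def \<delta>_def intro!: divide_pos_pos mult_pos_pos)
  obtain CE where CE: "0 \<le> CE" "\<And>Q P \<eta> \<xi> t. feasible_from s Q P \<eta> \<xi> \<Longrightarrow> t \<in> {s..\<nu>2} \<Longrightarrow>
      norm (\<eta> t) \<le> CE + \<delta> * (\<Sum>r = s..<\<nu>2. \<xi> r)"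
    using feasible_eta_sublinear[OF s \<delta>] by blast
  have "bounded_linear (\<lambda>P. trace (transpose B ** P ** B ** \<Sigma>w))"
    by (rule linear_conv_bounded_linear[THEN iffD1, OF linear_trace_sandwich])
  then obtain KT where KT: "0 \<le> KT" "\<And>P. norm (trace (transpose B ** P ** B ** \<Sigma>w)) \<le> norm P * KT"
    using bounded_linear.nonneg_bounded by blast
  define XR where "XR = (\<Sum>t = 0..\<nu>2. norm (xr t))"
  define C1 where "C1 = \<phi> + \<phi> * XR + CP * KT"
  have C1: "0 \<le> C1" using radius CP KT by (auto simp: C1_def XR_def intro!: add_nonneg_nonneg mult_nonneg_nonneg sum_nonneg)
  define C where "C = D * (L * (2 * CP + 2 * CE) + D * (L * C1))"
  show ?thesis
  proof (intro exI[of _ C] allI impI)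
    fix S Q P \<eta> \<xi> assume inf: "informative c L N0 S" and "feasible_from (start \<nu>2 N0) Q P \<eta> \<xi>"
    then have f: "feasible_from s Q P \<eta> \<xi>" by (simp add: s_def)
    define X where "X = (\<Sum>r = s..<\<nu>2. \<xi> r)"
    have \<xi>0: "0 \<le> \<xi> t" if "t \<in> {s..<\<nu>2}" for t using slack_nonneg[OF f that] .
    have X0: "0 \<le> X" unfolding X_def using \<xi>0 by (intro sum_nonneg)
    define E where "E = L * (2 * CP + 2 * (CE + \<delta> * X)) + D * (L * C1)"
    have E0: "0 \<le> E" using L CP CE \<delta> X0 D C1 by (auto simp: E_def intro!: add_nonneg_nonneg mult_nonneg_nonneg)
    have nQ: "norm Q \<le> \<phi>" using f by (simp add: feasible_from_def psd_ball_def)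
    let ?l = "\<lambda>N. stat_loss B \<Sigma>w \<nu>2 Q (\<lambda>t. - (Q *v xr t)) P \<eta> \<xi> N (S N)"
    let ?g = "\<lambda>N. \<Sum>t = s..<\<nu>2. if start \<nu>2 N \<le> t then 1/2 * (\<xi> t * snd (snd (S N t))) else 0"
    have lower: "- E + ?g N \<le> ?l N" if N: "N \<in> {\<nu>1..\<nu>2}" "N \<le> N0" for N
    proof -
      have sN: "s \<le> start \<nu>2 N" "start \<nu>2 N \<le> \<nu>2" using start_bounds[OF N(1)] N by (auto simp: s_def start_def)
      have S: "norm (S N t) \<le> L" if "t \<in> {s..\<nu>2}" for t
        using inf N that s by (auto simp: informative_def)
      have V: "\<bar>((1/2) *\<^sub>R P t, \<eta> t, 0) \<bullet> S N t\<bar> \<le> (CP + (CE + \<delta> * X)) * L" if "t \<in> {s..\<nu>2}" for t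
      proof -
        have "\<bar>((1/2) *\<^sub>R P t, \<eta> t, 0) \<bullet> S N t\<bar> \<le> norm ((1/2) *\<^sub>R P t, \<eta> t, 0 :: real) * norm (S N t)"
          by (rule Cauchy_Schwarz_ineq2)
        also have "\<dots> \<le> (CP + (CE + \<delta> * X)) * L"
        proof (rule mult_mono)
          have "norm (P t) \<le> CP" "norm (\<eta> t) \<le> CE + \<delta> * X"
            using CP(2)[OF f that] CE(2)[OF f that] by (auto simp: X_def)
          moreover have "norm ((1/2) *\<^sub>R P t, \<eta> t, 0 :: real) \<le> 1/2 * norm (P t) + norm (\<eta> t)"
            using norm_triple_le[of "(1/2) *\<^sub>R P t" "\<eta> t" 0] by simp
          ultimately show "norm ((1/2) *\<^sub>R P t, \<eta> t, 0 :: real) \<le> CP + (CE + \<delta> * X)"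
            using norm_ge_zero[of "P t"] by linarith
        qed (use S[OF that] CP CE \<delta> X0 in auto)
        finally show ?thesis .
      qed
      have W: "1/2 * (\<xi> t * snd (snd (S N t))) - L * C1 \<le>
          ((1/2) *\<^sub>R Q, - (Q *v xr t), 1/2 * \<xi> t - 1/2 * trace (transpose B ** P (t+1) ** B ** \<Sigma>w)) \<bullet> S N t"
        if t: "t \<in> {start \<nu>2 N..<\<nu>2}" for t
      proof -
        let ?T = "trace (transpose B ** P (t+1) ** B ** \<Sigma>w)"
        have t': "t \<in> {s..\<nu>2}" "t + 1 \<in> {s..\<nu>2}" using t sN by auto
        have "\<bar>((1/2) *\<^sub>R Q, - (Q *v xr t), - 1/2 * ?T) \<bullet> S N t\<bar>
          \<le> norm ((1/2) *\<^sub>R Q, - (Q *v xr t), - 1/2 * ?T) * norm (S N t)" by (rule Cauchy_Schwarz_ineq2)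
        also have "\<dots> \<le> C1 * L"
        proof (rule mult_mono)
          have "norm (xr t) \<le> XR" unfolding XR_def using t' by (intro member_le_sum) auto
          then have "norm (Q *v xr t) \<le> \<phi> * XR"
            using nQ radius by (intro order_trans[OF norm_matrix_vector_mult_le] mult_mono) auto
          moreover have "\<bar>?T\<bar> \<le> CP * KT"
          proof -
            have "\<bar>?T\<bar> \<le> norm (P (t+1)) * KT" using KT(2)[of "P (t+1)"] by simp
            also have "\<dots> \<le> CP * KT" by (intro mult_right_mono CP(2)[OF f t'(2)] KT(1))
            finally show ?thesis .
          qed
          moreover have "norm ((1/2) *\<^sub>R Q, - (Q *v xr t), - 1/2 * ?T) \<le> 1/2 * norm Q + norm (Q *v xr t) + 1/2 * \<bar>?T\<bar>"
            using norm_triple_le[of "(1/2) *\<^sub>R Q" "- (Q *v xr t)" "- 1/2 * ?T"] by (simp add: abs_mult)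
          ultimately show "norm ((1/2) *\<^sub>R Q, - (Q *v xr t), - 1/2 * ?T) \<le> C1"
            unfolding C1_def using nQ norm_ge_zero[of Q] abs_ge_zero[of ?T] by linarith
        qed (use S[OF t'(1)] C1 in auto)
        finally have "- (L * C1) \<le> ((1/2) *\<^sub>R Q, - (Q *v xr t), - 1/2 * ?T) \<bullet> S N t" by (simp add: mult.commute)
        moreover have "((1/2) *\<^sub>R Q, - (Q *v xr t), 1/2 * \<xi> t - 1/2 * ?T) \<bullet> S N t =
          1/2 * (\<xi> t * snd (snd (S N t))) + ((1/2) *\<^sub>R Q, - (Q *v xr t), - 1/2 * ?T) \<bullet> S N t"
          by (cases "S N t") (simp add: algebra_simps)
        ultimately show ?thesis by linarith
      qed
      have "(\<Sum>t = start \<nu>2 N..<\<nu>2. 1/2 * (\<xi> t * snd (snd (S N t))) - L * C1) =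
        ?g N - real (card {start \<nu>2 N..<\<nu>2}) * (L * C1)"
      proof -
        have "?g N = (\<Sum>t = start \<nu>2 N..<\<nu>2. 1/2 * (\<xi> t * snd (snd (S N t))))"
          using sN by (subst sum.inter_filter[symmetric]) (auto intro!: sum.cong)
        then show ?thesis by (simp only: sum_subtractf sum_constant of_nat_id)
      qed
      moreover have "real (card {start \<nu>2 N..<\<nu>2}) * (L * C1) \<le> D * (L * C1)"
        using L C1 by (intro mult_right_mono) (auto simp: D_def)
      ultimately have "?g N - D * (L * C1) \<le> (\<Sum>t = start \<nu>2 N..<\<nu>2.
          ((1/2) *\<^sub>R Q, - (Q *v xr t), 1/2 * \<xi> t - 1/2 * trace (transpose B ** P (t+1) ** B ** \<Sigma>w)) \<bullet> S N t)"
        using sum_mono[OF W, of "{start \<nu>2 N..<\<nu>2}" "\<lambda>t. t"] by simp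
      then show ?thesis
        using V[of \<nu>2] V[of "start \<nu>2 N"] sN s unfolding stat_loss_def E_def by (simp add: algebra_simps abs_le_iff)
    qed
    have g0: "0 \<le> ?g N" if "N \<in> {\<nu>1..\<nu>2}" for N
      using inf that s \<xi>0 by (intro sum_nonneg) (auto simp: informative_def)
    \<comment> \<open>Longer horizons contribute nothing, shorter ones contribute slack terms of the
      right sign, and \<open>N0\<close> supplies the gain.\<close>
    have lower': "- E + (if N = N0 then c / 2 * X else 0) \<le> ?l N" if N: "N \<in> {\<nu>1..\<nu>2}" for N
    proof -
      consider "N0 < N" | "N = N0" | "N < N0" by linarith
      then show ?thesis
      proof cases
        case 1
        then have "S N t = 0" if "t \<in> {1..\<nu>2}" for t using inf N that by (auto simp: informative_def)
        then have "?l N = 0" using start_bounds[OF N] by (simp add: stat_loss_def)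
        then show ?thesis using E0 1 by simp
      next
        case 2
        have "c / 2 * X \<le> ?g N"
          unfolding X_def sum_distrib_left
        proof (rule sum_mono)
          fix t assume t: "t \<in> {s..<\<nu>2}"
          have "c \<le> snd (snd (S N0 t))" using inf t s by (auto simp: informative_def)
          then have "\<xi> t * c \<le> \<xi> t * snd (snd (S N0 t))" using \<xi>0[OF t] by (intro mult_left_mono)
          then show "c / 2 * \<xi> t \<le> (if start \<nu>2 N \<le> t then 1/2 * (\<xi> t * snd (snd (S N t))) else 0)"
            using t 2 by (simp add: s_def mult.commute)
        qed
        then show ?thesis using lower[OF N] 2 by simp
      next
        case 3
        then show ?thesis using lower[OF N] g0[OF N] by simp
      qed
    qed
    have "(\<Sum>N = \<nu>1..\<nu>2. - E + (if N = N0 then c / 2 * X else 0)) \<le> objective S Q P \<eta> \<xi>"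
      unfolding objective_def by (intro sum_mono lower')
    moreover have "(\<Sum>N = \<nu>1..\<nu>2. - E + (if N = N0 then c / 2 * X else 0)) = - (real (card {\<nu>1..\<nu>2}) * E) + c / 2 * X"
      unfolding sum.distrib using N0 by simp
    moreover have "real (card {\<nu>1..\<nu>2}) * E \<le> D * E"
      using E0 horizons by (intro mult_right_mono) (auto simp: D_def)
    moreover have "D * E = C + 2 * D * L * \<delta> * X" by (simp add: E_def C_def algebra_simps)
    moreover have "2 * D * L * \<delta> * X \<le> c / 4 * X"
    proof (rule mult_right_mono[OF _ X0])
      have "2 * D * L * c = (2 * D) * (L * c)" "8 * D * (L + 1) = (2 * D) * (4 * (L + 1))" by simp_all
      then have "2 * D * L * \<delta> = ((2 * D) * (L * c)) / ((2 * D) * (4 * (L + 1)))"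
        unfolding \<delta>_def times_divide_eq_right by (rule arg_cong2)
      also have "\<dots> = (L * c) / (4 * (L + 1))" using D by (intro mult_divide_mult_cancel_left) auto
      also have "\<dots> = c / 4 * (L / (L + 1))" by simp
      also have "\<dots> \<le> c / 4 * 1" using c L by (intro mult_left_mono) auto
      finally show "2 * D * L * \<delta> \<le> c / 4" by simp
    qed
    ultimately show "c / 4 * (\<Sum>t = start \<nu>2 N0..<\<nu>2. \<xi> t) - C \<le> objective S Q P \<eta> \<xi>"
      by (simp add: X_def[symmetric] s_def[symmetric])
  qed
qed

end

lemma abs_snd_snd_le_norm: "\<bar>snd (snd z) :: real\<bar> \<le> norm z"
  using order_trans[OF norm_snd_le norm_snd_le, of "snd (snd z)" "fst z" "fst (snd z)"] by simp

context est_problem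
begin

text \<open>Convergence of the variables is required only from the start of \<open>N0\<close> on,
  because the statistics of longer horizons are zero.\<close>

lemma tendsto_objective:
  assumes N0: "N0 \<in> {\<nu>1..\<nu>2}"
    and zero: "\<And>k N t. N \<in> {\<nu>1..\<nu>2} \<Longrightarrow> N0 < N \<Longrightarrow> t \<in> {1..\<nu>2} \<Longrightarrow> S k N t = 0"
    and S: "\<And>N t. N \<in> {\<nu>1..\<nu>2} \<Longrightarrow> t \<in> {1..\<nu>2} \<Longrightarrow> (\<lambda>k. S k N t) \<longlonglongrightarrow> S' N t"
    and Q: "Q \<longlonglongrightarrow> Q'"
    and P: "\<And>t. t \<in> {start \<nu>2 N0..\<nu>2} \<Longrightarrow> (\<lambda>k. P k t) \<longlonglongrightarrow> P' t"
    and \<eta>: "\<And>t. t \<in> {start \<nu>2 N0..\<nu>2} \<Longrightarrow> (\<lambda>k. \<eta> k t) \<longlonglongrightarrow> \<eta>' t"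
    and \<xi>: "\<And>t. t \<in> {start \<nu>2 N0..<\<nu>2} \<Longrightarrow> (\<lambda>k. \<xi> k t) \<longlonglongrightarrow> \<xi>' t"
  shows "(\<lambda>k::nat. objective (S k) (Q k) (P k) (\<eta> k) (\<xi> k)) \<longlonglongrightarrow> objective S' Q' P' \<eta>' \<xi>'"
  unfolding objective_def
proof (rule tendsto_sum)
  fix N assume N: "N \<in> {\<nu>1..\<nu>2}"
  show "(\<lambda>k. stat_loss B \<Sigma>w \<nu>2 (Q k) (\<lambda>t. - (Q k *v xr t)) (P k) (\<eta> k) (\<xi> k) N (S k N))
      \<longlonglongrightarrow> stat_loss B \<Sigma>w \<nu>2 Q' (\<lambda>t. - (Q' *v xr t)) P' \<eta>' \<xi>' N (S' N)"
  proof (cases "N0 < N")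
    case True
    then have z: "S k N t = 0" if "t \<in> {1..\<nu>2}" for k t using zero N that by blast
    then have z': "S' N t = 0" if "t \<in> {1..\<nu>2}" for t
      using S[OF N that] that by (simp add: LIMSEQ_const_iff)
    show ?thesis using start_bounds[OF N] z z' by (simp add: stat_loss_def)
  next
    case False
    then show ?thesis
      using start_bounds[OF N] start_bounds[OF N0]
      by (intro tendsto_stat_loss[where ?s0.0="start \<nu>2 N0"] Q P \<eta> \<xi> S[OF N] tendsto_minus tendsto_matrix_vector_mult tendsto_const)
         (auto simp: start_def)
  qed
qed

text \<open>The compactness step behind both existence, with constant statistics, and stability,
  with converging ones. Bounded objective values bound the slacks by coercivity, hence all variables
  from the start of \<open>N0\<close> on, and the constraints are closed.\<close>

lemma minimizing_sequence_limit:
  assumes c: "0 < c" "0 \<le> L" and N0: "N0 \<in> {\<nu>1..\<nu>2}"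
    and inf: "\<And>k. informative c L N0 (S k)"
    and S: "\<And>N t. N \<in> {\<nu>1..\<nu>2} \<Longrightarrow> t \<in> {1..\<nu>2} \<Longrightarrow> (\<lambda>k. S k N t) \<longlonglongrightarrow> S' N t"
    and f: "\<And>k. feasible_from (start \<nu>2 N0) (Q k) (P k) (\<eta> k) (\<xi> k)"
    and J: "\<And>k. objective (S k) (Q k) (P k) (\<eta> k) (\<xi> k) \<le> J"
  obtains r :: "nat \<Rightarrow> nat" and Q' P' \<eta>' \<xi>' where "strict_mono r" "feasible_from (start \<nu>2 N0) Q' P' \<eta>' \<xi>'"
    "(\<lambda>k. Q (r k)) \<longlonglongrightarrow> Q'"
    "(\<lambda>k. objective (S (r k)) (Q (r k)) (P (r k)) (\<eta> (r k)) (\<xi> (r k))) \<longlonglongrightarrow> objective S' Q' P' \<eta>' \<xi>'"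
proof -
  define s where "s = start \<nu>2 N0"
  have s: "1 \<le> s" "s \<le> \<nu>2" using start_bounds[OF N0] by (auto simp: s_def)
  note f = f[folded s_def]
  obtain C where C: "\<And>S Q P \<eta> \<xi>. informative c L N0 S \<Longrightarrow> feasible_from s Q P \<eta> \<xi> \<Longrightarrow>
      c / 4 * (\<Sum>t = s..<\<nu>2. \<xi> t) - C \<le> objective S Q P \<eta> \<xi>"
    using objective_coercive[OF c N0] unfolding s_def by blast
  define X where "X = 4 * (J + C) / c"
  have sumX: "(\<Sum>t = s..<\<nu>2. \<xi> k t) \<le> X" for k
  proof -
    have "c / 4 * (\<Sum>t = s..<\<nu>2. \<xi> k t) \<le> J + C" using C[OF inf f, of k k] J[of k] by linarith
    then show ?thesis using c by (simp add: X_def field_simps)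
  qed
  obtain CP where CP: "\<And>k t. t \<in> {s..\<nu>2} \<Longrightarrow> norm (P k t) \<le> CP"
    using feasible_psd_bounded[OF s(2)] f by blast
  obtain CE where CE: "\<And>k t. t \<in> {s..\<nu>2} \<Longrightarrow> norm (\<eta> k t) \<le> CE + 1 * (\<Sum>r = s..<\<nu>2. \<xi> k r)"
    using feasible_eta_sublinear[OF s zero_less_one] f by blast
  have \<xi>b: "\<bar>\<xi> k t\<bar> \<le> X" if "t \<in> {s..<\<nu>2}" for k t
  proof -
    have "\<xi> k t \<le> (\<Sum>t = s..<\<nu>2. \<xi> k t)"
      using slack_nonneg[OF f] that by (intro member_le_sum) auto
    then show ?thesis using sumX[of k] slack_nonneg[OF f that] by simp
  qed
  have X0: "0 \<le> X" using order_trans[OF sum_nonneg sumX] slack_nonneg[OF f] by blast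
  \<comment> \<open>The slack at \<open>\<nu>2\<close> is subject to no constraint and could be
    unbounded, so it is masked by 0.\<close>
  define g where "g t k = (P k t, \<eta> k t, if t < \<nu>2 then \<xi> k t else 0)" for t k
  have "\<exists>r l. strict_mono r \<and> (\<forall>t\<in>{s..\<nu>2}. (\<lambda>k. g t (r k)) \<longlonglongrightarrow> l t)"
  proof (rule finite_family_convergent_subsequence)
    fix t assume t: "t \<in> {s..\<nu>2}"
    have "norm (g t k) \<le> CP + (CE + X) + X" for k
      using norm_triple_le[of "P k t" "\<eta> k t" "if t < \<nu>2 then \<xi> k t else 0"] CP[OF t, of k] CE[OF t, of k] sumX[of k] \<xi>b[of t k] X0 t
      unfolding g_def by (auto split: if_splits)
    then show "bounded (range (g t))" by (auto simp: bounded_iff)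
  qed simp
  then obtain r l where r: "strict_mono r" "\<And>t. t \<in> {s..\<nu>2} \<Longrightarrow> (\<lambda>k. g t (r k)) \<longlonglongrightarrow> l t" by blast
  define P' where "P' t = fst (l t)" for t
  define \<eta>' where "\<eta>' t = fst (snd (l t))" for t
  define \<xi>' where "\<xi>' t = snd (snd (l t))" for t
  \<comment> \<open>The weight is not listed in \<open>g\<close>, since it equals \<open>P\<close>
    at the final time.\<close>
  define Q' where "Q' = P' \<nu>2"
  have lP: "(\<lambda>k. P (r k) t) \<longlonglongrightarrow> P' t" if "t \<in> {s..\<nu>2}" for t
    using tendsto_fst[OF r(2)[OF that]] by (simp add: g_def P'_def)
  have l\<eta>: "(\<lambda>k. \<eta> (r k) t) \<longlonglongrightarrow> \<eta>' t" if "t \<in> {s..\<nu>2}" for t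
    using tendsto_fst[OF tendsto_snd[OF r(2)[OF that]]] by (simp add: g_def \<eta>'_def)
  have l\<xi>: "(\<lambda>k. \<xi> (r k) t) \<longlonglongrightarrow> \<xi>' t" if "t \<in> {s..<\<nu>2}" for t
    using tendsto_snd[OF tendsto_snd[OF r(2)[of t]]] that by (simp add: g_def \<xi>'_def)
  have lQ: "(\<lambda>k. Q (r k)) \<longlonglongrightarrow> Q'"
  proof -
    have "Q k = P k \<nu>2" for k using f[of k] by (simp add: feasible_from_def)
    then show ?thesis using lP[of \<nu>2] s by (simp add: Q'_def)
  qed
  have "feasible_from s Q' P' \<eta>' \<xi>'"
    unfolding feasible_from_def psd_ball_def
  proof (intro conjI ballI allI CollectI)
    have "norm (Q (r k)) \<le> \<phi>" for k using f[of "r k"] by (simp add: feasible_from_def psd_ball_def)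
    then show "norm Q' \<le> \<phi>" using tendsto_norm[OF lQ] by (auto intro: LIMSEQ_le_const2)
    have "psd (Q (r k))" for k using f[of "r k"] by (simp add: feasible_from_def psd_ball_def)
    then show "psd Q'" using lQ by (rule psd_limit)
    show "P' \<nu>2 = Q'" by (simp add: Q'_def)
    have "\<eta> (r k) \<nu>2 = - (Q (r k) *v xr \<nu>2)" for k using f[of "r k"] by (simp add: feasible_from_def)
    moreover have "(\<lambda>k. - (Q (r k) *v xr \<nu>2)) \<longlonglongrightarrow> - (Q' *v xr \<nu>2)" by (intro tendsto_intros lQ)
    ultimately show "\<eta>' \<nu>2 = - (Q' *v xr \<nu>2)" using l\<eta>[of \<nu>2] s by (simp add: LIMSEQ_unique)
    show "psd (P' t)" if "t \<in> {s..\<nu>2}" for t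
    proof (rule psd_limit[OF _ lP[OF that]])
      show "psd (P (r k) t)" for k using f[of "r k"] that by (simp add: feasible_from_def)
    qed
    show "0 \<le> stage_form A B Q' (- (Q' *v xr t)) (P' t) (\<eta>' t) (P' (t+1)) (\<eta>' (t+1)) (\<xi>' t) u x c"
      if "t \<in> {s..<\<nu>2}" for t u x c
    proof (rule LIMSEQ_le_const)
      show "(\<lambda>k. stage_form A B (Q (r k)) (- (Q (r k) *v xr t)) (P (r k) t) (\<eta> (r k) t) (P (r k) (t+1)) (\<eta> (r k) (t+1)) (\<xi> (r k) t) u x c)
        \<longlonglongrightarrow> stage_form A B Q' (- (Q' *v xr t)) (P' t) (\<eta>' t) (P' (t+1)) (\<eta>' (t+1)) (\<xi>' t) u x c"
        unfolding stage_form_def using that by (intro tendsto_intros lQ lP l\<eta> l\<xi>) auto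
      show "\<exists>N. \<forall>k\<ge>N. 0 \<le> stage_form A B (Q (r k)) (- (Q (r k) *v xr t)) (P (r k) t) (\<eta> (r k) t) (P (r k) (t+1)) (\<eta> (r k) (t+1)) (\<xi> (r k) t) u x c"
        using f that by (simp add: feasible_from_def)
    qed
  qed
  moreover have "(\<lambda>k. objective (S (r k)) (Q (r k)) (P (r k)) (\<eta> (r k)) (\<xi> (r k))) \<longlonglongrightarrow> objective S' Q' P' \<eta>' \<xi>'"
  proof (rule tendsto_objective[OF N0])
    show "S (r k) N t = 0" if "N \<in> {\<nu>1..\<nu>2}" "N0 < N" "t \<in> {1..\<nu>2}" for k N t
      using inf[of "r k"] that by (simp add: informative_def)
    show "(\<lambda>k. S (r k) N t) \<longlonglongrightarrow> S' N t" if "N \<in> {\<nu>1..\<nu>2}" "t \<in> {1..\<nu>2}" for N t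
      using LIMSEQ_subseq_LIMSEQ[OF S[OF that] r(1)] by (simp add: comp_def)
  qed (use lQ lP l\<eta> l\<xi> in \<open>auto simp: s_def\<close>)
  ultimately show ?thesis using r(1) lQ by (intro that) (auto simp: s_def)
qed

text \<open>The infimum is taken over the larger truncated feasible set, where minimizing sequences
  are bounded. Extending the minimizer backward changes only variables that meet zero
  statistics.\<close>

lemma minimizer_exists:
  assumes c: "0 < c" "0 \<le> L" and inf: "informative c L N0 S"
  shows "\<exists>Q P \<eta> \<xi>. feasible_from 1 Q P \<eta> \<xi> \<and>
    (\<forall>Q' P' \<eta>' \<xi>'. feasible_from 1 Q' P' \<eta>' \<xi>' \<longrightarrow> objective S Q P \<eta> \<xi> \<le> objective S Q' P' \<eta>' \<xi>')"
proof -
  have N0: "N0 \<in> {\<nu>1..\<nu>2}" using inf by (simp add: informative_def)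
  define s where "s = start \<nu>2 N0"
  have s: "1 \<le> s" "s \<le> \<nu>2" using start_bounds[OF N0] by (auto simp: s_def)
  define V where "V = {objective S Q P \<eta> \<xi> | Q P \<eta> \<xi>. feasible_from s Q P \<eta> \<xi>}"
  define m where "m = Inf V"
  obtain C where C: "\<And>Q P \<eta> \<xi>. feasible_from s Q P \<eta> \<xi> \<Longrightarrow> c / 4 * (\<Sum>t = s..<\<nu>2. \<xi> t) - C \<le> objective S Q P \<eta> \<xi>"
    using objective_coercive[OF c N0] inf unfolding s_def by blast
  have "- C \<le> v" if v: "v \<in> V" for v
  proof -
    obtain Q P \<eta> \<xi> where z: "v = objective S Q P \<eta> \<xi>" "feasible_from s Q P \<eta> \<xi>" using v by (auto simp: V_def)
    have "0 \<le> (\<Sum>t = s..<\<nu>2. \<xi> t)" using slack_nonneg[OF z(2)] by (intro sum_nonneg)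
    then have "0 \<le> c / 4 * (\<Sum>t = s..<\<nu>2. \<xi> t)" using c by simp
    then show ?thesis using C[OF z(2)] z(1) by linarith
  qed
  then have bdd: "bdd_below V" by (auto simp: bdd_below_def)
  have ne: "V \<noteq> {}" using feasible_exists feasible_from_mono[OF _ s(1)] unfolding V_def by blast
  have mle: "m \<le> objective S Q P \<eta> \<xi>" if "feasible_from s Q P \<eta> \<xi>" for Q P \<eta> \<xi>
    unfolding m_def using that by (intro cInf_lower bdd) (auto simp: V_def)
  have "\<exists>Q P \<eta> \<xi>. feasible_from s Q P \<eta> \<xi> \<and> objective S Q P \<eta> \<xi> < m + inverse (real (Suc k))" for k
  proof -
    have "Inf V < m + inverse (real (Suc k))" by (simp add: m_def)
    then obtain v where "v \<in> V" "v < m + inverse (real (Suc k))" using cInf_lessD[OF ne] by blast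
    then show ?thesis by (auto simp: V_def)
  qed
  then obtain Q P \<eta> \<xi> where z: "\<And>k. feasible_from s (Q k) (P k) (\<eta> k) (\<xi> k)"
    "\<And>k. objective S (Q k) (P k) (\<eta> k) (\<xi> k) < m + inverse (real (Suc k))" by metis
  have Jle: "objective S (Q k) (P k) (\<eta> k) (\<xi> k) \<le> m + 1" for k
  proof -
    have "inverse (real (Suc k)) \<le> 1" by (simp add: inverse_le_1_iff)
    then show ?thesis using z(2)[of k] by linarith
  qed
  note lim = minimizing_sequence_limit[of c L N0 "\<lambda>_. S" S Q P \<eta> \<xi> "m + 1", folded s_def, OF c N0 inf _ z(1) Jle]
  obtain r Q' P' \<eta>' \<xi>' where r: "strict_mono r" "feasible_from s Q' P' \<eta>' \<xi>'"
    "(\<lambda>k. objective S (Q (r k)) (P (r k)) (\<eta> (r k)) (\<xi> (r k))) \<longlonglongrightarrow> objective S Q' P' \<eta>' \<xi>'"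
    by (rule lim) (rule tendsto_const)
  have "objective S Q' P' \<eta>' \<xi>' \<le> m"
  proof (rule LIMSEQ_le[OF r(3)])
    have "(\<lambda>k. m + inverse (real (Suc (r k)))) \<longlonglongrightarrow> m + 0"
      using LIMSEQ_subseq_LIMSEQ[OF LIMSEQ_inverse_real_of_nat r(1)] by (intro tendsto_add tendsto_const) (simp add: comp_def)
    then show "(\<lambda>k. m + inverse (real (Suc (r k)))) \<longlonglongrightarrow> m" by simp
    show "\<exists>N. \<forall>n\<ge>N. objective S (Q (r n)) (P (r n)) (\<eta> (r n)) (\<xi> (r n)) \<le> m + inverse (real (Suc (r n)))"
      using z(2) less_imp_le by blast
  qed
  moreover obtain P2 \<eta>2 \<xi>2 where e: "feasible_from 1 Q' P2 \<eta>2 \<xi>2"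
    "\<And>t. s \<le> t \<Longrightarrow> P2 t = P' t" "\<And>t. s \<le> t \<Longrightarrow> \<eta>2 t = \<eta>' t" "\<And>t. s \<le> t \<Longrightarrow> \<xi>2 t = \<xi>' t"
    using feasible_from_extend[OF r(2) s] by blast
  moreover have "objective S Q' P2 \<eta>2 \<xi>2 = objective S Q' P' \<eta>' \<xi>'"
  proof (rule objective_cong[OF s])
    fix N t assume "N \<in> {\<nu>1..\<nu>2}" "start \<nu>2 N < s" "t \<in> {1..\<nu>2}"
    then show "S N t = 0" using inf by (auto simp: informative_def s_def start_def)
  qed (use e in auto)
  ultimately show ?thesis
    using mle feasible_from_mono[OF _ s(1)] by (metis order_trans)
qed

text \<open>Otherwise there are minimizers at distance more than \<open>\<epsilon>\<close> from
  \<open>Qb\<close> for statistics tending to \<open>S'\<close>. A limit point of them minimizes the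
  limiting objective, so its weight is \<open>Qb\<close> by \<open>uniq\<close>, yet it keeps the
  distance \<open>\<epsilon>\<close>.\<close>

lemma minimizer_stable:
  assumes c: "0 < c" "0 \<le> L" and inf: "informative c L \<nu>2 S'" and \<epsilon>: "0 < \<epsilon>"
    and uniq: "\<And>Q P \<eta> \<xi>. feasible_from 1 Q P \<eta> \<xi> \<Longrightarrow>
      (\<And>Q' P' \<eta>' \<xi>'. feasible_from 1 Q' P' \<eta>' \<xi>' \<Longrightarrow> objective S' Q P \<eta> \<xi> \<le> objective S' Q' P' \<eta>' \<xi>') \<Longrightarrow> Q = Qb"
  obtains \<delta> where "0 < \<delta>"
    "\<And>S Q P \<eta> \<xi>. (\<And>N t. N \<in> {\<nu>1..\<nu>2} \<Longrightarrow> t \<in> {1..\<nu>2} \<Longrightarrow> norm (S N t - S' N t) < \<delta> \<and> 0 \<le> snd (snd (S N t))) \<Longrightarrow>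
      feasible_from 1 Q P \<eta> \<xi> \<Longrightarrow>
      (\<And>Q' P' \<eta>' \<xi>'. feasible_from 1 Q' P' \<eta>' \<xi>' \<Longrightarrow> objective S Q P \<eta> \<xi> \<le> objective S Q' P' \<eta>' \<xi>') \<Longrightarrow>
      dist Q Qb \<le> \<epsilon>"
proof -
  define bad where "bad \<delta> S Q P \<eta> \<xi> \<longleftrightarrow>
    (\<forall>N\<in>{\<nu>1..\<nu>2}. \<forall>t\<in>{1..\<nu>2}. norm (S N t - S' N t) < \<delta> \<and> 0 \<le> snd (snd (S N t))) \<and> feasible_from 1 Q P \<eta> \<xi> \<and>
    (\<forall>Q' P' \<eta>' \<xi>'. feasible_from 1 Q' P' \<eta>' \<xi>' \<longrightarrow> objective S Q P \<eta> \<xi> \<le> objective S Q' P' \<eta>' \<xi>') \<and> \<epsilon> < dist Q Qb" for \<delta> S Q P \<eta> \<xi>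
  have "\<exists>\<delta>>0. \<forall>S Q P \<eta> \<xi>. \<not> bad \<delta> S Q P \<eta> \<xi>"
  proof (rule ccontr)
    \<comment> \<open>The bound \<open>c / 2\<close> keeps the full-horizon weight of the perturbed
      statistics at least \<open>c / 2\<close>, and the bound 1 keeps their norms at most
      \<open>L + 1\<close>, so one coercivity estimate serves them all.\<close>
    define d where "d k = min 1 (c / 2) * inverse (real (Suc k))" for k
    have d0: "0 < d k" for k using c by (simp add: d_def)
    have d1: "d k \<le> min 1 (c / 2)" for k
    proof -
      have "inverse (real (Suc k)) \<le> 1" by (simp add: inverse_le_1_iff)
      then have "d k \<le> min 1 (c / 2) * 1" unfolding d_def using c by (intro mult_left_mono) auto
      then show ?thesis by simp
    qed
    have dl: "d \<longlonglongrightarrow> 0"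
      using tendsto_mult[OF tendsto_const LIMSEQ_inverse_real_of_nat, of "min 1 (c / 2)"] by (simp add: d_def[abs_def])
    assume "\<not> (\<exists>\<delta>>0. \<forall>S Q P \<eta> \<xi>. \<not> bad \<delta> S Q P \<eta> \<xi>)"
    then have "\<forall>k. \<exists>S Q P \<eta> \<xi>. bad (d k) S Q P \<eta> \<xi>" using d0 by blast
    then obtain S Q P \<eta> \<xi> where b: "\<And>k. bad (d k) (S k) (Q k) (P k) (\<eta> k) (\<xi> k)" by metis
    have near: "norm (S k N t - S' N t) < d k" "0 \<le> snd (snd (S k N t))" if "N \<in> {\<nu>1..\<nu>2}" "t \<in> {1..\<nu>2}" for k N t
      using b[of k] that by (auto simp: bad_def)
    have f: "feasible_from 1 (Q k) (P k) (\<eta> k) (\<xi> k)" for k using b[of k] by (simp add: bad_def)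
    have opt: "objective (S k) (Q k) (P k) (\<eta> k) (\<xi> k) \<le> objective (S k) Q' P' \<eta>' \<xi>'"
      if "feasible_from 1 Q' P' \<eta>' \<xi>'" for k Q' P' \<eta>' \<xi>' using b[of k] that by (simp add: bad_def)
    have far: "\<epsilon> < dist (Q k) Qb" for k using b[of k] by (simp add: bad_def)
    have S: "(\<lambda>k. S k N t) \<longlonglongrightarrow> S' N t" if "N \<in> {\<nu>1..\<nu>2}" "t \<in> {1..\<nu>2}" for N t
    proof (rule LIM_zero_cancel, rule Lim_null_comparison[OF _ dl])
      show "\<forall>\<^sub>F k in sequentially. norm (S k N t - S' N t) \<le> d k"
        using near(1)[OF that] by (intro always_eventually allI less_imp_le)
    qed
    have \<nu>2: "\<nu>2 \<in> {\<nu>1..\<nu>2}" and s: "start \<nu>2 \<nu>2 = 1" using horizons by (auto simp: start_def)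
    have infk: "informative (c / 2) (L + 1) \<nu>2 (S k)" for k
      unfolding informative_def
    proof (intro conjI ballI impI \<nu>2)
      fix N t assume Nt: "N \<in> {\<nu>1..\<nu>2}" "t \<in> {1..\<nu>2}"
      have "norm (S' N t) \<le> L" using inf Nt by (simp add: informative_def)
      then show "norm (S k N t) \<le> L + 1"
        using norm_triangle_sub[of "S k N t" "S' N t"] near(1)[OF Nt, of k] d1[of k] by simp
      show "0 \<le> snd (snd (S k N t))" using near(2)[OF Nt] .
      show "S k N t = 0" if "\<nu>2 < N" using that Nt by simp
    next
      fix t assume t: "t \<in> {1..\<nu>2}"
      have "c \<le> snd (snd (S' \<nu>2 t))" using inf t by (simp add: informative_def)
      moreover have "\<bar>snd (snd (S k \<nu>2 t)) - snd (snd (S' \<nu>2 t))\<bar> \<le> norm (S k \<nu>2 t - S' \<nu>2 t)"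
        using abs_snd_snd_le_norm[of "S k \<nu>2 t - S' \<nu>2 t"] by simp
      ultimately show "c / 2 \<le> snd (snd (S k \<nu>2 t))"
        using near(1)[OF \<nu>2 t, of k] d1[of k] by (simp add: abs_le_iff)
    qed
    have lim: "(\<lambda>k. objective (S k) Q' P' \<eta>' \<xi>') \<longlonglongrightarrow> objective S' Q' P' \<eta>' \<xi>'" for Q' P' \<eta>' \<xi>'
      by (rule tendsto_objective[OF \<nu>2]) (use S in auto)
    obtain Q0 P0 \<eta>0 \<xi>0 where z0: "feasible_from 1 Q0 P0 \<eta>0 \<xi>0" using feasible_exists by blast
    \<comment> \<open>One fixed feasible point bounds all the minimal values from above, since its
      objective converges.\<close>
    obtain J where J: "\<And>k. \<bar>objective (S k) Q0 P0 \<eta>0 \<xi>0\<bar> \<le> J"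
      using convergent_imp_Bseq[OF convergentI[OF lim]] unfolding Bseq_def by (metis real_norm_def)
    have c2: "0 < c / 2" and L2: "0 \<le> L + 1" using c by auto
    have Jle: "objective (S k) (Q k) (P k) (\<eta> k) (\<xi> k) \<le> J" for k
      using opt[OF z0, of k] J[of k] by linarith
    obtain r Q' P' \<eta>' \<xi>' where r: "strict_mono r" "feasible_from 1 Q' P' \<eta>' \<xi>'" "(\<lambda>k. Q (r k)) \<longlonglongrightarrow> Q'"
      "(\<lambda>k. objective (S (r k)) (Q (r k)) (P (r k)) (\<eta> (r k)) (\<xi> (r k))) \<longlonglongrightarrow> objective S' Q' P' \<eta>' \<xi>'"
      by (rule minimizing_sequence_limit[of "c / 2" "L + 1" \<nu>2 S S' Q P \<eta> \<xi> J, unfolded s, OF c2 L2 \<nu>2 infk _ f Jle]) (rule S)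
    have "Q' = Qb"
    proof (rule uniq[OF r(2)])
      fix Q2 P2 \<eta>2 \<xi>2 assume "feasible_from 1 Q2 P2 \<eta>2 \<xi>2"
      from opt[OF this] show "objective S' Q' P' \<eta>' \<xi>' \<le> objective S' Q2 P2 \<eta>2 \<xi>2"
        using LIMSEQ_le[OF r(4) LIMSEQ_subseq_LIMSEQ[OF lim r(1), unfolded comp_def]] by blast
    qed
    moreover have "(\<lambda>k. dist (Q (r k)) Qb) \<longlonglongrightarrow> dist Q' Qb" by (intro tendsto_intros r)
    then have "\<epsilon> \<le> dist Q' Qb" using far less_imp_le by (intro LIMSEQ_le_const) blast+
    ultimately show False using \<epsilon> by simp
  qed
  then obtain \<delta> where "0 < \<delta>" and nb: "\<And>S Q P \<eta> \<xi>. \<not> bad \<delta> S Q P \<eta> \<xi>" by blast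
  show ?thesis
  proof (rule that[OF \<open>0 < \<delta>\<close>])
    fix S Q P \<eta> \<xi>
    assume a: "\<And>N t. N \<in> {\<nu>1..\<nu>2} \<Longrightarrow> t \<in> {1..\<nu>2} \<Longrightarrow> norm (S N t - S' N t) < \<delta> \<and> 0 \<le> snd (snd (S N t))"
      "feasible_from 1 Q P \<eta> \<xi>"
      "\<And>Q' P' \<eta>' \<xi>'. feasible_from 1 Q' P' \<eta>' \<xi>' \<Longrightarrow> objective S Q P \<eta> \<xi> \<le> objective S Q' P' \<eta>' \<xi>'"
    show "dist Q Qb \<le> \<epsilon>"
    proof (rule ccontr)
      assume "\<not> dist Q Qb \<le> \<epsilon>"
      then have "bad \<delta> S Q P \<eta> \<xi>" unfolding bad_def using a by (simp add: not_le)
      then show False using nb by blast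
    qed
  qed
qed

end

section \<open>Consistency\<close>

lemma norm_outer_square: "norm (outer_square v) = (norm v)\<^sup>2"
proof -
  have "outer_square v *v v = (v \<bullet> v) *\<^sub>R v"
    by (simp add: vec_eq_iff matrix_vector_mult_def outer_square_def inner_vec_def sum_distrib_left mult_ac)
  then have "outer_square v \<bullet> outer_square v = (v \<bullet> v) * (v \<bullet> v)"
    by (simp add: inner_outer_square)
  then show ?thesis
    by (simp add: norm_eq_sqrt_inner real_sqrt_mult power2_eq_square)
qed

lemma borel_measurable_stat_of [measurable]: "(stat_of :: real^'k \<Rightarrow> _) \<in> borel_measurable borel"
proof (rule borel_measurable_continuous_onI)
  have "continuous_on UNIV (\<lambda>v :: real^'k. (\<chi> i j. v $ i * v $ j) :: real^'k^'k)"
    by (intro continuous_intros)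
  then show "continuous_on UNIV (stat_of :: real^'k \<Rightarrow> _)"
    unfolding stat_of_def outer_square_def by (intro continuous_intros)
qed

lemma norm_stat_of_le: "norm (stat_of v) \<le> 2 + 2 * (norm v)\<^sup>2"
proof -
  have "norm (stat_of v) \<le> (norm v)\<^sup>2 + norm v + 1"
    using norm_triple_le[of "outer_square v" v 1] by (simp add: stat_of_def norm_outer_square)
  moreover have "norm v \<le> 1 + (norm v)\<^sup>2"
    using sum_squares_bound[of "norm v" 1] norm_ge_zero[of v] unfolding power2_eq_square by linarith
  ultimately show ?thesis by linarith
qed

text \<open>Being zero for other horizon lengths, it can be averaged over the whole sample as a mean
  of identically distributed variables; the random counts per horizon length never appear as
  divisors.\<close>

definition indexed_stat :: "nat \<Rightarrow> nat \<Rightarrow> (nat \<Rightarrow> real^'n) \<times> nat \<Rightarrow> (real^'n^'n) \<times> (real^'n) \<times> real" where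
  "indexed_stat N t z = (if snd z = N then stat_of (fst z t) else 0)"

definition empirical_stat :: "nat \<Rightarrow> (nat \<Rightarrow> (nat \<Rightarrow> real^'n) \<times> nat) \<Rightarrow> nat \<Rightarrow> nat \<Rightarrow> (real^'n^'n) \<times> (real^'n) \<times> real" where
  "empirical_stat M d N t = (1 / real M) *\<^sub>R (\<Sum>i<M. indexed_stat N t (d i))"

lemma empirical_stat_weight:
  "snd (snd (empirical_stat M d N t)) = (1 / real M) * (\<Sum>i<M. if snd (d i) = N then 1 else 0)"
  by (auto simp: empirical_stat_def snd_sum indexed_stat_def stat_of_def intro!: sum.cong)

lemma empirical_stat_weight_nonneg: "0 \<le> snd (snd (empirical_stat M d N t))"
  unfolding empirical_stat_weight by (intro mult_nonneg_nonneg sum_nonneg) auto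

lemma borel_measurable_indexed_stat:
  assumes "t \<in> {1..\<nu>2}"
  shows "indexed_stat N t \<in> borel_measurable (obs_space \<nu>2)"
proof -
  have "(\<lambda>z. fst z t) \<in> borel_measurable (obs_space \<nu>2)"
    unfolding obs_space_def
    by (rule measurable_compose[OF measurable_fst measurable_component_singleton[OF assms]])
  moreover have "snd \<in> measurable (obs_space \<nu>2) (count_space UNIV)"
    unfolding obs_space_def by measurable
  ultimately show ?thesis unfolding indexed_stat_def[abs_def] by measurable
qed

lemma stat_loss_indexed_stat:
  "stat_loss B S \<nu> Q q P \<eta> \<xi> N (\<lambda>t. indexed_stat N t z) =
    (if snd z = N then est_loss B S \<nu> Q q P \<eta> \<xi> N (fst z) else 0)"
  by (simp add: indexed_stat_def est_loss_eq_stat_loss stat_loss_zero)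

lemma stat_loss_integral:
  assumes Z: "\<And>t. t \<in> {1..\<nu>} \<Longrightarrow> integrable M (Z t)" and s: "start \<nu> N \<le> \<nu>"
  shows "integrable M (\<lambda>\<omega>. stat_loss B S \<nu> Q q P \<eta> \<xi> N (\<lambda>t. Z t \<omega>))"
    and "(\<integral>\<omega>. stat_loss B S \<nu> Q q P \<eta> \<xi> N (\<lambda>t. Z t \<omega>) \<partial>M) = stat_loss B S \<nu> Q q P \<eta> \<xi> N (\<lambda>t. \<integral>\<omega>. Z t \<omega> \<partial>M)"
proof -
  have s1: "1 \<le> start \<nu> N" by (simp add: start_def)
  have i: "integrable M (\<lambda>\<omega>. c \<bullet> Z t \<omega>)" "(\<integral>\<omega>. c \<bullet> Z t \<omega> \<partial>M) = c \<bullet> (\<integral>\<omega>. Z t \<omega> \<partial>M)" if "start \<nu> N \<le> t" "t \<le> \<nu>" for c t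
    using Z[of t] that s1 by auto
  have i2: "integrable M (\<lambda>\<omega>. \<Sum>t = start \<nu> N..<\<nu>. c t \<bullet> Z t \<omega>)"
    "(\<integral>\<omega>. (\<Sum>t = start \<nu> N..<\<nu>. c t \<bullet> Z t \<omega>) \<partial>M) = (\<Sum>t = start \<nu> N..<\<nu>. c t \<bullet> (\<integral>\<omega>. Z t \<omega> \<partial>M))" for c
  proof -
    have j: "integrable M (\<lambda>\<omega>. c t \<bullet> Z t \<omega>)" if "t \<in> {start \<nu> N..<\<nu>}" for t using that by (intro i) auto
    show "integrable M (\<lambda>\<omega>. \<Sum>t = start \<nu> N..<\<nu>. c t \<bullet> Z t \<omega>)" by (intro Bochner_Integration.integrable_sum j)
    have "(\<integral>\<omega>. (\<Sum>t = start \<nu> N..<\<nu>. c t \<bullet> Z t \<omega>) \<partial>M) = (\<Sum>t = start \<nu> N..<\<nu>. \<integral>\<omega>. c t \<bullet> Z t \<omega> \<partial>M)"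
      by (intro Bochner_Integration.integral_sum j)
    also have "\<dots> = (\<Sum>t = start \<nu> N..<\<nu>. c t \<bullet> (\<integral>\<omega>. Z t \<omega> \<partial>M))"
      by (intro sum.cong refl i(2)) auto
    finally show "(\<integral>\<omega>. (\<Sum>t = start \<nu> N..<\<nu>. c t \<bullet> Z t \<omega>) \<partial>M) = (\<Sum>t = start \<nu> N..<\<nu>. c t \<bullet> (\<integral>\<omega>. Z t \<omega> \<partial>M))" .
  qed
  note a = i[OF s order_refl] i[OF order_refl s] i2
  show "integrable M (\<lambda>\<omega>. stat_loss B S \<nu> Q q P \<eta> \<xi> N (\<lambda>t. Z t \<omega>))"
    unfolding stat_loss_def by (intro Bochner_Integration.integrable_add Bochner_Integration.integrable_diff a)
  show "(\<integral>\<omega>. stat_loss B S \<nu> Q q P \<eta> \<xi> N (\<lambda>t. Z t \<omega>) \<partial>M) = stat_loss B S \<nu> Q q P \<eta> \<xi> N (\<lambda>t. \<integral>\<omega>. Z t \<omega> \<partial>M)"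
    unfolding stat_loss_def
    by (subst Bochner_Integration.integral_add Bochner_Integration.integral_diff,
        (intro Bochner_Integration.integrable_diff a)+)+ (simp only: a)
qed

context est_problem
begin

lemma est_objective_eq:
  assumes q: "\<And>t. t \<in> {1..\<nu>2} \<Longrightarrow> q t = - (Q *v xr t)"
  shows "est_objective B \<Sigma>w \<nu>1 \<nu>2 M d Q q P \<eta> \<xi> = objective (empirical_stat M d) Q P \<eta> \<xi>"
  unfolding est_objective_def objective_def
proof (subst sum_distrib_left, rule sum.cong[OF refl])
  fix N assume N: "N \<in> {\<nu>1..\<nu>2}"
  have "stat_loss B \<Sigma>w \<nu>2 Q (\<lambda>t. - (Q *v xr t)) P \<eta> \<xi> N (empirical_stat M d N) =
    stat_loss B \<Sigma>w \<nu>2 Q q P \<eta> \<xi> N (\<lambda>t. (1 / real M) *\<^sub>R (\<Sum>i<M. indexed_stat N t (d i)))"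
    using start_bounds[OF N] q by (subst stat_loss_cong[where q'=q]) (auto simp: empirical_stat_def[abs_def])
  also have "\<dots> = 1 / real M * (\<Sum>i<M. if snd (d i) = N then est_loss B \<Sigma>w \<nu>2 Q q P \<eta> \<xi> N (fst (d i)) else 0)"
    unfolding stat_loss_scaleR stat_loss_sum stat_loss_indexed_stat ..
  also have "(\<Sum>i<M. if snd (d i) = N then est_loss B \<Sigma>w \<nu>2 Q q P \<eta> \<xi> N (fst (d i)) else 0) =
    (\<Sum>i | i < M \<and> snd (d i) = N. est_loss B \<Sigma>w \<nu>2 Q q P \<eta> \<xi> N (fst (d i)))"
    by (subst sum.inter_filter[symmetric]) (auto intro!: sum.cong)
  finally show "1 / real M * (\<Sum>i | i < M \<and> snd (d i) = N. est_loss B \<Sigma>w \<nu>2 Q q P \<eta> \<xi> N (fst (d i))) =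
    stat_loss B \<Sigma>w \<nu>2 Q (\<lambda>t. - (Q *v xr t)) P \<eta> \<xi> N (empirical_stat M d N)" by simp
qed

lemma est_optimal_iff:
  "est_optimal A B \<Sigma>w xr \<phi> \<nu>1 \<nu>2 M d Q q P \<eta> \<xi> \<longleftrightarrow>
    feasible_from 1 Q P \<eta> \<xi> \<and> (\<forall>t\<in>{1..\<nu>2}. q t = - (Q *v xr t)) \<and>
    (\<forall>Q' P' \<eta>' \<xi>'. feasible_from 1 Q' P' \<eta>' \<xi>' \<longrightarrow>
      objective (empirical_stat M d) Q P \<eta> \<xi> \<le> objective (empirical_stat M d) Q' P' \<eta>' \<xi>')"
proof (cases "feasible_from 1 Q P \<eta> \<xi> \<and> (\<forall>t\<in>{1..\<nu>2}. q t = - (Q *v xr t))")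
  case True
  then have e: "est_objective B \<Sigma>w \<nu>1 \<nu>2 M d Q q P \<eta> \<xi> = objective (empirical_stat M d) Q P \<eta> \<xi>"
    by (intro est_objective_eq) auto
  have "(\<forall>Q' q' P' \<eta>' \<xi>'. est_feasible A B xr \<phi> \<nu>2 Q' q' P' \<eta>' \<xi>' \<longrightarrow>
      objective (empirical_stat M d) Q P \<eta> \<xi> \<le> est_objective B \<Sigma>w \<nu>1 \<nu>2 M d Q' q' P' \<eta>' \<xi>') \<longleftrightarrow>
    (\<forall>Q' P' \<eta>' \<xi>'. feasible_from 1 Q' P' \<eta>' \<xi>' \<longrightarrow>
      objective (empirical_stat M d) Q P \<eta> \<xi> \<le> objective (empirical_stat M d) Q' P' \<eta>' \<xi>')" (is "?l \<longleftrightarrow> ?r")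
  proof
    assume l: ?l
    show ?r
    proof (intro allI impI)
      fix Q' P' \<eta>' \<xi>' assume "feasible_from 1 Q' P' \<eta>' \<xi>'"
      then have "est_feasible A B xr \<phi> \<nu>2 Q' (\<lambda>t. - (Q' *v xr t)) P' \<eta>' \<xi>'" by (simp add: est_feasible_iff)
      then show "objective (empirical_stat M d) Q P \<eta> \<xi> \<le> objective (empirical_stat M d) Q' P' \<eta>' \<xi>'"
        using l est_objective_eq[of "\<lambda>t. - (Q' *v xr t)" Q'] by metis
    qed
  next
    assume r: ?r
    show ?l
    proof (intro allI impI)
      fix Q' q' P' \<eta>' \<xi>' assume "est_feasible A B xr \<phi> \<nu>2 Q' q' P' \<eta>' \<xi>'"
      then have f: "feasible_from 1 Q' P' \<eta>' \<xi>'" "\<And>t. t \<in> {1..\<nu>2} \<Longrightarrow> q' t = - (Q' *v xr t)"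
        by (simp_all add: est_feasible_iff)
      show "objective (empirical_stat M d) Q P \<eta> \<xi> \<le> est_objective B \<Sigma>w \<nu>1 \<nu>2 M d Q' q' P' \<eta>' \<xi>'"
        using r f(1) est_objective_eq[of q' Q' M d P' \<eta>' \<xi>', OF f(2)] by simp
    qed
  qed
  then show ?thesis unfolding est_optimal_def e using True by (simp add: est_feasible_iff)
qed (auto simp: est_optimal_def est_feasible_iff)

lemma est_optimal_exists:
  assumes "1 \<le> M"
  shows "\<exists>Q q P \<eta> \<xi>. est_optimal A B \<Sigma>w xr \<phi> \<nu>1 \<nu>2 M d Q q P \<eta> \<xi>"
proof -
  have "\<exists>Q P \<eta> \<xi>. feasible_from 1 Q P \<eta> \<xi> \<and>
    (\<forall>Q' P' \<eta>' \<xi>'. feasible_from 1 Q' P' \<eta>' \<xi>' \<longrightarrow>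
      objective (empirical_stat M d) Q P \<eta> \<xi> \<le> objective (empirical_stat M d) Q' P' \<eta>' \<xi>')"
  proof (cases "\<exists>i<M. snd (d i) \<in> {\<nu>1..\<nu>2}")
    \<comment> \<open>Existence is claimed for every sample point, including those where every
      observed horizon lies outside the range; there the objective is identically zero.\<close>
    case False
    then have z: "empirical_stat M d N t = 0" if "N \<in> {\<nu>1..\<nu>2}" for N t
      unfolding empirical_stat_def using that by (auto simp: indexed_stat_def intro!: sum.neutral)
    then have "objective (empirical_stat M d) Q P \<eta> \<xi> = 0" for Q P \<eta> \<xi>
      unfolding objective_def by (intro sum.neutral ballI) (simp add: stat_loss_def)
    then show ?thesis using feasible_exists by simp
  next
    case True
    define H where "H = {snd (d i) | i. i < M \<and> snd (d i) \<in> {\<nu>1..\<nu>2}}"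
    define N0 where "N0 = Max H"
    have H: "finite H" "H \<noteq> {}" using True by (auto simp: H_def intro: finite_subset[of _ "{\<nu>1..\<nu>2}"])
    have "N0 \<in> H" unfolding N0_def by (rule Max_in[OF H])
    then obtain i0 where i0: "i0 < M" "snd (d i0) = N0" and N0: "N0 \<in> {\<nu>1..\<nu>2}" by (auto simp: H_def)
    define L where "L = (\<Sum>N = \<nu>1..\<nu>2. \<Sum>t = 1..\<nu>2. norm (empirical_stat M d N t))"
    \<comment> \<open>At least one of the \<open>M\<close> observations has horizon
      \<open>N0\<close>, so its relative frequency is at least \<open>1 / real M\<close>.\<close>
    have "informative (1 / real M) L N0 (empirical_stat M d)"
      unfolding informative_def
    proof (intro conjI ballI impI N0)
      fix N t assume Nt: "N \<in> {\<nu>1..\<nu>2}" "t \<in> {1..\<nu>2}"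
      have "norm (empirical_stat M d N t) \<le> (\<Sum>t = 1..\<nu>2. norm (empirical_stat M d N t))"
        using Nt by (intro member_le_sum) auto
      also have "\<dots> \<le> L" unfolding L_def using Nt
        by (intro member_le_sum[where f="\<lambda>N. \<Sum>t = 1..\<nu>2. norm (empirical_stat M d N t)"]) (auto intro: sum_nonneg)
      finally show "norm (empirical_stat M d N t) \<le> L" .
      show "0 \<le> snd (snd (empirical_stat M d N t))" by (rule empirical_stat_weight_nonneg)
      show "empirical_stat M d N t = 0" if "N0 < N"
      proof -
        have "snd (d i) \<noteq> N" if "i < M" for i
        proof
          assume "snd (d i) = N"
          then have "N \<in> H" using that Nt by (auto simp: H_def)
          then have "N \<le> N0" unfolding N0_def using H by simp
          then show False using \<open>N0 < N\<close> by simp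
        qed
        then show ?thesis by (auto simp: empirical_stat_def indexed_stat_def intro!: sum.neutral)
      qed
    next
      fix t
      have "(1::real) \<le> (\<Sum>i<M. if snd (d i) = N0 then 1 else 0)"
        using member_le_sum[of i0 "{..<M}" "\<lambda>i. if snd (d i) = N0 then 1 else (0::real)"] i0 by simp
      then show "1 / real M \<le> snd (snd (empirical_stat M d N0 t))"
        unfolding empirical_stat_weight by (simp add: divide_right_mono)
    qed
    moreover have "0 \<le> L" unfolding L_def by (intro sum_nonneg) auto
    ultimately show ?thesis using assms by (intro minimizer_exists[of "1 / real M" L N0]) auto
  qed
  then obtain Q P \<eta> \<xi> where "feasible_from 1 Q P \<eta> \<xi>"
    "\<forall>Q' P' \<eta>' \<xi>'. feasible_from 1 Q' P' \<eta>' \<xi>' \<longrightarrow>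
      objective (empirical_stat M d) Q P \<eta> \<xi> \<le> objective (empirical_stat M d) Q' P' \<eta>' \<xi>'" by blast
  then have "est_optimal A B \<Sigma>w xr \<phi> \<nu>1 \<nu>2 M d Q (\<lambda>t. - (Q *v xr t)) P \<eta> \<xi>"
    unfolding est_optimal_iff by simp
  then show ?thesis by blast
qed

end

text \<open>The policy is jointly measurable for each fixed horizon, so the state is treated for one
  horizon at a time and the countably many cases are glued.\<close>

lemma (in tracking_noise) agent_state_measurable:
  assumes \<kappa>: "\<And>N t. (\<lambda>(x0, h). \<kappa> x0 N t h) \<in> borel_measurable (borel \<Otimes>\<^sub>M Pi\<^sub>M {1..<t} (\<lambda>_. borel))"
  shows "agent_state xbar \<N> w A B \<nu> \<kappa> t \<in> borel_measurable M"
proof -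
  let ?X = "\<lambda>N t \<omega>. state A B (start \<nu> N) (xbar \<omega>) (control (start \<nu> N) (\<kappa> (xbar \<omega>) N) (\<lambda>t. w t \<omega>)) (\<lambda>t. w t \<omega>) t"
  have X: "?X N t \<in> borel_measurable M" for N
  proof (induction t)
    case (Suc t)
    show ?case
    proof (cases "Suc t \<le> start \<nu> N")
      case True
      then have "?X N (Suc t) = (\<lambda>\<omega>. if Suc t < start \<nu> N then 0 else xbar \<omega>)" by auto
      then show ?thesis by simp
    next
      case False
      then have t: "1 \<le> t" "start \<nu> N \<le> t" by (auto simp: start_def)
      note [measurable] = w_rv[OF t(1)] Suc
      have "(\<lambda>\<omega>. restrict (\<lambda>i. w i \<omega>) {1..<t}) \<in> measurable M (Pi\<^sub>M {1..<t} (\<lambda>_. borel))"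
        by (intro measurable_restrict w_rv) auto
      from measurable_compose[OF measurable_Pair[OF xbar_rv this] \<kappa>[of N t]]
      have [measurable]: "(\<lambda>\<omega>. \<kappa> (xbar \<omega>) N t (restrict (\<lambda>i. w i \<omega>) {1..<t})) \<in> borel_measurable M" by simp
      have "?X N (Suc t) = (\<lambda>\<omega>. A *v ?X N t \<omega> + B *v (\<kappa> (xbar \<omega>) N t (restrict (\<lambda>i. w i \<omega>) {1..<t}) + w t \<omega>))"
        using False t by (auto simp: control_def)
      moreover have "(\<lambda>\<omega>. A *v ?X N t \<omega> + B *v (\<kappa> (xbar \<omega>) N t (restrict (\<lambda>i. w i \<omega>) {1..<t}) + w t \<omega>)) \<in> borel_measurable M"
        by measurable
      ultimately show ?thesis by (simp only:)
    qed
  qed simp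
  have "(\<lambda>\<omega>. ?X (\<N> \<omega>) t \<omega>) \<in> borel_measurable M"
    by (rule measurable_compose_countable[OF X horizon_rv])
  then show ?thesis by (simp add: agent_state_def[abs_def] Let_def)
qed

section \<open>Population statistics and the final argument\<close>

locale tracking_estimation = tracking_noise M xbar \<N> w \<Sigma>w + est_problem A B \<Sigma>w xr \<phi> \<nu>1 \<nu>2
  for M :: "'a measure" and xbar :: "'a \<Rightarrow> real^'n" and \<N> w and \<Sigma>w :: "real^'m^'m"
    and A :: "real^'n^'n" and B :: "real^'m^'n" and xr \<phi> \<nu>1 \<nu>2 +
  fixes K :: "nat \<Rightarrow> real^'n^'m" and k :: "nat \<Rightarrow> real^'m"
  assumes horizon_AE: "AE \<omega> in M. \<N> \<omega> \<in> {\<nu>1..\<nu>2}"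
begin

definition trajectory :: "'a \<Rightarrow> nat \<Rightarrow> real^'n" where
  "trajectory \<omega> = closed_loop A B K k (start \<nu>2 (\<N> \<omega>)) (xbar \<omega>) (\<lambda>t. w t \<omega>)"

definition population_stat :: "nat \<Rightarrow> nat \<Rightarrow> (real^'n^'n) \<times> (real^'n) \<times> real" where
  "population_stat N t = expectation (\<lambda>\<omega>. indexed_stat N t (trajectory \<omega>, \<N> \<omega>))"

lemma trajectory_square_integrable: "square_integrable (\<lambda>\<omega>. trajectory \<omega> t)"
  unfolding trajectory_def
  by (rule square_integrable_closed_loop) (use xbar_sq in \<open>auto simp: square_integrable_def start_def\<close>)

lemma integrable_indexed_stat: "integrable M (\<lambda>\<omega>. indexed_stat N t (trajectory \<omega>, \<N> \<omega>))"
proof (rule Bochner_Integration.integrable_bound)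
  have [measurable]: "(\<lambda>\<omega>. trajectory \<omega> t) \<in> borel_measurable M"
    using trajectory_square_integrable by (simp add: square_integrable_def)
  show "integrable M (\<lambda>\<omega>. 2 + 2 * (norm (trajectory \<omega> t))\<^sup>2)"
    using trajectory_square_integrable by (simp add: square_integrable_def)
  show "(\<lambda>\<omega>. indexed_stat N t (trajectory \<omega>, \<N> \<omega>)) \<in> borel_measurable M"
    unfolding indexed_stat_def fst_conv snd_conv by measurable
  show "AE \<omega> in M. norm (indexed_stat N t (trajectory \<omega>, \<N> \<omega>)) \<le> norm (2 + 2 * (norm (trajectory \<omega> t))\<^sup>2)"
    using norm_stat_of_le by (auto simp: indexed_stat_def)
qed

lemma population_weight: "snd (snd (population_stat N t)) = prob {\<omega> \<in> space M. \<N> \<omega> = N}"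
proof -
  have "bounded_linear (\<lambda>z :: (real^'n^'n) \<times> (real^'n) \<times> real. snd (snd z))"
    using bounded_linear_compose[OF bounded_linear_snd bounded_linear_snd] .
  then have "snd (snd (population_stat N t)) = expectation (\<lambda>\<omega>. snd (snd (indexed_stat N t (trajectory \<omega>, \<N> \<omega>))))"
    unfolding population_stat_def by (intro integral_bounded_linear[symmetric] integrable_indexed_stat)
  also have "\<dots> = expectation (\<lambda>\<omega>. indicator {\<omega> \<in> space M. \<N> \<omega> = N} \<omega>)"
    by (intro Bochner_Integration.integral_cong) (auto simp: indexed_stat_def stat_of_def)
  also have "\<dots> = prob {\<omega> \<in> space M. \<N> \<omega> = N}"
    by (simp add: Int_absorb2)
  finally show ?thesis .
qed

lemma informative_population:
  assumes "0 < prob {\<omega> \<in> space M. \<N> \<omega> = \<nu>2}"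
  shows "informative (prob {\<omega> \<in> space M. \<N> \<omega> = \<nu>2})
    (\<Sum>N = \<nu>1..\<nu>2. \<Sum>t = 1..\<nu>2. norm (population_stat N t)) \<nu>2 population_stat"
  unfolding informative_def population_weight
proof (intro conjI ballI impI)
  fix N t assume Nt: "N \<in> {\<nu>1..\<nu>2}" "t \<in> {1..\<nu>2}"
  have "norm (population_stat N t) \<le> (\<Sum>t = 1..\<nu>2. norm (population_stat N t))"
    using Nt by (intro member_le_sum) auto
  also have "\<dots> \<le> (\<Sum>N = \<nu>1..\<nu>2. \<Sum>t = 1..\<nu>2. norm (population_stat N t))" using Nt
    by (intro member_le_sum[where f="\<lambda>N. \<Sum>t = 1..\<nu>2. norm (population_stat N t)"]) (auto intro: sum_nonneg)
  finally show "norm (population_stat N t) \<le> (\<Sum>N = \<nu>1..\<nu>2. \<Sum>t = 1..\<nu>2. norm (population_stat N t))" .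
qed (use horizons in auto)

text \<open>Almost surely exactly one horizon length in the range contributes to the sum, so the
  objective at the mean statistics is the mean loss of one trajectory.\<close>

lemma objective_population:
  "integrable M (\<lambda>\<omega>. est_loss B \<Sigma>w \<nu>2 Q (\<lambda>t. - (Q *v xr t)) P \<eta> \<xi> (\<N> \<omega>) (trajectory \<omega>))"
  "objective population_stat Q P \<eta> \<xi> =
    expectation (\<lambda>\<omega>. est_loss B \<Sigma>w \<nu>2 Q (\<lambda>t. - (Q *v xr t)) P \<eta> \<xi> (\<N> \<omega>) (trajectory \<omega>))"
proof -
  let ?q = "\<lambda>t. - (Q *v xr t)"
  let ?L = "\<lambda>\<omega>. est_loss B \<Sigma>w \<nu>2 Q ?q P \<eta> \<xi> (\<N> \<omega>) (trajectory \<omega>)"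
  let ?l = "\<lambda>N \<omega>. stat_loss B \<Sigma>w \<nu>2 Q ?q P \<eta> \<xi> N (\<lambda>t. indexed_stat N t (trajectory \<omega>, \<N> \<omega>))"
  have [measurable]: "(\<lambda>\<omega>. trajectory \<omega> t) \<in> borel_measurable M" for t
    using trajectory_square_integrable by (simp add: square_integrable_def)
  have Lm: "?L \<in> borel_measurable M"
  proof (rule measurable_compose_countable[OF _ horizon_rv])
    show "(\<lambda>\<omega>. est_loss B \<Sigma>w \<nu>2 Q ?q P \<eta> \<xi> N (trajectory \<omega>)) \<in> borel_measurable M" for N
      unfolding est_loss_def Let_def by measurable
  qed
  have i: "integrable M (?l N)" "expectation (?l N) = stat_loss B \<Sigma>w \<nu>2 Q ?q P \<eta> \<xi> N (population_stat N)"
    if "N \<in> {\<nu>1..\<nu>2}" for N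
    unfolding population_stat_def[abs_def] using start_bounds[OF that]
    by (intro stat_loss_integral integrable_indexed_stat; simp)+
  have ae: "AE \<omega> in M. (\<Sum>N = \<nu>1..\<nu>2. ?l N \<omega>) = ?L \<omega>"
    using horizon_AE
  proof eventually_elim
    case (elim \<omega>)
    have "(\<Sum>N = \<nu>1..\<nu>2. ?l N \<omega>) = (\<Sum>N = \<nu>1..\<nu>2. if \<N> \<omega> = N then ?L \<omega> else 0)"
      by (intro sum.cong refl) (auto simp: stat_loss_indexed_stat)
    then show ?case using elim by simp
  qed
  have isum: "integrable M (\<lambda>\<omega>. \<Sum>N = \<nu>1..\<nu>2. ?l N \<omega>)" using i by (intro Bochner_Integration.integrable_sum) auto
  then show "integrable M ?L" using integrable_cong_AE[OF borel_measurable_integrable[OF isum] Lm ae] by blast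
  have "objective population_stat Q P \<eta> \<xi> = (\<Sum>N = \<nu>1..\<nu>2. expectation (?l N))"
    unfolding objective_def using i by (intro sum.cong refl) simp
  also have "\<dots> = expectation (\<lambda>\<omega>. \<Sum>N = \<nu>1..\<nu>2. ?l N \<omega>)"
    using i by (intro Bochner_Integration.integral_sum[symmetric]) auto
  also have "\<dots> = expectation ?L"
    by (rule integral_cong_AE[OF borel_measurable_integrable[OF isum] Lm ae])
  finally show "objective population_stat Q P \<eta> \<xi> = expectation ?L" .
qed

text \<open>The Riccati solution is itself feasible, so a minimizer has expected loss at most that
  of the Riccati solution, which is all that the identification of the weight requires.\<close>

lemma population_minimizer_unique:
  assumes ctrl: "controllable A B" and inv: "invertible A" and \<nu>: "CARD('n) + 1 \<le> \<nu>2"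
    and cov: "pos_def (cov_matrix (uniform_measure M {\<omega> \<in> space M. \<N> \<omega> = \<nu>2}) xbar)"
    and pos: "0 < prob {\<omega> \<in> space M. \<N> \<omega> = \<nu>2}"
    and ric: "riccati_solution A B \<nu>2 Q' (\<lambda>t. - (Q' *v xr t)) P' \<eta>' \<xi>' K k F" and Q': "Q' \<in> psd_ball \<phi>"
    and f: "feasible_from 1 Q P \<eta> \<xi>"
    and min: "\<And>Q' P' \<eta>' \<xi>'. feasible_from 1 Q' P' \<eta>' \<xi>' \<Longrightarrow>
      objective population_stat Q P \<eta> \<xi> \<le> objective population_stat Q' P' \<eta>' \<xi>'"
  shows "Q = Q'"
proof -
  have f': "feasible_from 1 Q' P' \<eta>' \<xi>'"
    unfolding feasible_from_def
  proof (intro conjI ballI allI Q')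
    show "P' \<nu>2 = Q'" "\<eta>' \<nu>2 = - (Q' *v xr \<nu>2)" using ric by (auto simp: riccati_solution_def)
    show "psd (P' t)" if "t \<in> {1..\<nu>2}" for t using ric that by (auto simp: riccati_solution_def)
    show "0 \<le> stage_form A B Q' (- (Q' *v xr t)) (P' t) (\<eta>' t) (P' (t+1)) (\<eta>' (t+1)) (\<xi>' t) u x c"
      if "t \<in> {1..<\<nu>2}" for t u x c
      using ric that by (auto simp: riccati_solution_def intro: pos_def_form_nonneg)
  qed
  have N: "AE \<omega> in M. 1 \<le> \<N> \<omega>" using horizon_AE by eventually_elim (use horizons in auto)
  have le: "objective population_stat Q P \<eta> \<xi> \<le> objective population_stat Q' P' \<eta>' \<xi>'" by (rule min[OF f'])
  note z = f[unfolded feasible_from_def]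
  show ?thesis
    by (rule population_minimizer_weight[OF ctrl inv \<nu> cov pos N ric, where P=P and q="\<lambda>t. - (Q *v xr t)" and \<eta>=\<eta> and \<xi>=\<xi>,
          folded trajectory_def])
       (use z Q' le objective_population in \<open>auto simp: psd_ball_def\<close>)
qed

end

theorem theorem2:
  fixes A :: "real^'n^'n" and B :: "real^'m^'n"
    and Qbar :: "real^'n^'n" and \<Sigma>w :: "real^'m^'m"
    and xr :: "nat \<Rightarrow> real^'n" and \<phi> :: real and \<nu>1 \<nu>2 :: nat
    and \<P> :: "'a measure" and xbar :: "'a \<Rightarrow> real^'n" and \<N> :: "'a \<Rightarrow> nat"
    and w :: "nat \<Rightarrow> 'a \<Rightarrow> real^'m"
    and \<kappa> :: "real^'n \<Rightarrow> nat \<Rightarrow> nat \<Rightarrow> (nat \<Rightarrow> real^'m) \<Rightarrow> real^'m"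
    and x :: "nat \<Rightarrow> 'a \<Rightarrow> real^'n"
    and \<Omega> :: "'b measure" and D :: "nat \<Rightarrow> 'b \<Rightarrow> (nat \<Rightarrow> real^'n) \<times> nat"
  assumes "prob_space \<P>"
    and "xbar \<in> borel_measurable \<P>"
    and "\<N> \<in> measurable \<P> (count_space UNIV)"
    and "\<And>t. t \<ge> 1 \<Longrightarrow> w t \<in> borel_measurable \<P>"
    \<comment> \<open>the agent acts optimally, which determines the law of the states and the horizon\<close>
    and "optimal_policy \<P> xbar \<N> w A B Qbar xr \<nu>2 \<kappa>"
    and "x = agent_state xbar \<N> w A B \<nu>2 \<kappa>"
    \<comment> \<open>the observations are independent copies of the states and the horizon\<close>
    and "prob_space \<Omega>"
    and "prob_space.indep_vars \<Omega> (\<lambda>_. obs_space \<nu>2) D UNIV"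
    and "\<And>i. distr \<Omega> (obs_space \<nu>2) (D i) = distr \<P> (obs_space \<nu>2) (observation \<nu>2 x \<N>)"
    and "\<nu>2 \<ge> CARD('n) + 1"
    and "1 \<le> \<nu>1" and "\<nu>1 \<le> \<nu>2"
    and "measure \<P> {\<omega> \<in> space \<P>. \<N> \<omega> \<in> {\<nu>1..\<nu>2}} = 1"
    and "measure \<P> {\<omega> \<in> space \<P>. \<N> \<omega> = \<nu>2} > 0"
    and "controllable A B" and "rank B = CARD('m)" and "invertible A"
    and "prob_space.indep_sets \<P>
          (\<lambda>t. if t = 0
               then {(\<lambda>\<omega>. (xbar \<omega>, \<N> \<omega>)) -` S \<inter> space \<P> |S. S \<in> sets (borel \<Otimes>\<^sub>M count_space UNIV)}
               else {w t -` S \<inter> space \<P> |S. S \<in> sets borel}) UNIV"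
    and "\<And>t. t \<ge> 1 \<Longrightarrow> distr \<P> borel (w t) = distr \<P> borel (w 1)"
    and "\<And>t. t \<ge> 1 \<Longrightarrow> integrable \<P> (\<lambda>\<omega>. (norm (w t \<omega>))\<^sup>2)"
    and "\<And>t. t \<ge> 1 \<Longrightarrow> (\<integral>\<omega>. w t \<omega> \<partial>\<P>) = 0"
    and "\<And>t. t \<ge> 1 \<Longrightarrow> cov_matrix \<P> (w t) = \<Sigma>w"
    and "pos_def \<Sigma>w"
    and "pos_def (cov_matrix (uniform_measure \<P> {\<omega> \<in> space \<P>. \<N> \<omega> = \<nu>2}) xbar)"
    and "integrable \<P> (\<lambda>\<omega>. (norm (xbar \<omega>))\<^sup>2)"
    and "0 < \<phi>" and "Qbar \<in> psd_ball \<phi>"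
  shows "(\<forall>M\<ge>1. \<forall>\<omega>\<in>space \<Omega>. \<exists>Q q P \<eta> \<xi>.
            est_optimal A B \<Sigma>w xr \<phi> \<nu>1 \<nu>2 M (\<lambda>i. D i \<omega>) Q q P \<eta> \<xi>)
       \<and> (\<forall>Q q P \<eta> \<xi>.
            (\<forall>M\<ge>1. \<forall>\<omega>\<in>space \<Omega>.
               est_optimal A B \<Sigma>w xr \<phi> \<nu>1 \<nu>2 M (\<lambda>i. D i \<omega>)
                 (Q M \<omega>) (q M \<omega>) (P M \<omega>) (\<eta> M \<omega>) (\<xi> M \<omega>))
            \<longrightarrow> tendsto_in_prob \<Omega> Q (\<lambda>_. Qbar))"
proof -
  note prob_P = assms(1) and prob_\<Omega> = assms(7) and D_indep = assms(8) and D_distr = assms(9)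
  interpret prob_P: prob_space \<P> by (rule prob_P)
  interpret prob_\<Omega>: prob_space \<Omega> by (rule prob_\<Omega>)
  have Qbar: "psd Qbar" using assms(27) by (simp add: psd_ball_def)
  \<comment> \<open>The gains of the true weight; the trajectory of the locale is formed with
    them.\<close>
  obtain P0 \<eta>0 \<xi>0 K k F where ric: "riccati_solution A B \<nu>2 Qbar (\<lambda>t. - (Qbar *v xr t)) P0 \<eta>0 \<xi>0 K k F"
    using riccati_solution_exists[OF Qbar] by blast
  have N_AE: "AE \<omega> in \<P>. \<N> \<omega> \<in> {\<nu>1..\<nu>2}"
  proof -
    have "{\<omega> \<in> space \<P>. \<N> \<omega> \<in> {\<nu>1..\<nu>2}} = \<N> -` {\<nu>1..\<nu>2} \<inter> space \<P>" by auto
    then have "{\<omega> \<in> space \<P>. \<N> \<omega> \<in> {\<nu>1..\<nu>2}} \<in> sets \<P>" using measurable_sets[OF assms(3)] by simp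
    then show ?thesis using assms(13) by (simp add: prob_P.prob_eq_1)
  qed
  interpret tracking_estimation \<P> xbar \<N> w \<Sigma>w A B xr \<phi> \<nu>1 \<nu>2 K k
    by unfold_locales (use assms N_AE in \<open>auto simp del: One_nat_def\<close>)
  have \<kappa>: "(\<lambda>(x0, h). \<kappa> x0 N t h) \<in> borel_measurable (borel \<Otimes>\<^sub>M Pi\<^sub>M {1..<t} (\<lambda>_. borel))" for N t
    using assms(5) by (simp add: optimal_policy_def)
  have N1: "AE \<omega> in \<P>. 1 \<le> \<N> \<omega>" using N_AE by eventually_elim (use assms(11) in auto)
  have x_closed: "AE \<omega> in \<P>. \<forall>t\<le>\<nu>2. x t \<omega> = trajectory \<omega> t"
    unfolding assms(6) trajectory_def
    by (rule agent_state_eq_closed_loop[OF ric Qbar _ _ N1 assms(5)]) (use assms(11,12) in auto)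
  have obs: "observation \<nu>2 x \<N> \<in> measurable \<P> (obs_space \<nu>2)"
    unfolding observation_def[abs_def] obs_space_def assms(6)
    by (intro measurable_Pair measurable_restrict agent_state_measurable \<kappa> horizon_rv)
  have D[measurable]: "D i \<in> measurable \<Omega> (obs_space \<nu>2)" for i
    using D_indep by (auto simp: prob_\<Omega>.indep_vars_def)
  \<comment> \<open>The observations have the law of the agent's states, which agree almost surely
    with the feedback trajectory; so their mean statistics are the population ones.\<close>
  have lln: "(\<lambda>M. prob_\<Omega>.prob {\<omega> \<in> space \<Omega>. \<delta> \<le> norm (empirical_stat M (\<lambda>i. D i \<omega>) N t - population_stat N t)}) \<longlonglongrightarrow> 0"
    if t: "t \<in> {1..\<nu>2}" and \<delta>: "0 < \<delta>" for N t \<delta>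
  proof -
    note [measurable] = borel_measurable_indexed_stat[OF t, of N]
    have ae: "AE \<omega> in \<P>. indexed_stat N t (observation \<nu>2 x \<N> \<omega>) = indexed_stat N t (trajectory \<omega>, \<N> \<omega>)"
      using x_closed by eventually_elim (use t in \<open>auto simp: indexed_stat_def observation_def\<close>)
    have om: "(\<lambda>\<omega>. indexed_stat N t (observation \<nu>2 x \<N> \<omega>)) \<in> borel_measurable \<P>"
      using obs by measurable
    note tm = borel_measurable_integrable[OF integrable_indexed_stat[of N t]]
    have int: "integrable \<Omega> (\<lambda>\<omega>. indexed_stat N t (D 0 \<omega>))"
    proof (rule integrable_iff_if_distr_eq[OF D_distr D obs, THEN iffD2])
      show "integrable \<P> (\<lambda>\<omega>. indexed_stat N t (observation \<nu>2 x \<N> \<omega>))"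
        using integrable_cong_AE[OF om tm ae] integrable_indexed_stat by blast
    qed measurable
    have "prob_\<Omega>.expectation (\<lambda>\<omega>. indexed_stat N t (D 0 \<omega>)) =
        prob_P.expectation (\<lambda>\<omega>. indexed_stat N t (observation \<nu>2 x \<N> \<omega>))"
      by (rule integral_eq_if_distr_eq[OF D_distr D obs]) measurable
    also have "\<dots> = population_stat N t"
      unfolding population_stat_def by (rule integral_cong_AE[OF om tm ae])
    finally have mean: "prob_\<Omega>.expectation (\<lambda>\<omega>. indexed_stat N t (D 0 \<omega>)) = population_stat N t" .
    have "(\<lambda>M. prob_\<Omega>.prob {\<omega> \<in> space \<Omega>. \<delta> \<le> norm ((1 / real M) *\<^sub>R (\<Sum>i<M. indexed_stat N t (D i \<omega>))
        - prob_\<Omega>.expectation (\<lambda>\<omega>. indexed_stat N t (D 0 \<omega>)))}) \<longlonglongrightarrow> 0"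
    proof (rule prob_\<Omega>.weak_law_of_large_numbers[where X="\<lambda>i \<omega>. indexed_stat N t (D i \<omega>)", OF _ _ int \<delta>])
      show "prob_\<Omega>.indep_vars (\<lambda>_. borel) (\<lambda>i \<omega>. indexed_stat N t (D i \<omega>)) UNIV"
        by (rule prob_\<Omega>.indep_vars_compose2[OF D_indep]) measurable
      have "distr \<Omega> borel (\<lambda>\<omega>. indexed_stat N t (D i \<omega>)) =
          distr (distr \<P> (obs_space \<nu>2) (observation \<nu>2 x \<N>)) borel (indexed_stat N t)" for i
        unfolding D_distr[of i, symmetric] by (subst distr_distr) (auto simp: comp_def)
      then show "distr \<Omega> borel (\<lambda>\<omega>. indexed_stat N t (D i \<omega>)) = distr \<Omega> borel (\<lambda>\<omega>. indexed_stat N t (D 0 \<omega>))" for i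
        by simp
    qed
    then show ?thesis unfolding mean empirical_stat_def .
  qed
  show ?thesis
  proof (intro conjI allI ballI impI)
    show "\<exists>Q q P \<eta> \<xi>. est_optimal A B \<Sigma>w xr \<phi> \<nu>1 \<nu>2 M (\<lambda>i. D i \<omega>) Q q P \<eta> \<xi>" if "1 \<le> M" for M \<omega>
      by (rule est_optimal_exists[OF that])
  next
    fix Q q P \<eta> \<xi>
    assume opt: "\<forall>M\<ge>1. \<forall>\<omega>\<in>space \<Omega>. est_optimal A B \<Sigma>w xr \<phi> \<nu>1 \<nu>2 M (\<lambda>i. D i \<omega>)
      (Q M \<omega>) (q M \<omega>) (P M \<omega>) (\<eta> M \<omega>) (\<xi> M \<omega>)"
    show "tendsto_in_prob \<Omega> Q (\<lambda>_. Qbar)"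
      unfolding tendsto_in_prob_def
    proof (intro allI impI)
      fix \<epsilon> :: real assume \<epsilon>: "0 < \<epsilon>"
      obtain \<delta> where \<delta>: "0 < \<delta>" and stable:
        "\<And>S Q P \<eta> \<xi>. (\<And>N t. N \<in> {\<nu>1..\<nu>2} \<Longrightarrow> t \<in> {1..\<nu>2} \<Longrightarrow> norm (S N t - population_stat N t) < \<delta> \<and> 0 \<le> snd (snd (S N t))) \<Longrightarrow>
          feasible_from 1 Q P \<eta> \<xi> \<Longrightarrow>
          (\<And>Q' P' \<eta>' \<xi>'. feasible_from 1 Q' P' \<eta>' \<xi>' \<Longrightarrow> objective S Q P \<eta> \<xi> \<le> objective S Q' P' \<eta>' \<xi>') \<Longrightarrow>
          dist Q Qbar \<le> \<epsilon>"
      proof (rule minimizer_stable[OF assms(14) _ informative_population[OF assms(14)] \<epsilon>])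
        show "0 \<le> (\<Sum>N = \<nu>1..\<nu>2. \<Sum>t = 1..\<nu>2. norm (population_stat N t))" by (intro sum_nonneg) auto
        show "Q = Qbar" if "feasible_from 1 Q P \<eta> \<xi>"
          "\<And>Q' P' \<eta>' \<xi>'. feasible_from 1 Q' P' \<eta>' \<xi>' \<Longrightarrow>
            objective population_stat Q P \<eta> \<xi> \<le> objective population_stat Q' P' \<eta>' \<xi>'" for Q P \<eta> \<xi>
          by (rule population_minimizer_unique[OF assms(15,17,10,24,14) ric assms(27) that])
      qed blast
      define I where "I = {\<nu>1..\<nu>2} \<times> {1..\<nu>2}"
      define E where "E M z = {\<omega> \<in> space \<Omega>. \<delta> \<le> norm (empirical_stat M (\<lambda>i. D i \<omega>) (fst z) (snd z) - population_stat (fst z) (snd z))}" for M z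
      have E: "E M z \<in> sets \<Omega>" if "z \<in> I" for M z
      proof -
        have [measurable]: "indexed_stat (fst z) (snd z) \<in> borel_measurable (obs_space \<nu>2)"
          using that by (intro borel_measurable_indexed_stat) (auto simp: I_def)
        show ?thesis unfolding E_def empirical_stat_def by measurable
      qed
      \<comment> \<open>An arbitrary selection of minimizers need not be measurable. Its deviation
        set lies in the finite union of the events that one statistic is off by at least
        \<open>\<delta>\<close>; this union is measurable, and its outer measure is its
        probability.\<close>
      have bound: "outer_measure_of \<Omega> {\<omega> \<in> space \<Omega>. \<epsilon> < dist (Q M \<omega>) Qbar} \<le> ennreal (\<Sum>z\<in>I. prob_\<Omega>.prob (E M z))"
        if M: "1 \<le> M" for M
      proof -
        have "{\<omega> \<in> space \<Omega>. \<epsilon> < dist (Q M \<omega>) Qbar} \<subseteq> (\<Union>z\<in>I. E M z)"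
        proof
          fix \<omega> assume "\<omega> \<in> {\<omega> \<in> space \<Omega>. \<epsilon> < dist (Q M \<omega>) Qbar}"
          then have \<omega>: "\<omega> \<in> space \<Omega>" "\<epsilon> < dist (Q M \<omega>) Qbar" by auto
          show "\<omega> \<in> (\<Union>z\<in>I. E M z)"
          proof (rule ccontr)
            assume "\<omega> \<notin> (\<Union>z\<in>I. E M z)"
            then have near: "norm (empirical_stat M (\<lambda>i. D i \<omega>) N t - population_stat N t) < \<delta>"
              if "N \<in> {\<nu>1..\<nu>2}" "t \<in> {1..\<nu>2}" for N t
              using that \<omega>(1) by (force simp: I_def E_def not_le)
            have "est_optimal A B \<Sigma>w xr \<phi> \<nu>1 \<nu>2 M (\<lambda>i. D i \<omega>) (Q M \<omega>) (q M \<omega>) (P M \<omega>) (\<eta> M \<omega>) (\<xi> M \<omega>)"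
              using opt M \<omega>(1) by blast
            then have "dist (Q M \<omega>) Qbar \<le> \<epsilon>"
              unfolding est_optimal_iff using near empirical_stat_weight_nonneg by (intro stable) blast+
            then show False using \<omega>(2) by simp
          qed
        qed
        then have "outer_measure_of \<Omega> {\<omega> \<in> space \<Omega>. \<epsilon> < dist (Q M \<omega>) Qbar} \<le> outer_measure_of \<Omega> (\<Union>z\<in>I. E M z)"
          by (rule outer_measure_of_mono)
        also have "\<dots> = ennreal (prob_\<Omega>.prob (\<Union>z\<in>I. E M z))"
          using E by (subst outer_measure_of_eq) (auto simp: I_def prob_\<Omega>.emeasure_eq_measure intro!: sets.finite_UN)
        also have "\<dots> \<le> ennreal (\<Sum>z\<in>I. prob_\<Omega>.prob (E M z))"
          using E by (intro ennreal_leI prob_\<Omega>.finite_measure_subadditive_finite) (auto simp: I_def)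
        finally show ?thesis .
      qed
      have "(\<lambda>M. ennreal (\<Sum>z\<in>I. prob_\<Omega>.prob (E M z))) \<longlonglongrightarrow> ennreal (\<Sum>z\<in>I. 0)"
        unfolding E_def by (intro tendsto_ennrealI tendsto_sum lln) (auto simp: I_def \<delta>)
      then have lim: "(\<lambda>M. ennreal (\<Sum>z\<in>I. prob_\<Omega>.prob (E M z))) \<longlonglongrightarrow> 0" by simp
      show "(\<lambda>M. outer_measure_of \<Omega> {\<omega> \<in> space \<Omega>. \<epsilon> < dist (Q M \<omega>) Qbar}) \<longlonglongrightarrow> 0"
        by (rule tendsto_sandwich[OF _ _ tendsto_const lim])
           (use bound in \<open>auto simp: eventually_sequentially intro: exI[of _ 1]\<close>)
    qed
  qed
qed

end
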